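(* Consider periodic genus 0 Fock weights on the Aztec diamond, with arbitrary periods: angles $(\alpha_j),(\beta_j)$ periodic in $j$ with period $l\ge1$ and $(\gamma_j),(\delta_j)$ periodic in $j$ with period $k\ge1$, in $S^1$, satisfying the cyclic order condition $\boldsymbol\alpha<\boldsymbol\gamma<\boldsymbol\beta<\boldsymbol\delta$. Then: 1. The map from the (open) unit disc to the liquid region, sending $u_0$ to the point $(x,y)$ for which $u_0$ is a critical point of $F(\cdot;x,y)$, is a homeomorphism. 2. The arctic curve has a single component and has an explicit parametrization $u_0\in S^1\mapsto(x(u_0),y(u_0))$ by trigonometric (or rational) functions of $u_0$, obtained by solving in $(x,y)$ the linear system $$\frac{\partial}{\partial u}F(u_0;x,y)=0,\qquad \frac{\partial^2}{\partial u^2}F(u_0;x,y)=0.$$ It is thus a real algebraic curve of genus 0. In particular there is no gaseous phase. 3. The tangency points of the arctic curve with the bottom (resp. top, left, right) side of the square $[0,1]^2$ correspond to $u_0$ taking one of the values of $\boldsymbol\alpha$ (resp. $\boldsymbol\beta$, $\boldsymbol\gamma$, $\boldsymbol\delta$).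
   Context: **Model.** $\mathrm{Az}_n$ is the bipartite graph with white vertices $(\mathsf w_x,\mathsf w_y)$, $\mathsf w_x\in\{0,2,\dots,2n\}$, $\mathsf w_y\in\{1,3,\dots,2n-1\}$, black vertices $(\mathsf b_x,\mathsf b_y)$, $\mathsf b_x\in\{1,3,\dots,2n-1\}$, $\mathsf b_y\in\{0,2,\dots,2n\}$, and edges joining white and black vertices whose coordinates both differ by $\pm1$. Its train-tracks are the lines $y=2j-\frac32$ (angle $\alpha_j$), $y=2j-\frac12$ (angle $\beta_j$), $x=2j-\frac32$ (angle $\gamma_j$), $x=2j-\frac12$ (angle $\delta_j$), $1\le j\le n$; each edge is crossed at its midpoint by exactly one horizontal and one vertical such line. The angles are points of $S^1=\{z\in\mathbb C:|z|=1\}$. The genus 0 Fock weight (Kenyon's critical weight) of an edge crossed by train-tracks with angles $a,a'$ is $|a-a'|$, and the Boltzmann measure gives each perfect matching a probability proportional to the product of its edge weights. The condition $\boldsymbol\alpha<\boldsymbol\gamma<\boldsymbol\beta<\boldsymbol\delta$ means that for all indices, $\alpha_i,\gamma_j,\beta_m,\delta_\ell$ are in this strict cyclic order on $S^1$ (oriented counterclockwise); no order is imposed inside a family. **Rescaling.** One lets $n\to\infty$ and looks near vertices with coordinates $(2i,2j+1)$ with $(i/n,j/n)\to(x,y)\in[0,1]^2$. **Action.** $$F(u;x,y)=\frac1l\sum_{j=1}^l\bigl[y\log(u-\alpha_j)+(1-y)\log(u-\beta_j)\bigr]-\frac1k\sum_{j=1}^k\bigl[x\log(u-\gamma_j)+(1-x)\log(u-\delta_j)\bigr].$$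 Critical points of $F(\cdot;x,y)$ are zeros in $u\in\mathbb C\cup\{\infty\}$ of the meromorphic differential $\partial_uF(u;x,y)\,du$. At most two of them (with multiplicity) are not on $S^1$, and if so they are exchanged by $u\mapsto1/\bar u$. **Phases.** The liquid region is the set of $(x,y)$ for which $F(\cdot;x,y)$ has a critical point not on $S^1$ (equivalently, local edge probabilities have non-trivial limits in $(0,1)$); the frozen regions correspond to all critical points being on $S^1$ (limits of edge probabilities are $0$ or $1$). The arctic curve is the boundary of the liquid region. A gaseous phase would be a non-frozen, non-liquid region, enclosed by an inner component of the arctic curve. At the finitely many $u_0\in S^1$ where the linear system is singular because $u_0$ is one of the angles, the parametrization is extended by continuity. *)

theory Defs
  imports
    "HOL-Complex_Analysis.Complex_Analysis"
    "HOL-Computational_Algebra.Computational_Algebra"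
    "HOL-Algebra.Algebraic_Closure_Type"
begin

section \<open>Periodic genus 0 Fock weights\<close>

text \<open>
  The genus 0 Fock weights of all Aztec diamonds are determined by the angles of the train-tracks
  (an edge crossed by train-tracks of angles \<open>a\<close>, \<open>a'\<close> has weight \<open>\<bar>a - a'\<bar>\<close>). The families
  \<open>alpha\<close>, \<open>beta\<close> have period \<open>hper\<close> and \<open>gamma\<close>, \<open>delta\<close> have period \<open>vper\<close>. Train-tracks are
  numbered from 1; by periodicity the value at index 0 is one of the others.
\<close>

record fock_angles =
  alpha :: "nat \<Rightarrow> complex"
  beta :: "nat \<Rightarrow> complex"
  gamma :: "nat \<Rightarrow> complex"
  delta :: "nat \<Rightarrow> complex"
  hper :: nat
  vper :: nat

abbreviation unit_circle :: "complex set"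
  where "unit_circle \<equiv> sphere 0 1"

abbreviation unit_disc :: "complex set"
  where "unit_disc \<equiv> ball 0 1"

definition ccw_order :: "complex \<Rightarrow> complex \<Rightarrow> complex \<Rightarrow> complex \<Rightarrow> bool"
  where "ccw_order a b c d \<longleftrightarrow>
    (\<exists>r s t w. r < s \<and> s < t \<and> t < w \<and> w < r + 2 * pi \<and>
       a = cis r \<and> b = cis s \<and> c = cis t \<and> d = cis w)"

definition periodic_fock_angles :: "fock_angles \<Rightarrow> bool"
  where "periodic_fock_angles W \<longleftrightarrow>
    hper W \<ge> 1 \<and> vper W \<ge> 1 \<and>
    (\<forall>j. alpha W (j + hper W) = alpha W j) \<and> (\<forall>j. beta W (j + hper W) = beta W j) \<and>
    (\<forall>j. gamma W (j + vper W) = gamma W j) \<and> (\<forall>j. delta W (j + vper W) = delta W j) \<and>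
    range (alpha W) \<subseteq> unit_circle \<and> range (beta W) \<subseteq> unit_circle \<and>
    range (gamma W) \<subseteq> unit_circle \<and> range (delta W) \<subseteq> unit_circle \<and>
    (\<forall>i j m p. ccw_order (alpha W i) (gamma W j) (beta W m) (delta W p))"

definition angle_set :: "fock_angles \<Rightarrow> complex set"
  where "angle_set W = range (alpha W) \<union> range (beta W) \<union> range (gamma W) \<union> range (delta W)"


section \<open>The action and its critical points\<close>

text \<open>
  The action is multivalued; \<open>lg a\<close> is the branch of \<open>u \<mapsto> log (u - a)\<close> in use. Its derivative
  does not depend on the branches (lemma \<open>has_field_derivative_action\<close>) and is meromorphic on the
  whole plane.
\<close>

definition action ::
    "fock_angles \<Rightarrow> (complex \<Rightarrow> complex \<Rightarrow> complex) \<Rightarrow> real \<times> real \<Rightarrow> complex \<Rightarrow> complex"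
  where "action W lg = (\<lambda>(x, y) u.
    (\<Sum>j = 1..hper W. of_real y * lg (alpha W j) u + of_real (1 - y) * lg (beta W j) u)
        / of_nat (hper W)
    - (\<Sum>j = 1..vper W. of_real x * lg (gamma W j) u + of_real (1 - x) * lg (delta W j) u)
        / of_nat (vper W))"

definition action' :: "fock_angles \<Rightarrow> real \<times> real \<Rightarrow> complex \<Rightarrow> complex"
  where "action' W = (\<lambda>(x, y) u.
    (\<Sum>j = 1..hper W. of_real y / (u - alpha W j) + of_real (1 - y) / (u - beta W j))
        / of_nat (hper W)
    - (\<Sum>j = 1..vper W. of_real x / (u - gamma W j) + of_real (1 - x) / (u - delta W j))
        / of_nat (vper W))"

lemma has_field_derivative_log_branch:
  assumes "open U" "u \<in> U" "g holomorphic_on U" "\<And>w. w \<in> U \<Longrightarrow> exp (g w) = w - a"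
  shows "(g has_field_derivative 1 / (u - a)) (at u)"
proof -
  have g: "(g has_field_derivative deriv g u) (at u)"
    using assms holomorphic_derivI by blast
  have "((\<lambda>w. exp (g w)) has_field_derivative exp (g u) * deriv g u) (at u)"
    by (rule DERIV_fun_exp[OF g])
  moreover have "((\<lambda>w. exp (g w)) has_field_derivative 1) (at u)"
    by (rule has_field_derivative_transform_within_open[of "\<lambda>w. w - a" _ _ U])
      (use assms in \<open>auto intro!: derivative_eq_intros\<close>)
  ultimately have "exp (g u) * deriv g u = 1"
    using DERIV_unique by blast
  then have "deriv g u = 1 / (u - a)"
    using assms by (metis exp_not_eq_zero nonzero_eq_divide_eq mult.commute)
  with g show ?thesis by simp
qed

lemma has_field_derivative_action:
  assumes "open U" "u \<in> U"
    and "\<And>a. a \<in> angle_set W \<Longrightarrow> lg a holomorphic_on U"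
    and "\<And>a w. a \<in> angle_set W \<Longrightarrow> w \<in> U \<Longrightarrow> exp (lg a w) = w - a"
  shows "(action W lg p has_field_derivative action' W p u) (at u)"
proof -
  obtain x y where p: "p = (x, y)" by force
  have *: "(lg a has_field_derivative 1 / (u - a)) (at u)" if "a \<in> angle_set W" for a
    using has_field_derivative_log_branch[OF assms(1,2)] assms(3,4) that by blast
  have **: "((\<lambda>u. s * lg a u) has_field_derivative s / (u - a)) (at u)"
    if "a \<in> angle_set W" for a s
    using DERIV_cmult[OF *[OF that], of s] by simp
  show ?thesis
    unfolding p action_def action'_def prod.case
    by (intro DERIV_diff DERIV_cdivide DERIV_sum DERIV_add **) (auto simp: angle_set_def)
qed

text \<open>
  Points of the Riemann sphere are \<open>Some u\<close> and \<open>None\<close> (infinity). A critical point is a zero of the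
  differential \<open>action' W p u du\<close>; zeros are expressed by limits because the term \<open>action' W p u\<close>
  has no meaning as a value when \<open>u\<close> is a pole. In the coordinate \<open>w = 1 / u\<close> at infinity,
  \<open>du = - dw / w\<^sup>2\<close>.
\<close>

fun critical_point :: "fock_angles \<Rightarrow> real \<times> real \<Rightarrow> complex option \<Rightarrow> bool"
  where
    "critical_point W p (Some u) \<longleftrightarrow> (action' W p \<longlongrightarrow> 0) (at u)"
  | "critical_point W p None \<longleftrightarrow> ((\<lambda>w. - action' W p (1 / w) / w\<^sup>2) \<longlongrightarrow> 0) (at 0)"


section \<open>Phases\<close>

definition unit_square :: "(real \<times> real) set"
  where "unit_square = {0..1} \<times> {0..1}"

definition liquid_region :: "fock_angles \<Rightarrow> (real \<times> real) set"
  where "liquid_region W =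
    {p \<in> unit_square. \<exists>u. critical_point W p u \<and> u \<notin> Some ` unit_circle}"

definition frozen_region :: "fock_angles \<Rightarrow> (real \<times> real) set"
  where "frozen_region W =
    {p \<in> unit_square. \<forall>u. critical_point W p u \<longrightarrow> u \<in> Some ` unit_circle}"

definition arctic_curve :: "fock_angles \<Rightarrow> (real \<times> real) set"
  where "arctic_curve W = frontier (liquid_region W)"

text \<open>
  A gaseous phase is a non-liquid, non-frozen region enclosed by an inner component of the arctic
  curve. Since \<open>liquid_region\<close> and \<open>frozen_region\<close> are complementary by definition, we use the larger
  set of all non-liquid points that are not frozen \<^emph>\<open>or\<close> are enclosed by some component of the arctic
  curve, so that its emptiness has topological content.
\<close>

definition gaseous_region :: "fock_angles \<Rightarrow> (real \<times> real) set"
  where "gaseous_region W =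
    {p \<in> unit_square - liquid_region W.
       p \<notin> frozen_region W \<or> (\<exists>C \<in> components (arctic_curve W). p \<in> inside C)}"


section \<open>Tangency of a closed curve to a segment\<close>

definition tangent_to_side ::
    "(complex \<Rightarrow> real \<times> real) \<Rightarrow> complex \<Rightarrow> real \<times> real \<Rightarrow> real \<times> real \<Rightarrow> bool"
  where "tangent_to_side c u P Q \<longleftrightarrow>
    c u \<in> closed_segment P Q \<and>
    (\<exists>r. r \<noteq> 0 \<and> ((\<lambda>t. c (u * cis t)) has_vector_derivative r *\<^sub>R (Q - P)) (at 0))"


section \<open>Genus of a plane algebraic curve\<close>

text \<open>
  Bivariate polynomials are polynomials in the second variable with coefficients in the first one.
  Every function field of one variable over the complex numbers embeds in the algebraic closure of
  the field of rational functions.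
\<close>

type_synonym omega = "complex poly fract alg_closure"

definition const :: "complex \<Rightarrow> omega"
  where "const c = to_ac (to_fract [:c:])"

definition eval2 :: "('a \<Rightarrow> 'b) \<Rightarrow> 'a::zero poly poly \<Rightarrow> 'b \<Rightarrow> 'b \<Rightarrow> 'b::comm_ring_1"
  where "eval2 h f x y = poly (map_poly (\<lambda>q. poly (map_poly h q) x) f) y"

text \<open>
  If \<open>(\<xi>, \<eta>)\<close> is a generic point of the curve \<open>P = 0\<close>, then \<open>function_field \<xi> \<eta>\<close> is isomorphic to the
  field of fractions of \<open>\<complex>[X, Y] / (P)\<close>. The existence of a generic point forces \<open>P\<close> to be irreducible.
\<close>

definition generic_point :: "complex poly poly \<Rightarrow> omega \<Rightarrow> omega \<Rightarrow> bool"
  where "generic_point P \<xi> \<eta> \<longleftrightarrow> (\<forall>f. eval2 const f \<xi> \<eta> = 0 \<longleftrightarrow> P dvd f)"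

definition function_field :: "omega \<Rightarrow> omega \<Rightarrow> omega set"
  where "function_field \<xi> \<eta> =
    {eval2 const f \<xi> \<eta> / eval2 const g \<xi> \<eta> | f g. eval2 const g \<xi> \<eta> \<noteq> 0}"

text \<open>
  Places are represented by their normalized discrete valuations, extended by 0 outside \<open>K - {0}\<close> to
  make them unique. All places have degree 1 because the complex numbers are algebraically closed.
\<close>

definition places :: "omega set \<Rightarrow> (omega \<Rightarrow> int) set"
  where "places K =
    {v. (\<forall>f. f \<notin> K - {0} \<longrightarrow> v f = 0) \<and>
        (\<forall>f \<in> K - {0}. \<forall>g \<in> K - {0}. v (f * g) = v f + v g) \<and>
        (\<forall>f \<in> K - {0}. \<forall>g \<in> K - {0}. f + g \<noteq> 0 \<longrightarrow> v (f + g) \<ge> min (v f) (v g)) \<and>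
        (\<forall>c. v (const c) = 0) \<and>
        (\<exists>f \<in> K. v f = 1)}"

definition divisors :: "omega set \<Rightarrow> ((omega \<Rightarrow> int) \<Rightarrow> int) set"
  where "divisors K = {D. finite {v. D v \<noteq> 0} \<and> {v. D v \<noteq> 0} \<subseteq> places K}"

definition divisor_degree :: "((omega \<Rightarrow> int) \<Rightarrow> int) \<Rightarrow> int"
  where "divisor_degree D = (\<Sum>v | D v \<noteq> 0. D v)"

definition riemann_roch_space :: "omega set \<Rightarrow> ((omega \<Rightarrow> int) \<Rightarrow> int) \<Rightarrow> omega set"
  where "riemann_roch_space K D = {f \<in> K. f = 0 \<or> (\<forall>v \<in> places K. v f + D v \<ge> 0)}"

definition dim_over_complex :: "omega set \<Rightarrow> nat"
  where "dim_over_complex = vector_space.dim (\<lambda>c f. const c * f)"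

text \<open>Riemann's definition: the genus is the maximum of \<open>deg D + 1 - dim L(D)\<close>.\<close>

definition riemann_defect :: "omega set \<Rightarrow> ((omega \<Rightarrow> int) \<Rightarrow> int) \<Rightarrow> int"
  where "riemann_defect K D =
    divisor_degree D + 1 - int (dim_over_complex (riemann_roch_space K D))"

definition field_has_genus :: "omega set \<Rightarrow> nat \<Rightarrow> bool"
  where "field_has_genus K g \<longleftrightarrow>
    (\<forall>D \<in> divisors K. riemann_defect K D \<le> int g) \<and>
    (\<exists>D \<in> divisors K. riemann_defect K D = int g)"

definition curve_has_genus :: "complex poly poly \<Rightarrow> nat \<Rightarrow> bool"
  where "curve_has_genus P g \<longleftrightarrow>
    (\<exists>\<xi> \<eta>. generic_point P \<xi> \<eta> \<and> field_has_genus (function_field \<xi> \<eta>) g)"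

text \<open>
  The genus of a real curve is that of its complexification. An infinite real zero set determines
  the irreducible equation \<open>P\<close> up to a constant factor.
\<close>

definition real_algebraic_curve_of_genus :: "(real \<times> real) set \<Rightarrow> nat \<Rightarrow> bool"
  where "real_algebraic_curve_of_genus S g \<longleftrightarrow>
    infinite S \<and>
    (\<exists>P :: real poly poly.
       S = {(x, y). eval2 id P x y = 0} \<and>
       curve_has_genus (map_poly (map_poly complex_of_real) P) g)"

end

theory Submission
  imports Defs "Subresultants.Subresultant_Gcd"
begin

text \<open>
  Writing \<open>\<partial>\<^sub>u F = \<Sum> r\<^sub>a / (u - a)\<close> with real charges \<open>r\<^sub>a\<close> of total 0 on the circle, a zero off the
  circle and a double zero on the circle are both equivalent to the real equations
  \<open>\<Sum> r\<^sub>a / \<bar>u - a\<bar>\<^sup>2 = 0\<close> and \<open>\<Sum> r\<^sub>a a / \<bar>u - a\<bar>\<^sup>2 = 0\<close>, linear in \<open>(x, y)\<close>; the cyclic order makes their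
  determinant positive. The solution \<open>(x, y) = point u\<close> is continuous on the closed disc, and it is
  injective: if two points \<open>u\<close>, \<open>v\<close> gave the same charges, then \<open>\<Sum> r\<^sub>a q a / (\<bar>u - a\<bar>\<^sup>2 \<bar>v - a\<bar>\<^sup>2) = 0\<close> for
  all products \<open>q\<close> of two affine forms, but \<open>r\<^sub>a\<close> changes sign only four times around the circle, as does
  a suitable \<open>q\<close>. The topological assertions follow by invariance of domain.

  The coordinates of \<open>point u\<close> on the circle are rational functions of \<open>u\<close>. At \<open>u = a\<close> in the first
  family, the numerator of \<open>\<partial>\<^sub>u F\<close> has full degree and \<open>a\<close> as its only multiple root, of order 2; hence so
  it is generically, the parameter \<open>u\<close> lies in the field generated by the coordinates, and the curve
  has genus 0. No other real point lies on its implicit equation because a value of the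
  parametrization off the circle would be a double zero of \<open>\<partial>\<^sub>u F\<close> off the circle, and there are none.
\<close>

section \<open>The field of rational functions has genus 0\<close>

text \<open>The obstacle is the set of angles: there the linear system for \<open>(x, y)\<close> is
  singular, although these parameters carry the tangency points and the control of the generic
  double root. Hence Cramer's solution is written with all denominators \<open>|u - a|^2\<close>
  cleared, as a quotient of sums of nonnegative terms, so that one formula gives continuity, the
  range and the boundary values on the whole closed disc. At an angle of the first family
  \<open>y = 0\<close> and this family loses its charge; the remaining charges change sign only
  twice around the circle, and a single line separates them. Tangency, injectivity on the angles and
  the specialization for the genus are therefore settled there. The other families follow by
  symmetry: shifting the cyclic order by one family is a quarter turn of the square. As to the
  implicit equation, a resultant cuts out the right real points but need be neither real nor
  irreducible; the equation is taken instead as the generator of the prime ideal of real relations,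
  which contains the real and imaginary parts of the resultant.\<close>

lemma complex_poly_linear_induct [consumes 1, case_names const factor]:
  fixes p :: "complex poly"
  assumes "p \<noteq> 0"
    and const: "\<And>c. c \<noteq> 0 \<Longrightarrow> P [:c:]"
    and factor: "\<And>a q. q \<noteq> 0 \<Longrightarrow> P q \<Longrightarrow> P ([:- a, 1:] * q)"
  shows "P p"
  using assms(1)
proof (induction "Polynomial.degree p" arbitrary: p)
  case 0
  then obtain c where "p = [:c:]"
    by (metis degree_eq_zeroE)
  with const 0 show ?case
    by auto
next
  case (Suc n)
  obtain a where "poly p a = 0"
    using alg_closed_imp_poly_has_root[of p] Suc by auto
  then obtain q where q: "p = [:- a, 1:] * q"
    by (auto simp: poly_eq_0_iff_dvd elim: dvdE)
  then have "q \<noteq> 0"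
    using Suc by auto
  moreover from this have "Polynomial.degree p = Suc (Polynomial.degree q)"
    unfolding q by (subst degree_mult_eq) auto
  ultimately show ?case
    using Suc factor q by auto
qed

lemma order_linear: "Polynomial.order z [:- a, 1:] = (if z = a then 1 else 0 :: nat)" for z :: complex
  using order_power_n_n[of a 1] by (auto intro!: order_0I)

lemma order_linear_mult:
  fixes q :: "complex poly"
  assumes "q \<noteq> 0"
  shows "Polynomial.order z ([:- a, 1:] * q) = (if z = a then 1 else 0) + Polynomial.order z q"
proof -
  have "[:- a, 1:] * q \<noteq> 0"
    unfolding mult_eq_0_iff using assms by simp
  from order_mult[OF this] show ?thesis
    unfolding order_linear .
qed

text \<open>Peel off one root of \<open>q\<close> at a time. This is how nonnegativity at all finite
  places becomes the absence of a denominator.\<close>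

lemma complex_poly_dvd_if_order_le:
  fixes p q :: "complex poly"
  assumes "q \<noteq> 0" "p \<noteq> 0" "\<And>z. Polynomial.order z q \<le> Polynomial.order z p"
  shows "q dvd p"
  using assms
proof (induction q arbitrary: p rule: complex_poly_linear_induct)
  case (const c)
  then show ?case
    by (auto simp: dvd_iff_poly_eq_0 intro: is_unit_triv unit_imp_dvd)
next
  case (factor a q)
  have o: "Polynomial.order z ([:- a, 1:] * q) = (if z = a then 1 else 0) + Polynomial.order z q" for z
    using factor(1) by (rule order_linear_mult)
  then have "Polynomial.order a p \<noteq> 0"
    using factor.prems(2)[of a] by simp
  then have "poly p a = 0"
    by (metis order_0I)
  then obtain r where r: "p = [:- a, 1:] * r"
    by (auto simp: poly_eq_0_iff_dvd elim: dvdE)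
  with factor have "r \<noteq> 0"
    by auto
  moreover have "Polynomial.order z q \<le> Polynomial.order z r" for z
  proof -
    have "Polynomial.order z p = (if z = a then 1 else 0) + Polynomial.order z r"
      unfolding r using \<open>r \<noteq> 0\<close> by (rule order_linear_mult)
    then show ?thesis
      using factor.prems(2)[of z] o[of z] by simp
  qed
  ultimately have "q dvd r"
    by (rule factor.IH)
  then show ?case
    unfolding r by (rule mult_dvd_mono[OF dvd_refl])
qed

section \<open>Valuations and places of the field of rational functions\<close>

definition emb :: "complex poly \<Rightarrow> omega"
  where "emb p = to_ac (to_fract p)"

lemma emb_simps [simp]:
  "emb 0 = 0" "emb 1 = 1" "emb (p + q) = emb p + emb q" "emb (p * q) = emb p * emb q"
  "emb (p - q) = emb p - emb q" "emb (- p) = - emb p" "emb p = 0 \<longleftrightarrow> p = 0" "emb p = emb q \<longleftrightarrow> p = q"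
  by (simp_all add: emb_def)

lemma emb_power [simp]: "emb (p ^ n) = emb p ^ n"
  by (induction n) simp_all

lemma emb_sum: "emb (\<Sum>i\<in>S. f i) = (\<Sum>i\<in>S. emb (f i))"
  by (induction S rule: infinite_finite_induct) simp_all

lemma const_emb: "const c = emb [:c:]"
  by (simp add: const_def emb_def)

text \<open>The copy inside \<open>omega\<close> of the rational functions in one variable; the
  variable \<open>emb [:0, 1:]\<close> will be the parameter \<open>u\<close> of the curve.\<close>

definition rational_functions :: "omega set"
  where "rational_functions = range to_ac"

lemma rational_functions_cases:
  assumes "f \<in> rational_functions" "f \<noteq> 0"
  obtains p q where "p \<noteq> 0" "q \<noteq> 0" "f = emb p / emb q"
proof -
  obtain r where r: "f = to_ac r"
    using assms by (auto simp: rational_functions_def)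
  obtain a b where ab: "r = Fraction_Field.Fract a b" "b \<noteq> 0"
    by (cases r)
  have "f = emb a / emb b"
    unfolding r ab(1) emb_def by (simp add: Fract_conv_to_fract)
  with that[of a b] ab assms show ?thesis
    by auto
qed

lemma emb_divide_rational: "emb p / emb q \<in> rational_functions"
  unfolding emb_def rational_functions_def by (metis rangeI to_ac_divide)

text \<open>What a place becomes on nonzero polynomials, without the normalization that the value 1
  is taken. A place is recovered from this restriction by \<open>valuation_ext\<close>.\<close>

definition poly_valuation :: "(complex poly \<Rightarrow> int) \<Rightarrow> bool"
  where "poly_valuation w \<longleftrightarrow>
    (\<forall>p q. p \<noteq> 0 \<longrightarrow> q \<noteq> 0 \<longrightarrow> w (p * q) = w p + w q) \<and>
    (\<forall>p q. p \<noteq> 0 \<longrightarrow> q \<noteq> 0 \<longrightarrow> p + q \<noteq> 0 \<longrightarrow> w (p + q) \<ge> min (w p) (w q)) \<and>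
    (\<forall>c. c \<noteq> 0 \<longrightarrow> w [:c:] = 0)"

text \<open>The choice of numerator and denominator does not matter, see \<open>valuation_ext_quotient\<close>.\<close>

definition valuation_ext :: "(complex poly \<Rightarrow> int) \<Rightarrow> omega \<Rightarrow> int"
  where "valuation_ext w f = (if f \<in> rational_functions - {0}
    then (SOME n. \<exists>p q. p \<noteq> 0 \<and> q \<noteq> 0 \<and> f = emb p / emb q \<and> n = w p - w q) else 0)"

lemma valuation_ext_quotient:
  assumes w: "poly_valuation w" and pq: "p \<noteq> 0" "q \<noteq> 0"
  shows "valuation_ext w (emb p / emb q) = w p - w q"
proof -
  have "n = w p - w q" if n: "p' \<noteq> 0" "q' \<noteq> 0" "emb p / emb q = emb p' / emb q'" "n = w p' - w q'" for n p' q'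
  proof -
    have "emb (p * q') = emb (p' * q)"
      using n pq by (simp add: frac_eq_eq)
    then have "p * q' = p' * q"
      unfolding emb_simps(8) .
    then have "w (p * q') = w (p' * q)"
      by (rule arg_cong)
    then show ?thesis
      using w pq n by (simp add: poly_valuation_def)
  qed
  then have "(SOME n. \<exists>p' q'. p' \<noteq> 0 \<and> q' \<noteq> 0 \<and> emb p / emb q = emb p' / emb q' \<and> n = w p' - w q') = w p - w q"
    using pq by (intro some_equality) blast+
  then show ?thesis
    using pq emb_divide_rational by (simp add: valuation_ext_def)
qed

lemma valuation_ext_emb: "poly_valuation w \<Longrightarrow> p \<noteq> 0 \<Longrightarrow> valuation_ext w (emb p) = w p"
proof -
  assume w: "poly_valuation w" and p: "p \<noteq> 0"
  have "w 1 = 0"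
    using w unfolding poly_valuation_def one_pCons by (metis zero_neq_one)
  then show ?thesis
    using valuation_ext_quotient[OF w p, of 1] by simp
qed

lemma valuation_ext_outside: "f \<notin> rational_functions - {0} \<Longrightarrow> valuation_ext w f = 0"
  unfolding valuation_ext_def by (rule if_not_P)

lemma valuation_ext_place:
  assumes w: "poly_valuation w" and f: "f \<in> rational_functions" "valuation_ext w f = 1"
  shows "valuation_ext w \<in> places rational_functions"
  unfolding places_def
proof (intro CollectI conjI allI impI ballI)
  show "valuation_ext w f = 0" if "f \<notin> rational_functions - {0}" for f
    using that by (rule valuation_ext_outside)
next
  fix f g assume f: "f \<in> rational_functions - {0}" and g: "g \<in> rational_functions - {0}"
  obtain p q where pq: "p \<noteq> 0" "q \<noteq> 0" "f = emb p / emb q"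
    using f rational_functions_cases by auto
  obtain r s where rs: "r \<noteq> 0" "s \<noteq> 0" "g = emb r / emb s"
    using g rational_functions_cases by auto
  have v: "valuation_ext w f = w p - w q" "valuation_ext w g = w r - w s"
    using valuation_ext_quotient w pq rs by simp_all
  have "f * g = emb (p * r) / emb (q * s)"
    using pq rs by simp
  then show "valuation_ext w (f * g) = valuation_ext w f + valuation_ext w g"
    using valuation_ext_quotient[of w "p * r" "q * s"] w v pq rs by (simp add: poly_valuation_def)
  assume "f + g \<noteq> 0"
  have fg: "f + g = emb (p * s + r * q) / emb (q * s)"
    using pq rs by (simp add: add_frac_eq)
  have nz: "p * s + r * q \<noteq> 0"
  proof
    assume "p * s + r * q = 0"
    then have "f + g = 0"
      unfolding fg by simp
    with \<open>f + g \<noteq> 0\<close> show False ..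
  qed
  then have "w (p * s + r * q) \<ge> min (w (p * s)) (w (r * q))"
    using w pq rs unfolding poly_valuation_def by (metis mult_eq_0_iff)
  moreover have "valuation_ext w (f + g) = w (p * s + r * q) - w (q * s)"
    unfolding fg using nz pq rs by (intro valuation_ext_quotient w) auto
  ultimately show "min (valuation_ext w f) (valuation_ext w g) \<le> valuation_ext w (f + g)"
    using w v pq rs by (simp add: poly_valuation_def)
next
  show "valuation_ext w (const c) = 0" for c
  proof (cases "c = 0")
    case True
    then show ?thesis
      by (simp add: const_emb valuation_ext_def)
  next
    case False
    then show ?thesis
      using w by (simp add: const_emb valuation_ext_emb poly_valuation_def)
  qed
next
  show "\<exists>f\<in>rational_functions. valuation_ext w f = 1"
    using f by blast
qed

lemma poly_valuation_order: "poly_valuation (\<lambda>p. int (Polynomial.order z p))"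
  unfolding poly_valuation_def
proof (intro conjI allI impI)
  fix p q :: "complex poly" assume pq: "p \<noteq> 0" "q \<noteq> 0"
  then show "int (Polynomial.order z (p * q)) = int (Polynomial.order z p) + int (Polynomial.order z q)"
    by (simp add: order_mult)
  assume "p + q \<noteq> 0"
  let ?n = "min (Polynomial.order z p) (Polynomial.order z q)"
  have "[:- z, 1:] ^ ?n dvd p + q"
    using pq by (intro dvd_add) (simp_all only: order_divides min.cobounded1 min.cobounded2 simp_thms)
  then show "min (int (Polynomial.order z p)) (int (Polynomial.order z q)) \<le> int (Polynomial.order z (p + q))"
    using \<open>p + q \<noteq> 0\<close> unfolding order_divides by (simp flip: of_nat_min)
qed (auto intro: order_0I)

lemma poly_valuation_degree: "poly_valuation (\<lambda>p. - int (Polynomial.degree p))"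
  unfolding poly_valuation_def
proof (intro conjI allI impI)
  fix p q :: "complex poly"
  show "min (- int (Polynomial.degree p)) (- int (Polynomial.degree q)) \<le> - int (Polynomial.degree (p + q))"
    using degree_add_le_max[of p q] by simp
qed (simp_all add: degree_mult_eq)

definition finite_place :: "complex \<Rightarrow> omega \<Rightarrow> int"
  where "finite_place z = valuation_ext (\<lambda>p. int (Polynomial.order z p))"

definition infinite_place :: "omega \<Rightarrow> int"
  where "infinite_place = valuation_ext (\<lambda>p. - int (Polynomial.degree p))"

lemma finite_place_quotient: "p \<noteq> 0 \<Longrightarrow> q \<noteq> 0 \<Longrightarrow>
    finite_place z (emb p / emb q) = int (Polynomial.order z p) - int (Polynomial.order z q)"
  unfolding finite_place_def by (simp add: valuation_ext_quotient[OF poly_valuation_order])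

lemma infinite_place_quotient: "p \<noteq> 0 \<Longrightarrow> q \<noteq> 0 \<Longrightarrow>
    infinite_place (emb p / emb q) = int (Polynomial.degree q) - int (Polynomial.degree p)"
  unfolding infinite_place_def by (simp add: valuation_ext_quotient[OF poly_valuation_degree])

lemma finite_place_linear: "finite_place z (emb [:- a, 1:]) = (if z = a then 1 else 0)"
  unfolding finite_place_def by (subst valuation_ext_emb[OF poly_valuation_order], simp, unfold order_linear, simp)

lemma infinite_place_linear: "infinite_place (emb [:- a, 1:]) = - 1"
  unfolding infinite_place_def by (subst valuation_ext_emb[OF poly_valuation_degree]) simp_all

lemma inj_finite_place: "inj finite_place"
  using finite_place_linear by (metis injI zero_neq_one)

lemma infinite_place_neq: "infinite_place \<noteq> finite_place z"
  using finite_place_linear[of z z] infinite_place_linear[of z] by auto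

lemma places_are_places: "infinite_place \<in> places rational_functions"
  "finite_place z \<in> places rational_functions"
proof -
  have "finite_place z (emb [:- z, 1:]) = 1"
    unfolding finite_place_linear by simp
  moreover have "infinite_place (emb 1 / emb [:0, 1:]) = 1"
    by (subst infinite_place_quotient) simp_all
  moreover have "emb [:- z, 1:] \<in> rational_functions" "emb 1 / emb [:0, 1:] \<in> rational_functions"
    using emb_divide_rational[of "[:- z, 1:]" 1] emb_divide_rational[of 1 "[:0, 1:]"] by simp_all
  ultimately show "infinite_place \<in> places rational_functions" "finite_place z \<in> places rational_functions"
    unfolding finite_place_def infinite_place_def
    using valuation_ext_place poly_valuation_order poly_valuation_degree by blast+
qed

text \<open>Constants have value 0, so \<open>v\<close> is determined by its values on monic linear
  polynomials, any two of which differ by a constant. Either one of them has positive value and then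
  all others have value 0, which makes \<open>v\<close> a multiple of the order at a point; or all
  have the same negative value, which makes \<open>v\<close> a multiple of minus the degree. Since
  the value 1 is taken, the factor is 1.\<close>

lemma places_rational_functions: "places rational_functions = insert infinite_place (range finite_place)"
proof (intro equalityI subsetI)
  fix v assume v: "v \<in> places rational_functions"
  have R: "emb p \<in> rational_functions - {0}" if "p \<noteq> 0" for p
    using that emb_divide_rational[of p 1] by simp
  have mult: "v (emb (p * q)) = v (emb p) + v (emb q)" if "p \<noteq> 0" "q \<noteq> 0" for p q
    using v R that unfolding places_def by simp
  have add: "v (emb (p + q)) \<ge> min (v (emb p)) (v (emb q))" if "p \<noteq> 0" "q \<noteq> 0" "p + q \<noteq> 0" for p q
  proof -
    have "emb p + emb q \<noteq> 0"
      using that emb_simps(3,7) by metis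
    then show ?thesis
      using v R[OF that(1)] R[OF that(2)] unfolding places_def by simp
  qed
  have const: "v (emb [:c:]) = 0" for c
    using v unfolding places_def const_emb by simp
  define w where "w = (\<lambda>p. v (emb p))"
  have w: "poly_valuation w"
    using mult add const by (simp add: poly_valuation_def w_def)
  have ext: "v = valuation_ext w"
  proof
    fix f
    show "v f = valuation_ext w f"
    proof (cases "f \<in> rational_functions - {0}")
      case True
      then obtain p q where pq: "p \<noteq> 0" "q \<noteq> 0" "f = emb p / emb q"
        using rational_functions_cases by auto
      have "v (f * emb q) = v f + v (emb q)"
        using v True R[OF pq(2)] unfolding places_def by blast
      moreover have "f * emb q = emb p"
        using pq by simp
      ultimately show ?thesis
        using valuation_ext_quotient[OF w pq(1,2)] pq by (simp add: w_def)
    next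
      case False
      then show ?thesis
        using v unfolding places_def by (simp add: valuation_ext_outside)
    qed
  qed
  obtain f where f: "f \<in> rational_functions" "v f = 1"
    using v unfolding places_def by blast
  have "f \<noteq> 0"
    using f v unfolding places_def by force
  then obtain p q where pq: "p \<noteq> 0" "q \<noteq> 0" "f = emb p / emb q"
    using f rational_functions_cases by auto
  then have one: "w p - w q = 1"
    using f valuation_ext_quotient[OF w pq(1,2)] ext by simp
  have shift: "w [:- b, 1:] \<ge> min (w [:- a, 1:]) 0" for a b
  proof (cases "a = b")
    case False
    then show ?thesis
      using add[of "[:- a, 1:]" "[:a - b:]"] const[of "a - b"] by (simp add: w_def)
  qed simp
  have wmult: "w ([:- a, 1:] * p) = w [:- a, 1:] + w p" if "p \<noteq> 0" for a p
    unfolding w_def using that by (intro mult) auto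
  have wconst: "w [:c:] = 0" for c
    using const by (simp add: w_def)
  show "v \<in> insert infinite_place (range finite_place)"
  proof (cases "\<exists>a. w [:- a, 1:] > 0")
    case True
    then obtain a where a: "w [:- a, 1:] > 0"
      by blast
    have b: "w [:- b, 1:] = 0" if "b \<noteq> a" for b
    proof (rule antisym)
      show "0 \<le> w [:- b, 1:]"
        using shift[of a b] a by simp
      \<comment> \<open>Two positive values would make the value of the constant
        \<open>a - b\<close> positive.\<close>
      have "min (w [:- b, 1:]) (w (- [:- a, 1:])) \<le> w ([:- b, 1:] + - [:- a, 1:])"
        unfolding w_def using that by (intro add) auto
      moreover have "w ([:- 1:] * [:- a, 1:]) = w [:- a, 1:]"
        using mult[of "[:- 1:]" "[:- a, 1:]"] const[of "- 1"] by (simp add: w_def del: mult_pCons_left)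
      then have "w (- [:- a, 1:]) = w [:- a, 1:]"
        by (simp only: mult_pCons_left mult_zero_left pCons_0_0 add_0_right smult_minus_left smult_1_left)
      moreover have "[:- b, 1:] + - [:- a, 1:] = [:a - b:]"
        by simp
      ultimately show "w [:- b, 1:] \<le> 0"
        using a wconst[of "a - b"] by (simp add: min_def split: if_splits)
    qed
    have wp: "w p = int (Polynomial.order a p) * w [:- a, 1:]" if "p \<noteq> 0" for p
      using that
    proof (induction p rule: complex_poly_linear_induct)
      case (const c)
      then show ?case
        using wconst by (simp add: order_0I)
    next
      case (factor c q)
      have "Polynomial.order a ([:- c, 1:] * q) = (if a = c then 1 else 0) + Polynomial.order a q"
        using factor(1) by (rule order_linear_mult)
      then show ?case
        using wmult[OF factor(1), of c] factor(2) b[of c] by (simp add: distrib_right)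
    qed
    \<comment> \<open>Thus \<open>w [:- a, 1:]\<close> is a positive divisor of 1.\<close>
    have "w [:- a, 1:] * (int (Polynomial.order a p) - int (Polynomial.order a q)) = 1"
      using one wp[OF pq(1)] wp[OF pq(2)] by (simp add: algebra_simps)
    then have "w [:- a, 1:] = 1"
      using a pos_zmult_eq_1_iff by blast
    then have "v f = finite_place a f" for f
    proof (cases "f \<in> rational_functions - {0}")
      case True
      then obtain p q where pq: "p \<noteq> 0" "q \<noteq> 0" "f = emb p / emb q"
        using rational_functions_cases by auto
      then show ?thesis
        using \<open>w [:- a, 1:] = 1\<close> wp[OF pq(1)] wp[OF pq(2)] valuation_ext_quotient[OF w pq(1,2)]
        by (simp add: ext finite_place_quotient)
    next
      case out: False
      show ?thesis
        unfolding ext finite_place_def valuation_ext_outside[OF out] ..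
    qed
    then show ?thesis
      by blast
  next
    case False
    then have neg: "w [:- a, 1:] \<le> 0" for a
      by (simp add: not_less)
    then have eq: "w [:- a, 1:] = w [:- 0, 1:]" for a
      using shift[of a 0] shift[of 0 a] neg[of 0] neg[of a] by (simp add: min_def split: if_splits)
    have wp: "w p = int (Polynomial.degree p) * w [:- 0, 1:]" if "p \<noteq> 0" for p
      using that
    proof (induction p rule: complex_poly_linear_induct)
      case (const c)
      then show ?case
        using wconst by simp
    next
      case (factor c q)
      have "Polynomial.degree ([:- c, 1:] * q) = 1 + Polynomial.degree q"
        using degree_mult_eq[of "[:- c, 1:]" q] factor(1) by simp
      then show ?case
        using wmult[OF factor(1), of c] factor(2) eq[of c] by (simp add: distrib_right)
    qed
    have "- w [:- 0, 1:] * (int (Polynomial.degree q) - int (Polynomial.degree p)) = 1"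
      using one wp[OF pq(1)] wp[OF pq(2)] by (simp add: algebra_simps)
    moreover from this have "- w [:- 0, 1:] > 0"
      using neg[of 0] by (metis mult_zero_left neg_0_less_iff_less order_le_less zero_neq_one minus_zero)
    ultimately have w0: "w [:- 0, 1:] = - 1"
      using pos_zmult_eq_1_iff[of "- w [:- 0, 1:]"] by simp
    have "v f = infinite_place f" for f
    proof (cases "f \<in> rational_functions - {0}")
      case True
      then obtain p q where pq: "p \<noteq> 0" "q \<noteq> 0" "f = emb p / emb q"
        using rational_functions_cases by auto
      then show ?thesis
        using w0 wp[OF pq(1)] wp[OF pq(2)] valuation_ext_quotient[OF w pq(1,2)]
        by (simp add: ext infinite_place_quotient)
    next
      case out: False
      show ?thesis
        unfolding ext infinite_place_def valuation_ext_outside[OF out] ..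
    qed
    then show ?thesis
      by blast
  qed
qed (use places_are_places in auto)

section \<open>Riemann-Roch spaces of the field of rational functions\<close>

lemma vector_space_const: "vector_space (\<lambda>c f. const c * f)"
proof
  show "const a * (x + y) = const a * x + const a * y" for a x y
    by (simp add: distrib_left)
  have "[:a + b:] = [:a:] + [:b:]" "[:a * b:] = [:a:] * [:b:]" for a b :: complex
    by simp_all
  then show "const (a + b) * x = const a * x + const b * x" "const a * (const b * x) = const (a * b) * x" for a b x
    unfolding const_emb by (simp_all only: emb_simps distrib_right mult.assoc)
  show "const 1 * x = x" for x
    by (simp add: const_emb flip: one_pCons)
qed

text \<open>The monomials times \<open>g\<close> are a basis. The factor \<open>g\<close> will
  absorb the finite part of a divisor.\<close>

lemma dim_bounded_degree:
  assumes "g \<noteq> 0"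
  shows "dim_over_complex {g * emb q | q. Polynomial.degree q \<le> n} = Suc n"
proof -
  interpret vector_space "\<lambda>c f. const c * f"
    by (rule vector_space_const)
  define b where "b i = g * emb (Polynomial.monom 1 i)" for i
  have sum_b: "(\<Sum>i\<le>n. const (c i) * b i) = g * emb (\<Sum>i\<le>n. Polynomial.monom (c i) i)" for c
  proof -
    have "const (c i) * b i = g * emb (Polynomial.monom (c i) i)" for i
      unfolding b_def const_emb mult.left_commute[of _ g] emb_simps(4)[symmetric]
      by (simp add: smult_monom)
    then show ?thesis
      by (simp add: emb_sum sum_distrib_left)
  qed
  have inj: "inj b"
    using assms by (auto simp: b_def monom_eq_iff' intro!: injI)
  have ind: "independent (b ` {..n})"
  proof
    assume "dependent (b ` {..n})"
    then obtain u where u: "(\<exists>v\<in>b ` {..n}. u v \<noteq> 0)" "(\<Sum>v\<in>b ` {..n}. const (u v) * v) = 0"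
      unfolding dependent_finite[OF finite_imageI[OF finite_atMost]] by blast
    have "(\<Sum>i\<le>n. const (u (b i)) * b i) = 0"
      using u(2) inj by (subst (asm) sum.reindex) (auto intro: inj_on_subset)
    then have "(\<Sum>i\<le>n. Polynomial.monom (u (b i)) i) = 0"
      unfolding sum_b using assms by simp
    then have "Polynomial.coeff (\<Sum>i\<le>n. Polynomial.monom (u (b i)) i) j = 0" for j
      by simp
    then have "(if j \<le> n then u (b j) else 0) = 0" for j
      by (simp add: coeff_sum)
    then have "u (b j) = 0" if "j \<le> n" for j
      using that by (metis (full_types))
    with u(1) show False
      by auto
  qed
  have span: "span (b ` {..n}) = {g * emb q | q. Polynomial.degree q \<le> n}"
  proof (intro equalityI subsetI)
    fix f assume "f \<in> span (b ` {..n})"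
    then obtain u where "f = (\<Sum>v\<in>b ` {..n}. const (u v) * v)"
      unfolding span_finite[OF finite_imageI[OF finite_atMost]] by blast
    also have "\<dots> = (\<Sum>i\<le>n. const (u (b i)) * b i)"
      using inj by (subst sum.reindex) (auto intro: inj_on_subset)
    also note sum_b
    finally show "f \<in> {g * emb q | q. Polynomial.degree q \<le> n}"
      by (auto intro!: exI degree_sum_le order.trans[OF degree_monom_le])
  next
    fix f assume "f \<in> {g * emb q | q. Polynomial.degree q \<le> n}"
    then obtain q where q: "f = g * emb q" "Polynomial.degree q \<le> n"
      by blast
    have "q = (\<Sum>i\<le>n. Polynomial.monom (Polynomial.coeff q i) i)"
      using poly_as_sum_of_monoms'[OF q(2)] by simp
    then have "f = (\<Sum>i\<le>n. const (Polynomial.coeff q i) * b i)"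
      unfolding sum_b q(1) by simp
    also have "\<dots> \<in> span (b ` {..n})"
      by (intro span_sum span_scale span_base) auto
    finally show "f \<in> span (b ` {..n})" .
  qed
  have "card (b ` {..n}) = Suc n"
    using inj by (subst card_image) (auto intro: inj_on_subset)
  with dim_span_eq_card_independent[OF ind] show ?thesis
    unfolding dim_over_complex_def span by simp
qed

lemma order_prod_linear:
  fixes z :: complex
  assumes "finite Z"
  shows "Polynomial.order z (\<Prod>a\<in>Z. [:- a, 1:] ^ k a) = (if z \<in> Z then k z else 0)"
  using assms
proof (induction Z)
  case (insert a Z)
  have "(\<Prod>a\<in>Z. [:- a, 1:] ^ k a) \<noteq> 0"
    using insert(1) by (simp add: prod_zero_iff)
  moreover have "Polynomial.order z ([:- a, 1:] ^ k a) = (if z = a then k a else 0)"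
    using order_power_n_n[of a "k a"] by (auto intro!: order_0I)
  ultimately show ?case
    using insert by (subst prod.insert, simp, simp, subst order_mult) auto
qed simp

lemma degree_prod_linear:
  "Polynomial.degree (\<Prod>a\<in>Z. [:- a, 1:] ^ k a) = (\<Sum>a\<in>Z. k a)" for k :: "complex \<Rightarrow> nat"
  by (subst degree_prod_eq_sum_degree) (auto simp: degree_power_eq)

text \<open>Every finite place is principal: if \<open>g = A / B\<close> has the finite divisor
  \<open>- D\<close>, then \<open>f\<close> satisfies the conditions at finite places exactly when
  \<open>f / g\<close> is a polynomial, and the condition at infinity bounds its degree by the
  degree of \<open>D\<close>. The dimension is therefore \<open>divisor_degree D + 1\<close>, or 0
  when the degree is negative.\<close>

lemma riemann_defect_rational_functions:
  assumes D: "D \<in> divisors rational_functions"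
  shows "riemann_defect rational_functions D = min 0 (divisor_degree D + 1)"
proof -
  define n where "n z = D (finite_place z)" for z
  define Z where "Z = {z. n z \<noteq> 0}"
  have fin: "finite {v. D v \<noteq> 0}" and sub: "{v. D v \<noteq> 0} \<subseteq> insert infinite_place (range finite_place)"
    using D by (auto simp: divisors_def places_rational_functions)
  have finZ: "finite Z"
  proof (rule finite_imageD)
    show "finite (finite_place ` Z)"
      by (rule finite_subset[OF _ fin]) (auto simp: Z_def n_def)
    show "inj_on finite_place Z"
      using inj_finite_place by (rule inj_on_subset) auto
  qed
  have deg: "divisor_degree D = D infinite_place + (\<Sum>z\<in>Z. n z)"
  proof -
    have "divisor_degree D = sum D (insert infinite_place (finite_place ` Z))"
      unfolding divisor_degree_def
    proof (rule sum.mono_neutral_left)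
      show "{v. D v \<noteq> 0} \<subseteq> insert infinite_place (finite_place ` Z)"
        using sub by (auto simp: Z_def n_def)
    qed (use finZ in auto)
    also have "\<dots> = D infinite_place + sum D (finite_place ` Z)"
      using finZ infinite_place_neq by (subst sum.insert) auto
    also have "sum D (finite_place ` Z) = (\<Sum>z\<in>Z. n z)"
      using inj_finite_place by (subst sum.reindex) (auto simp: n_def intro: inj_on_subset)
    finally show ?thesis .
  qed
  \<comment> \<open>\<open>nat\<close> sorts the exponents by sign, so that \<open>A / B\<close> has
    at every \<open>z\<close> the order \<open>- n z\<close>, the least one that the divisor
    permits.\<close>
  define A B where "A = (\<Prod>a\<in>Z. [:- a, 1:] ^ nat (- n a))" and "B = (\<Prod>a\<in>Z. [:- a, 1:] ^ nat (n a))"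
  have AB: "A \<noteq> 0" "B \<noteq> 0"
    using finZ by (simp_all add: A_def B_def prod_zero_iff)
  have ord: "int (Polynomial.order z A) - int (Polynomial.order z B) = - n z" for z
    unfolding A_def B_def order_prod_linear[OF finZ] by (auto simp: Z_def)
  have degAB: "int (Polynomial.degree B) - int (Polynomial.degree A) = (\<Sum>z\<in>Z. n z)"
    unfolding A_def B_def degree_prod_linear of_nat_sum sum_subtractf[symmetric]
    by (intro sum.cong) auto
  define g where "g = emb A / emb B"
  have g: "g \<noteq> 0"
    using AB by (simp add: g_def)
  have L: "riemann_roch_space rational_functions D =
      {g * emb q | q. q = 0 \<or> int (Polynomial.degree q) \<le> divisor_degree D}"
  proof (intro equalityI subsetI)
    fix f assume f: "f \<in> riemann_roch_space rational_functions D"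
    show "f \<in> {g * emb q | q. q = 0 \<or> int (Polynomial.degree q) \<le> divisor_degree D}"
    proof (cases "f = 0")
      case True
      then show ?thesis
        by (auto intro!: exI[of _ 0])
    next
      case False
      have "f \<in> rational_functions"
        using f by (simp add: riemann_roch_space_def)
      from this False obtain p q where pq: "p \<noteq> 0" "q \<noteq> 0" "f = emb p / emb q"
        by (rule rational_functions_cases)
      have v: "finite_place z f + n z \<ge> 0" "infinite_place f + D infinite_place \<ge> 0" for z
      proof -
        have "\<forall>v \<in> insert infinite_place (range finite_place). v f + D v \<ge> 0"
          using f False unfolding riemann_roch_space_def places_rational_functions by blast
        then show "finite_place z f + n z \<ge> 0" "infinite_place f + D infinite_place \<ge> 0"
          unfolding n_def by blast+
      qed
      have "q * A dvd p * B"
      proof (rule complex_poly_dvd_if_order_le)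
        fix z
        have "int (Polynomial.order z p) - int (Polynomial.order z q) + n z \<ge> 0"
          using v(1)[of z] pq by (simp add: finite_place_quotient)
        then show "Polynomial.order z (q * A) \<le> Polynomial.order z (p * B)"
          using ord[of z] pq AB by (simp add: order_mult)
      qed (use pq AB in auto)
      then obtain r where r: "p * B = q * A * r"
        by (auto elim: dvdE)
      then have "r \<noteq> 0"
        using pq AB by auto
      have "emb p * emb B = emb q * emb A * emb r"
        using r by (metis emb_simps(4))
      then have "emb q * (f * emb B) = emb q * (emb A * emb r)"
        using pq by (simp add: mult_ac)
      then have "f * emb B = emb A * emb r"
        using pq(2) by simp
      then have fr: "f = g * emb r"
        using AB by (simp add: g_def eq_divide_eq)
      have "Polynomial.degree p + Polynomial.degree B = Polynomial.degree q + Polynomial.degree A + Polynomial.degree r"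
        using arg_cong[OF r, of Polynomial.degree] pq AB \<open>r \<noteq> 0\<close> by (simp add: degree_mult_eq)
      then have "int (Polynomial.degree r) \<le> divisor_degree D"
        using v(2) pq degAB deg by (simp add: infinite_place_quotient)
      with fr show ?thesis
        by blast
    qed
  next
    fix f assume "f \<in> {g * emb q | q. q = 0 \<or> int (Polynomial.degree q) \<le> divisor_degree D}"
    then obtain q where q: "f = g * emb q" "q = 0 \<or> int (Polynomial.degree q) \<le> divisor_degree D"
      by blast
    then have f: "f = emb (A * q) / emb B"
      by (simp add: g_def)
    show "f \<in> riemann_roch_space rational_functions D"
    proof (cases "q = 0")
      case True
      then show ?thesis
        using q emb_divide_rational[of 0 1] by (simp add: riemann_roch_space_def)
    next
      case False
      have "finite_place z f + n z \<ge> 0" for z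
        unfolding f using ord[of z] False AB by (subst finite_place_quotient) (auto simp: order_mult)
      moreover have "infinite_place f + D infinite_place \<ge> 0"
        unfolding f using q(2) False AB degAB deg by (subst infinite_place_quotient) (auto simp: degree_mult_eq)
      moreover have "f \<in> rational_functions"
        unfolding f by (rule emb_divide_rational)
      ultimately show ?thesis
        unfolding riemann_roch_space_def places_rational_functions by (auto simp: n_def)
    qed
  qed
  show ?thesis
  proof (cases "divisor_degree D \<ge> 0")
    case True
    then have "q = 0 \<or> int (Polynomial.degree q) \<le> divisor_degree D \<longleftrightarrow>
        Polynomial.degree q \<le> nat (divisor_degree D)" for q :: "complex poly"
      by (auto simp: le_nat_iff)
    then have "{g * emb q | q. q = 0 \<or> int (Polynomial.degree q) \<le> divisor_degree D} =
        {g * emb q | q. Polynomial.degree q \<le> nat (divisor_degree D)}"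
      by simp
    then show ?thesis
      unfolding riemann_defect_def L using True dim_bounded_degree[OF g] by simp
  next
    case False
    then have "riemann_roch_space rational_functions D = {0}"
      unfolding L by auto
    moreover have "dim_over_complex {0} = 0"
    proof -
      interpret vector_space "\<lambda>c f. const c * f"
        by (rule vector_space_const)
      show ?thesis
        using dim_span_eq_card_independent[OF independent_empty] by (simp add: dim_over_complex_def)
    qed
    ultimately show ?thesis
      using False by (simp add: riemann_defect_def)
  qed
qed

lemma genus_rational_functions: "field_has_genus rational_functions 0"
proof -
  have "(\<lambda>v. 0) \<in> divisors rational_functions" "divisor_degree (\<lambda>v. 0) = 0"
    by (simp_all add: divisors_def divisor_degree_def)
  then show ?thesis
    unfolding field_has_genus_def
    by (auto simp: riemann_defect_rational_functions intro!: bexI[of _ "\<lambda>v. 0"])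
qed

section \<open>Evaluation of bivariate polynomials\<close>

lemma comm_ring_hom_map_poly:
  assumes "comm_ring_hom h"
  shows "comm_ring_hom (map_poly h)"
proof -
  interpret h: comm_ring_hom h by fact
  interpret m: map_poly_comm_ring_hom h ..
  show ?thesis ..
qed

lemma map_poly_pCons_ring_hom:
  assumes "comm_ring_hom h"
  shows "map_poly h (pCons a p) = pCons (h a) (map_poly h p)"
proof -
  interpret h: comm_ring_hom h by fact
  show ?thesis
    by (rule h.map_poly_pCons_hom)
qed

lemma comm_ring_hom_eval:
  assumes "comm_ring_hom h"
  shows "comm_ring_hom (\<lambda>q. poly (map_poly h q) x)"
proof -
  interpret h: comm_ring_hom h by fact
  interpret m: map_poly_comm_ring_hom h ..
  show ?thesis
    by unfold_locales (simp_all add: m.hom_add m.hom_mult)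
qed

lemma comm_ring_hom_eval2:
  assumes "comm_ring_hom h"
  shows "comm_ring_hom (\<lambda>f. eval2 h f x y)"
  unfolding eval2_def by (intro comm_ring_hom_eval assms)

lemma comm_ring_hom_id: "comm_ring_hom (id :: 'a :: comm_ring_1 \<Rightarrow> 'a)"
  by unfold_locales simp_all

lemma comm_ring_hom_const: "comm_ring_hom const"
proof -
  have "const 0 = 0" "const 1 = 1"
    by (simp_all add: const_emb flip: one_pCons)
  moreover have "const (a + b) = const a + const b" "const (a * b) = const a * const b" for a b
    unfolding const_emb emb_simps(3)[symmetric] emb_simps(4)[symmetric] by simp_all
  ultimately show ?thesis
    by unfold_locales
qed

lemma inj_comm_ring_hom_emb: "inj_comm_ring_hom emb"
  by unfold_locales simp_all

lemma eval2_pCons: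
  assumes "comm_ring_hom h"
  shows "eval2 h (pCons a q) x y = poly (map_poly h a) x + y * eval2 h q x y"
proof -
  interpret e: comm_ring_hom "\<lambda>q. poly (map_poly h q) x"
    by (rule comm_ring_hom_eval[OF assms])
  show ?thesis
    unfolding eval2_def by (subst e.map_poly_pCons_hom) simp
qed

lemma poly_map_pCons:
  assumes "comm_ring_hom h"
  shows "poly (map_poly h (pCons a q)) x = h a + x * poly (map_poly h q) x"
proof -
  interpret h: comm_ring_hom h by fact
  show ?thesis
    by (subst h.map_poly_pCons_hom) simp
qed

lemma eval2_of_real: "eval2 id (map_poly (map_poly complex_of_real) q) (of_real x) (of_real y) =
    of_real (eval2 id q x y)"
proof -
  have r: "comm_ring_hom complex_of_real"
    by unfold_locales
  have 1: "poly (map_poly id (map_poly complex_of_real a)) (of_real x) = of_real (poly (map_poly id a) x)" for a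
    by (induction a) (simp_all add: map_poly_pCons_ring_hom[OF r])
  show ?thesis
  proof (induction q)
    case 0
    show ?case
      by (simp add: eval2_def)
  next
    case (pCons a q)
    show ?case
      unfolding map_poly_pCons_ring_hom[OF comm_ring_hom_map_poly[OF r]] eval2_pCons[OF comm_ring_hom_id]
        1 pCons.IH by simp
  qed
qed

text \<open>The Horner steps of the inductions in \<open>homogenize\<close>, over an arbitrary field
  because they serve both for the values at a point and in \<open>omega\<close>.\<close>

lemma clear_denominator:
  fixes H :: "'a :: field"
  assumes "H \<noteq> 0"
  shows "a * H ^ Suc M + F * (H ^ M * V) = H ^ Suc M * (a + F / H * V)"
    and "H ^ N * b * H ^ Suc M + F * (H ^ M * V) * H ^ N = H ^ (N + Suc M) * (b + F / H * V)"
  using assms by (simp_all add: distrib_left power_add mult_ac)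

text \<open>The numerator of \<open>q (f / h, g / h)\<close>, seen both as a function on the plane and as an
  element of the field of rational functions.\<close>

lemma homogenize:
  fixes f g h :: "complex poly"
  assumes h: "h \<noteq> 0"
  shows "\<exists>w M. (\<forall>u. poly h u \<noteq> 0 \<longrightarrow>
      poly w u = poly h u ^ M * eval2 id q (poly f u / poly h u) (poly g u / poly h u)) \<and>
    emb w = emb h ^ M * eval2 const q (emb f / emb h) (emb g / emb h)"
proof -
  have 1: "\<exists>w M. (\<forall>u. poly h u \<noteq> 0 \<longrightarrow>
      poly w u = poly h u ^ M * poly (map_poly id r) (poly f u / poly h u)) \<and>
    emb w = emb h ^ M * poly (map_poly const r) (emb f / emb h)" for r
  proof (induction r)
    case 0
    show ?case
      by (auto intro!: exI[of _ 0])
  next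
    case (pCons a r)
    then obtain w M where w: "\<And>u. poly h u \<noteq> 0 \<Longrightarrow>
        poly w u = poly h u ^ M * poly (map_poly id r) (poly f u / poly h u)"
      "emb w = emb h ^ M * poly (map_poly const r) (emb f / emb h)"
      by blast
    show ?case
    proof (intro exI conjI allI impI)
      fix u assume u: "poly h u \<noteq> 0"
      show "poly (Polynomial.smult a (h ^ Suc M) + f * w) u =
          poly h u ^ Suc M * poly (map_poly id (pCons a r)) (poly f u / poly h u)"
        unfolding poly_map_pCons[OF comm_ring_hom_id] poly_add poly_smult poly_power poly_mult w(1)[OF u] id_apply
        by (rule clear_denominator(1)[OF u])
    next
      have "emb (Polynomial.smult a (h ^ Suc M)) = const a * emb h ^ Suc M"
        unfolding const_emb emb_power[symmetric] emb_simps(4)[symmetric] by simp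
      then show "emb (Polynomial.smult a (h ^ Suc M) + f * w) =
          emb h ^ Suc M * poly (map_poly const (pCons a r)) (emb f / emb h)"
        unfolding poly_map_pCons[OF comm_ring_hom_const] emb_simps(3) emb_simps(4)[of f w] w(2)
        using clear_denominator(1)[of "emb h"] h by simp
    qed
  qed
  show ?thesis
  proof (induction q)
    case 0
    show ?case
      by (auto simp: eval2_def intro!: exI[of _ 0])
  next
    case (pCons a q)
    obtain w M where w: "\<And>u. poly h u \<noteq> 0 \<Longrightarrow>
        poly w u = poly h u ^ M * eval2 id q (poly f u / poly h u) (poly g u / poly h u)"
      "emb w = emb h ^ M * eval2 const q (emb f / emb h) (emb g / emb h)"
      using pCons by blast
    obtain v N where v: "\<And>u. poly h u \<noteq> 0 \<Longrightarrow>
        poly v u = poly h u ^ N * poly (map_poly id a) (poly f u / poly h u)"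
      "emb v = emb h ^ N * poly (map_poly const a) (emb f / emb h)"
      using 1[of a] by blast
    show ?case
    proof (intro exI conjI allI impI)
      fix u assume u: "poly h u \<noteq> 0"
      show "poly (v * h ^ Suc M + g * w * h ^ N) u =
          poly h u ^ (N + Suc M) * eval2 id (pCons a q) (poly f u / poly h u) (poly g u / poly h u)"
        unfolding eval2_pCons[OF comm_ring_hom_id] poly_add poly_power poly_mult w(1)[OF u] v(1)[OF u]
        by (rule clear_denominator(2)[OF u])
    next
      show "emb (v * h ^ Suc M + g * w * h ^ N) =
          emb h ^ (N + Suc M) * eval2 const (pCons a q) (emb f / emb h) (emb g / emb h)"
        unfolding eval2_pCons[OF comm_ring_hom_const] emb_simps(3,4) emb_power w(2) v(2)
        using h by (intro clear_denominator(2)) simp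
    qed
  qed
qed

lemma infinite_unit_circle: "infinite unit_circle"
proof
  assume "finite unit_circle"
  moreover have "connected unit_circle"
    by (rule connected_sphere) simp
  ultimately obtain a where "unit_circle = {} \<or> unit_circle = {a}"
    using connected_finite_iff_sing by blast
  moreover have "1 \<in> unit_circle" "- 1 \<in> unit_circle"
    by simp_all
  ultimately have "(1 :: complex) = - 1"
    by (metis emptyE singletonD)
  then show False
    by simp
qed

lemma poly_zero_on_circle:
  assumes "\<And>u. u \<in> unit_circle \<Longrightarrow> poly p u = 0"
  shows "p = 0"
proof (rule ccontr)
  assume "p \<noteq> 0"
  then have "finite {u. poly p u = 0}"
    by (rule poly_roots_finite)
  moreover have "unit_circle \<subseteq> {u. poly p u = 0}"
    using assms by auto
  ultimately show False
    using infinite_unit_circle finite_subset by blast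
qed

text \<open>Both sides say that the numerator of \<open>q (f / h, g / h)\<close> is the zero
  polynomial: in \<open>omega\<close> because \<open>emb\<close> is injective, on the circle because
  it is infinite. Algebraic relations between the coordinates can thus be tested on the points of
  the curve.\<close>

lemma eval2_const_eq_0_iff:
  assumes h: "\<And>u. u \<in> unit_circle \<Longrightarrow> poly h u \<noteq> 0"
  shows "eval2 const q (emb f / emb h) (emb g / emb h) = 0 \<longleftrightarrow>
    (\<forall>u\<in>unit_circle. eval2 id q (poly f u / poly h u) (poly g u / poly h u) = 0)"
proof -
  have "h \<noteq> 0"
    using h[of 1] by auto
  then obtain w M where w: "\<And>u. poly h u \<noteq> 0 \<Longrightarrow>
      poly w u = poly h u ^ M * eval2 id q (poly f u / poly h u) (poly g u / poly h u)"
    "emb w = emb h ^ M * eval2 const q (emb f / emb h) (emb g / emb h)"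
    using homogenize[of h q f g] by blast
  have "emb w = 0 \<longleftrightarrow> eval2 const q (emb f / emb h) (emb g / emb h) = 0"
    unfolding w(2) using \<open>h \<noteq> 0\<close> by simp
  then have "eval2 const q (emb f / emb h) (emb g / emb h) = 0 \<longleftrightarrow> w = 0"
    by simp
  also have "\<dots> \<longleftrightarrow> (\<forall>u\<in>unit_circle. poly w u = 0)"
    using poly_zero_on_circle[of w] by auto
  also have "\<dots> \<longleftrightarrow> (\<forall>u\<in>unit_circle. eval2 id q (poly f u / poly h u) (poly g u / poly h u) = 0)"
    using w(1) h by (intro ball_cong refl) simp
  finally show ?thesis .
qed

section \<open>Real equations\<close>

text \<open>A nonzero prime ideal that contains no nonzero polynomial in the first variable alone is
  principal, as for height one primes of a factorial ring. The generator is the primitive part of an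
  element of least degree: it is in the ideal because the content is not, pseudo-division by it
  leaves remainder 0, and Gauss's lemma removes the multiplier.\<close>

lemma principal_prime:
  fixes I :: "real poly poly set"
  assumes diff: "\<And>p q. p \<in> I \<Longrightarrow> q \<in> I \<Longrightarrow> p - q \<in> I"
    and mult: "\<And>p q. p \<in> I \<Longrightarrow> p * q \<in> I"
    and prime: "\<And>p q. p * q \<in> I \<Longrightarrow> p \<in> I \<or> q \<in> I"
    and const: "\<And>a. [:a:] \<in> I \<Longrightarrow> a = 0"
    and ne: "p0 \<in> I" "p0 \<noteq> 0"
  obtains P where "\<And>q. q \<in> I \<longleftrightarrow> P dvd q"
proof -
  obtain Q where Q: "Q \<in> I" "Q \<noteq> 0" and min: "\<And>q. q \<in> I \<Longrightarrow> q \<noteq> 0 \<Longrightarrow> Polynomial.degree Q \<le> Polynomial.degree q"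
    using ex_has_least_nat[of "\<lambda>q. q \<in> I \<and> q \<noteq> 0" p0 Polynomial.degree] ne by blast
  define P where "P = primitive_part Q"
  have "[:content Q:] * P = Q"
    by (simp add: P_def)
  then have "[:content Q:] * P \<in> I"
    using Q by simp
  then have "[:content Q:] \<in> I \<or> P \<in> I"
    by (rule prime)
  then have "P \<in> I"
    using const[of "content Q"] Q by auto
  have P: "P \<noteq> 0" "content P = 1" "primitive_part P = P" "Polynomial.degree P = Polynomial.degree Q"
    using Q by (simp_all add: P_def primitive_part_prim)
  show ?thesis
  proof (rule that[of P], rule iffI)
    fix q assume q: "q \<in> I"
    obtain s r where sr: "pseudo_divmod q P = (s, r)"
      by force
    define a where "a = Polynomial.coeff P (Polynomial.degree P) ^ (Suc (Polynomial.degree q) - Polynomial.degree P)"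
    have "Polynomial.smult a q = P * s + r" and r: "r = 0 \<or> Polynomial.degree r < Polynomial.degree P"
      unfolding a_def by (rule pseudo_divmod[OF P(1) sr])+
    then have "r = q * [:a:] - P * s"
      by simp
    moreover have "q * [:a:] - P * s \<in> I"
      by (intro diff mult q \<open>P \<in> I\<close>)
    ultimately have "r \<in> I"
      by (simp only:)
    then have "r = 0"
      using r min[of r] P(4) by (cases "r = 0") auto
    with \<open>Polynomial.smult a q = P * s + r\<close> have "P dvd Polynomial.smult a q"
      by simp
    \<comment> \<open>Gauss's lemma: the primitive divisor \<open>P\<close> divides the primitive
      part, which is that of \<open>q\<close> up to the unit \<open>unit_factor a\<close>.\<close>
    then have "P dvd primitive_part (Polynomial.smult a q)"
      using primitive_part_dvd_primitive_partI[of P "Polynomial.smult a q"] P(3) by simp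
    moreover have "a \<noteq> 0"
      using P(1) by (simp add: a_def)
    then have "unit_factor a dvd 1"
      by (rule unit_factor_is_unit)
    then obtain b where b: "1 = unit_factor a * b"
      by (rule dvdE)
    ultimately have "P dvd Polynomial.smult b (Polynomial.smult (unit_factor a) (primitive_part q))"
      unfolding primitive_part_smult by - (rule dvd_smult)
    also have "\<dots> = primitive_part q"
      unfolding smult_smult mult.commute[of b] b[symmetric] by simp
    finally have "P dvd Polynomial.smult (content q) (primitive_part q)"
      by (rule dvd_smult)
    then show "P dvd q"
      by simp
  next
    fix q assume "P dvd q"
    then show "q \<in> I"
      using mult \<open>P \<in> I\<close> by (auto elim: dvdE)
  qed
qed

text \<open>The type classes admit the complex numbers and \<open>omega\<close>: the lemma serves to
  eliminate the parameter, and for discriminants both generically and after specialization.\<close>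

lemma resultant_eq_0_iff_common_root:
  fixes p q :: "'a :: {alg_closed_field, euclidean_ring_gcd, semiring_gcd_mult_normalize} poly"
  assumes "p \<noteq> 0"
  shows "resultant p q = 0 \<longleftrightarrow> (\<exists>x. poly p x = 0 \<and> poly q x = 0)"
proof
  assume "resultant p q = 0"
  then have "Polynomial.degree (gcd p q) > 0"
    by (simp add: resultant_0_gcd)
  then obtain x where "poly (gcd p q) x = 0"
    using alg_closed_imp_poly_has_root by blast
  then have "[:- x, 1:] dvd gcd p q"
    by (simp add: poly_eq_0_iff_dvd)
  then show "\<exists>x. poly p x = 0 \<and> poly q x = 0"
    by (auto simp: poly_eq_0_iff_dvd)
next
  assume "\<exists>x. poly p x = 0 \<and> poly q x = 0"
  then obtain x where "[:- x, 1:] dvd gcd p q"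
    by (auto simp: poly_eq_0_iff_dvd)
  moreover have "gcd p q \<noteq> 0"
    using assms by simp
  ultimately have "Polynomial.degree [:- x, 1:] \<le> Polynomial.degree (gcd p q)"
    by (rule dvd_imp_degree_le)
  then show "resultant p q = 0"
    by (simp add: resultant_0_gcd)
qed

text \<open>Gives \<open>omega\<close> characteristic 0, on which the separability argument in
  \<open>unique_multiple_root_in_subfield\<close> rests.\<close>

instance fract :: ("{idom, ring_char_0}") field_char_0
proof
  have "of_nat n = Fract (of_nat n :: 'a) 1" for n
    by (rule Fract_of_nat_eq[symmetric])
  then show "inj (of_nat :: nat \<Rightarrow> 'a fract)"
    by (intro injI) (simp add: eq_fract)
qed

section \<open>Parametrizations that generate the field of rational functions\<close>

definition subfield_of :: "'a :: field set \<Rightarrow> bool"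
  where "subfield_of K \<longleftrightarrow> 1 \<in> K \<and> (\<forall>a\<in>K. \<forall>b\<in>K. a - b \<in> K \<and> a * b \<in> K \<and> a / b \<in> K)"

definition polys_over :: "'a :: field set \<Rightarrow> 'a poly set"
  where "polys_over K = {p. \<forall>i. Polynomial.coeff p i \<in> K}"

lemma subfield_of_closed:
  assumes "subfield_of K"
  shows "0 \<in> K" "1 \<in> K" "a \<in> K \<Longrightarrow> - a \<in> K" "a \<in> K \<Longrightarrow> b \<in> K \<Longrightarrow> a - b \<in> K"
    "a \<in> K \<Longrightarrow> b \<in> K \<Longrightarrow> a + b \<in> K" "a \<in> K \<Longrightarrow> b \<in> K \<Longrightarrow> a * b \<in> K"
    "a \<in> K \<Longrightarrow> b \<in> K \<Longrightarrow> a / b \<in> K"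
proof -
  have *: "a - b \<in> K" "a * b \<in> K" "a / b \<in> K" if "a \<in> K" "b \<in> K" for a b
    using assms that by (auto simp: subfield_of_def)
  show 1: "1 \<in> K"
    using assms by (simp add: subfield_of_def)
  show 0: "0 \<in> K"
    using *(1)[OF 1 1] by simp
  show neg: "- a \<in> K" if "a \<in> K" for a
    using *(1)[OF 0 that] by simp
  show "a + b \<in> K" if "a \<in> K" "b \<in> K" for a b
    using *(1)[OF that(1) neg[OF that(2)]] by simp
qed (use assms in \<open>auto simp: subfield_of_def\<close>)

lemma polys_over_closed:
  assumes K: "subfield_of K" and p: "p \<in> polys_over K"
  shows "q \<in> polys_over K \<Longrightarrow> p + q \<in> polys_over K" "q \<in> polys_over K \<Longrightarrow> p - q \<in> polys_over K"
    "c \<in> K \<Longrightarrow> Polynomial.monom c n * p \<in> polys_over K" "c \<in> K \<Longrightarrow> Polynomial.smult c p \<in> polys_over K"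
    "pderiv p \<in> polys_over K"
proof -
  have nat: "of_nat n \<in> K" for n
    by (induction n) (simp_all add: subfield_of_closed[OF K])
  show "pderiv p \<in> polys_over K"
    using p by (simp add: polys_over_def coeff_pderiv subfield_of_closed[OF K] nat del: of_nat_Suc)
  show "c \<in> K \<Longrightarrow> Polynomial.monom c n * p \<in> polys_over K"
    using p by (simp add: polys_over_def coeff_monom_mult subfield_of_closed[OF K])
qed (use p in \<open>simp_all add: polys_over_def subfield_of_closed[OF K]\<close>)

text \<open>Long division subtracts multiples of \<open>m\<close> with coefficients in
  \<open>K\<close>, so the remainder stays over \<open>K\<close>, where minimality of a polynomial
  applies to it.\<close>

lemma polys_over_division:
  assumes K: "subfield_of K" and m: "m \<in> polys_over K" "m \<noteq> 0" and p: "p \<in> polys_over K"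
  shows "\<exists>s r. r \<in> polys_over K \<and> p = s * m + r \<and> (r = 0 \<or> Polynomial.degree r < Polynomial.degree m)"
  using p
proof (induction "Polynomial.degree p" arbitrary: p rule: less_induct)
  case less
  show ?case
  proof (cases "p = 0 \<or> Polynomial.degree p < Polynomial.degree m")
    case True
    with less.prems show ?thesis
      by (intro exI[of _ 0] exI[of _ p]) auto
  next
    case False
    define c where "c = Polynomial.coeff p (Polynomial.degree p) / Polynomial.coeff m (Polynomial.degree m)"
    define k where "k = Polynomial.degree p - Polynomial.degree m"
    define q where "q = p - Polynomial.monom c k * m"
    have c: "c \<in> K" "c \<noteq> 0"
      using less.prems m False by (auto simp: c_def polys_over_def intro!: subfield_of_closed[OF K])
    have q: "q \<in> polys_over K"
      unfolding q_def using less.prems m c by (intro polys_over_closed[OF K])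
    have deg: "Polynomial.degree (Polynomial.monom c k * m) = Polynomial.degree p"
      using c m False by (subst degree_mult_eq) (auto simp: degree_monom_eq k_def)
    show ?thesis
    proof (cases "q = 0")
      case True
      then have "p = Polynomial.monom c k * m + 0"
        by (simp add: q_def)
      then show ?thesis
        by (intro exI[of _ "Polynomial.monom c k"] exI[of _ 0]) (auto simp: polys_over_def subfield_of_closed[OF K])
    next
      case False
      have "Polynomial.coeff q (Polynomial.degree p) = 0"
        using m \<open>\<not> (p = 0 \<or> _)\<close> by (simp add: q_def coeff_monom_mult c_def k_def)
      moreover have "Polynomial.degree q \<le> Polynomial.degree p"
        unfolding q_def using deg by (intro degree_diff_le) auto
      ultimately have "Polynomial.degree q < Polynomial.degree p"
        using False by (metis le_neq_implies_less leading_coeff_0_iff)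
      from less.hyps[OF this q] obtain s r where
        "r \<in> polys_over K" "q = s * m + r" "r = 0 \<or> Polynomial.degree r < Polynomial.degree m"
        by blast
      then show ?thesis
        by (intro exI[of _ "s + Polynomial.monom c k"] exI[of _ r]) (auto simp: q_def algebra_simps)
    qed
  qed
qed

text \<open>All roots of the minimal polynomial of \<open>t\<close> over \<open>K\<close> are multiple roots of \<open>n\<close>.\<close>

lemma unique_multiple_root_in_subfield:
  fixes n :: "'a :: {alg_closed_field, field_char_0} poly"
  assumes K: "subfield_of K" and n: "n \<in> polys_over K" "n \<noteq> 0"
    and t: "poly n t = 0" "poly (pderiv n) t = 0"
    and unique: "\<And>s. poly n s = 0 \<Longrightarrow> poly (pderiv n) s = 0 \<Longrightarrow> s = t"
  shows "t \<in> K"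
proof -
  obtain m where m: "m \<in> polys_over K" "m \<noteq> 0" "poly m t = 0"
    and min: "\<And>p. p \<in> polys_over K \<Longrightarrow> p \<noteq> 0 \<Longrightarrow> poly p t = 0 \<Longrightarrow> Polynomial.degree m \<le> Polynomial.degree p"
    using ex_has_least_nat[of "\<lambda>p. p \<in> polys_over K \<and> p \<noteq> 0 \<and> poly p t = 0" n Polynomial.degree] n t by blast
  have dvd: "m dvd p" if p: "p \<in> polys_over K" "poly p t = 0" for p
  proof -
    obtain s r where sr: "r \<in> polys_over K" "p = s * m + r" "r = 0 \<or> Polynomial.degree r < Polynomial.degree m"
      using polys_over_division[OF K m(1,2) p(1)] by blast
    then have "poly r t = 0"
      using p m by simp
    then have "r = 0"
      using sr min[of r] by (cases "r = 0") auto
    with sr show ?thesis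
      by simp
  qed
  have root: "s = t" if "poly m s = 0" for s
  proof (rule unique)
    have "m dvd n" "m dvd pderiv n"
      using dvd n t polys_over_closed(5)[OF K] by blast+
    then show "poly n s = 0" "poly (pderiv n) s = 0"
      using that by (auto elim!: dvdE)
  qed
  obtain m1 where m1: "m = [:- t, 1:] * m1"
    using m(3) by (auto simp: poly_eq_0_iff_dvd elim: dvdE)
  then have "m1 \<noteq> 0"
    using m by auto
  \<comment> \<open>Otherwise \<open>m1\<close> has a root, necessarily \<open>t\<close>, so
    \<open>pderiv m\<close> vanishes at \<open>t\<close>; in characteristic 0 it is nonzero, and its
    degree is smaller than that of the minimal polynomial.\<close>
  have "Polynomial.degree m1 = 0"
  proof (rule ccontr)
    assume "Polynomial.degree m1 \<noteq> 0"
    then obtain s where s: "poly m1 s = 0"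
      using alg_closed_imp_poly_has_root[of m1] by blast
    then have "s = t"
      using root[of s] by (simp add: m1)
    have deg: "Polynomial.degree m > 1"
      using \<open>Polynomial.degree m1 \<noteq> 0\<close> \<open>m1 \<noteq> 0\<close> degree_mult_eq[of "[:- t, 1:]" m1] by (simp add: m1)
    have "poly (pderiv m) t = 0"
      using s \<open>s = t\<close> by (simp add: m1 pderiv_mult del: mult_pCons_left)
    moreover have "pderiv m \<noteq> 0"
      using deg by (simp add: pderiv_eq_0_iff)
    ultimately have "Polynomial.degree m \<le> Polynomial.degree (pderiv m)"
      using min m polys_over_closed(5)[OF K] by blast
    then show False
      using deg by (simp add: degree_pderiv)
  qed
  then obtain b where b: "m1 = [:b:]" "b \<noteq> 0"
    using \<open>m1 \<noteq> 0\<close> by (metis degree_eq_zeroE pCons_eq_0_iff)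
  \<comment> \<open>The minimal polynomial is linear, so \<open>t\<close> is a quotient of its
    coefficients up to sign.\<close>
  have "m = [:- t * b, b:]"
    by (simp add: m1 b)
  then have "- t * b \<in> K" "b \<in> K"
    using m(1) unfolding polys_over_def by (metis (no_types, lifting) coeff_pCons_0 coeff_pCons_Suc mem_Collect_eq)+
  then have "- ((- t * b) / b) \<in> K"
    using subfield_of_closed(3,7)[OF K] by blast
  moreover have "- ((- t * b) / b) = t"
    using b by simp
  ultimately show ?thesis
    by (simp only:)
qed

lemma subfield_function_field: "subfield_of (function_field \<xi> \<eta>)"
proof -
  interpret e: comm_ring_hom "\<lambda>f. eval2 const f \<xi> \<eta>"
    by (rule comm_ring_hom_eval2[OF comm_ring_hom_const])
  let ?e = "\<lambda>f. eval2 const f \<xi> \<eta>"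
  have "1 = ?e 1 / ?e 1"
    by (simp add: e.hom_one)
  then have "1 \<in> function_field \<xi> \<eta>"
    unfolding function_field_def by (intro CollectI exI[of _ 1] conjI) (simp_all add: e.hom_one)
  moreover have "a - b \<in> function_field \<xi> \<eta> \<and> a * b \<in> function_field \<xi> \<eta> \<and> a / b \<in> function_field \<xi> \<eta>"
    if ab: "a \<in> function_field \<xi> \<eta>" "b \<in> function_field \<xi> \<eta>" for a b
  proof -
    obtain f g where a: "a = ?e f / ?e g" "?e g \<noteq> 0"
      using ab(1) unfolding function_field_def by blast
    obtain h k where b: "b = ?e h / ?e k" "?e k \<noteq> 0"
      using ab(2) unfolding function_field_def by blast
    have gk: "?e (g * k) \<noteq> 0"
      using a b by (simp add: e.hom_mult)
    have "a - b = ?e (f * k - h * g) / ?e (g * k)"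
      using a b by (simp add: e.hom_mult e.hom_minus diff_frac_eq)
    moreover have "a * b = ?e (f * h) / ?e (g * k)"
      using a b by (simp add: e.hom_mult)
    moreover have "a / b = ?e (f * k) / ?e (g * h)" if "?e h \<noteq> 0"
      using a b by (simp add: e.hom_mult)
    moreover have "?e (g * h) \<noteq> 0" if "?e h \<noteq> 0"
      using a that by (simp add: e.hom_mult)
    moreover have "a / b = ?e 0 / ?e g" if "?e h = 0"
      using b that by (simp add: e.hom_zero)
    ultimately show ?thesis
      using gk a(2) unfolding function_field_def by blast
  qed
  ultimately show ?thesis
    by (simp add: subfield_of_def)
qed

lemma function_field_const: "const c \<in> function_field \<xi> \<eta>"
  and function_field_fst: "\<xi> \<in> function_field \<xi> \<eta>"
  and function_field_snd: "\<eta> \<in> function_field \<xi> \<eta>"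
proof -
  interpret e: comm_ring_hom "\<lambda>f. eval2 const f \<xi> \<eta>"
    by (rule comm_ring_hom_eval2[OF comm_ring_hom_const])
  have c: "const 0 = 0" "const 1 = 1"
    by (simp_all add: const_emb flip: one_pCons)
  have F: "eval2 const f \<xi> \<eta> \<in> function_field \<xi> \<eta>" for f
    unfolding function_field_def
    by (intro CollectI exI[of _ f] exI[of _ 1] conjI) (simp_all add: e.hom_one)
  have 1: "eval2 const [:[:c:]:] \<xi> \<eta> = const c"
    by (simp only: eval2_pCons[OF comm_ring_hom_const] poly_map_pCons[OF comm_ring_hom_const] e.hom_zero) simp
  have 2: "eval2 const [:[:0, 1:]:] \<xi> \<eta> = \<xi>"
    by (simp only: eval2_pCons[OF comm_ring_hom_const] poly_map_pCons[OF comm_ring_hom_const] e.hom_zero c) simp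
  have 3: "eval2 const [:0, 1:] \<xi> \<eta> = \<eta>"
    by (simp only: eval2_pCons[OF comm_ring_hom_const] e.hom_zero map_poly_1 one_pCons) (simp add: c)
  show "const c \<in> function_field \<xi> \<eta>" "\<xi> \<in> function_field \<xi> \<eta>" "\<eta> \<in> function_field \<xi> \<eta>"
    using F[of "[:[:c:]:]"] F[of "[:[:0, 1:]:]"] F[of "[:0, 1:]"] unfolding 1 2 3 by blast+
qed

lemma eval2_rational:
  assumes "\<xi> \<in> rational_functions" "\<eta> \<in> rational_functions"
  shows "eval2 const f \<xi> \<eta> \<in> rational_functions"
proof -
  have add: "a + b \<in> rational_functions" and mult: "a * b \<in> rational_functions"
    if "a \<in> rational_functions" "b \<in> rational_functions" for a b
    using that unfolding rational_functions_def by (auto simp flip: to_ac_add to_ac_mult)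
  have const: "const c \<in> rational_functions" for c
    by (simp add: const_def rational_functions_def)
  have zero: "0 \<in> rational_functions"
    using const[of 0] by (simp add: const_emb)
  have 1: "poly (map_poly const a) \<xi> \<in> rational_functions" for a
    by (induction a) (simp_all add: zero poly_map_pCons[OF comm_ring_hom_const] add mult const assms)
  show ?thesis
    by (induction f) (simp_all add: eval2_pCons[OF comm_ring_hom_const] add mult 1 assms eval2_def[of _ 0] zero)
qed

lemma function_field_eq_rational_functions:
  assumes \<xi>\<eta>: "\<xi> \<in> rational_functions" "\<eta> \<in> rational_functions"
    and T: "emb [:0, 1:] \<in> function_field \<xi> \<eta>"
  shows "function_field \<xi> \<eta> = rational_functions"
proof (intro equalityI subsetI)
  fix a assume "a \<in> function_field \<xi> \<eta>"
  then obtain f g where "a = eval2 const f \<xi> \<eta> / eval2 const g \<xi> \<eta>"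
    unfolding function_field_def by blast
  then show "a \<in> rational_functions"
    using eval2_rational[OF \<xi>\<eta>, of f] eval2_rational[OF \<xi>\<eta>, of g] unfolding rational_functions_def
    by (auto simp flip: to_ac_divide)
next
  note K = subfield_of_closed[OF subfield_function_field[of \<xi> \<eta>]]
  have poly: "emb p \<in> function_field \<xi> \<eta>" for p
  proof (induction p)
    case (pCons c p)
    have "emb (pCons c p) = const c + emb [:0, 1:] * emb p"
      unfolding const_emb emb_simps(3)[symmetric] emb_simps(4)[symmetric] by simp
    then show ?case
      using K(5,6) function_field_const T pCons by metis
  qed (simp add: K)
  fix a assume a: "a \<in> rational_functions"
  show "a \<in> function_field \<xi> \<eta>"
  proof (cases "a = 0")
    case False
    from a this obtain p q where "a = emb p / emb q"
      by (rule rational_functions_cases)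
    then show ?thesis
      using K(7)[OF poly poly] by simp
  qed (simp add: K)
qed

lemma divide_combination:
  fixes a b c u v w :: "'a :: field"
  assumes "a \<noteq> 0"
  shows "1 / a * (b * u + c * v + a * w) = b / a * u + c / a * v + w"
  using assms by (simp add: distrib_left)

lemma degree_double_root:
  fixes v :: "'a :: idom poly"
  assumes "v \<noteq> 0"
  shows "Polynomial.degree ([:- b, 1:] * ([:- b, 1:] * v)) = Suc (Suc (Polynomial.degree v))"
proof -
  have "[:- b, 1:] * v \<noteq> 0" "[:- b, 1:] \<noteq> 0"
    unfolding mult_eq_0_iff using assms by simp_all
  then show ?thesis
    using degree_mult_eq[of "[:- b, 1:]" "[:- b, 1:] * v"] degree_mult_eq[of "[:- b, 1:]" v] assms by simp
qed

text \<open>\<open>N\<close> is the family of polynomials \<open>f t * p + g t * q + h t * r\<close>, with parameter \<open>t\<close>; each has a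
  double root at \<open>t\<close>. If for one value \<open>t = a\<close> there is no other multiple root,
  this is true generically.\<close>

lemma parameter_in_function_field:
  fixes f g h p q r :: "complex poly"
  assumes h: "poly h a \<noteq> 0"
    and zero: "f * p + g * q + h * r = 0"
      "f * pderiv p + g * pderiv q + h * pderiv r = 0"
    and N0: "N0 = Polynomial.smult (poly f a) p + Polynomial.smult (poly g a) q + Polynomial.smult (poly h a) r"
    and deg: "Polynomial.degree p \<le> Polynomial.degree N0" "Polynomial.degree q \<le> Polynomial.degree N0"
      "Polynomial.degree r \<le> Polynomial.degree N0"
    and N0_nz: "N0 \<noteq> 0"
    and simple: "\<And>s. poly N0 s = 0 \<Longrightarrow> poly (pderiv N0) s = 0 \<Longrightarrow> s = a"
    and double: "poly (pderiv (pderiv N0)) a \<noteq> 0"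
  shows "emb [:0, 1:] \<in> function_field (emb f / emb h) (emb g / emb h)"
proof -
  \<comment> \<open>\<open>N\<close> is a polynomial in a new variable \<open>s\<close> with
    coefficients depending on the parameter \<open>t\<close>: \<open>C\<close> reads
    \<open>p\<close>, \<open>q\<close>, \<open>r\<close> as polynomials in \<open>s\<close>, and
    \<open>T\<close> is \<open>t\<close>. The hypotheses \<open>zero\<close> say that
    \<open>N\<close> and its derivative in \<open>s\<close> vanish at \<open>s = t\<close>.\<close>
  define C where "C = map_poly (\<lambda>c :: complex. [:c:])"
  have hC: "comm_ring_hom (\<lambda>c :: complex. [:c:])"
    by unfold_locales (simp_all add: one_pCons)
  define T :: "complex poly" where "T = [:0, 1:]"
  define N where "N = Polynomial.smult f (C p) + Polynomial.smult g (C q) + Polynomial.smult h (C r)"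
  have C_T: "poly (C v) T = v" for v
    by (induction v) (simp_all add: C_def T_def map_poly_pCons_ring_hom[OF hC])
  have C_pderiv: "pderiv (C v) = C (pderiv v)" for v
    unfolding C_def by (rule poly_eqI) (simp add: coeff_pderiv coeff_map_poly of_nat_poly)
  have "poly N T = 0" "poly (pderiv N) T = 0"
    using zero by (simp_all add: N_def pderiv_add pderiv_smult C_pderiv C_T)
  then obtain A where A: "N = [:- T, 1:] * A"
    by (auto simp: poly_eq_0_iff_dvd elim: dvdE)
  have "poly A T = 0"
    using \<open>poly (pderiv N) T = 0\<close> by (simp add: A pderiv_mult pderiv_pCons del: mult_pCons_left)
  then obtain M where "A = [:- T, 1:] * M"
    by (auto simp: poly_eq_0_iff_dvd elim: dvdE)
  with A have NM: "N = [:- T, 1:] * ([:- T, 1:] * M)"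
    by simp
  \<comment> \<open>Specialization at \<open>t = a\<close>, which takes \<open>N\<close> to
    \<open>N0\<close>.\<close>
  define \<phi> where "\<phi> = map_poly (\<lambda>q :: complex poly. poly q a)"
  have h\<phi>: "comm_ring_hom (\<lambda>q :: complex poly. poly q a)"
    by unfold_locales simp_all
  interpret \<phi>: comm_ring_hom \<phi>
    unfolding \<phi>_def by (rule comm_ring_hom_map_poly[OF h\<phi>])
  interpret e: inj_comm_ring_hom emb
    by (rule inj_comm_ring_hom_emb)
  have \<phi>C: "\<phi> (C v) = v" "\<phi> (Polynomial.smult c v') = Polynomial.smult (poly c a) (\<phi> v')" for v c v'
    by (rule poly_eqI, simp add: \<phi>_def C_def coeff_map_poly)+
  have \<phi>N: "\<phi> N = N0"
    by (simp add: N_def N0 \<phi>.hom_add \<phi>C)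
  define M0 where "M0 = \<phi> M"
  have \<phi>T: "\<phi> [:- T, 1:] = [:- a, 1:]"
    by (simp add: \<phi>_def T_def map_poly_pCons_ring_hom[OF h\<phi>])
  have N0M0: "N0 = [:- a, 1:] * ([:- a, 1:] * M0)"
    unfolding \<phi>N[symmetric] NM \<phi>.hom_mult \<phi>T M0_def ..
  then have "M0 \<noteq> 0" "M \<noteq> 0"
    using N0_nz by (auto simp: M0_def)
  have M0a: "poly M0 a \<noteq> 0"
    using double by (simp add: N0M0 pderiv_mult pderiv_add pderiv_pCons del: mult_pCons_left)
  have M0: "\<not> (poly M0 s = 0 \<and> poly (pderiv M0) s = 0)" for s
  proof
    assume s: "poly M0 s = 0 \<and> poly (pderiv M0) s = 0"
    then have "poly N0 s = 0" "poly (pderiv N0) s = 0"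
      by (simp_all add: N0M0 pderiv_mult del: mult_pCons_left)
    then have "s = a"
      by (rule simple)
    with s M0a show False
      by simp
  qed
  \<comment> \<open>Resultants commute with specialization if the degrees do not drop. This is what
    the hypotheses \<open>deg\<close> are for: they bound the degree of \<open>N\<close> by that of
    \<open>N0\<close>.\<close>
  have degM: "Polynomial.degree M0 = Polynomial.degree M"
  proof (rule antisym)
    show "Polynomial.degree M0 \<le> Polynomial.degree M"
      unfolding M0_def \<phi>_def by (rule degree_map_poly_le)
    have "Polynomial.degree (C v) \<le> Polynomial.degree v" for v
      unfolding C_def by (rule degree_map_poly_le)
    then have "Polynomial.degree N \<le> Polynomial.degree N0"
      unfolding N_def using deg by (intro degree_add_le order.trans[OF degree_smult_le]) (meson order.trans)+
    then show "Polynomial.degree M \<le> Polynomial.degree M0"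
      unfolding N0M0 NM degree_double_root[OF \<open>M \<noteq> 0\<close>] degree_double_root[OF \<open>M0 \<noteq> 0\<close>] by simp
  qed
  have \<phi>_pderiv: "\<phi> (pderiv v) = pderiv (\<phi> v)" for v
    by (rule poly_eqI) (simp add: \<phi>_def coeff_pderiv coeff_map_poly of_nat_poly)
  \<comment> \<open>The discriminant of \<open>M\<close> is nonzero because its value at
    \<open>t = a\<close> is; hence \<open>M\<close> has no multiple root in
    \<open>omega\<close>.\<close>
  have "resultant M0 (pderiv M0) = poly (resultant M (pderiv M)) a"
    unfolding M0_def \<phi>_pderiv[symmetric] unfolding \<phi>_def
  proof (rule comm_ring_hom.resultant_map_poly[OF h\<phi>])
    show "Polynomial.degree (map_poly (\<lambda>q. poly q a) M) = Polynomial.degree M"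
      using degM by (simp add: M0_def \<phi>_def)
    have "Polynomial.degree (\<phi> (pderiv M)) = Polynomial.degree (pderiv M)"
      using degM by (simp add: M0_def \<phi>_pderiv degree_pderiv)
    then show "Polynomial.degree (map_poly (\<lambda>q. poly q a) (pderiv M)) = Polynomial.degree (pderiv M)"
      by (simp add: \<phi>_def)
  qed
  moreover have "resultant M0 (pderiv M0) \<noteq> 0"
    using resultant_eq_0_iff_common_root[OF \<open>M0 \<noteq> 0\<close>] M0 by auto
  ultimately have "resultant M (pderiv M) \<noteq> 0"
    by auto
  then have res: "resultant (map_poly emb M) (map_poly emb (pderiv M)) \<noteq> 0"
    by (simp add: e.resultant_hom)
  have emb_pderiv: "map_poly emb (pderiv v) = pderiv (map_poly emb v)" for v
  proof (rule poly_eqI)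
    fix i
    have "emb (of_nat k) = of_nat k" for k
      by (induction k) simp_all
    then show "Polynomial.coeff (map_poly emb (pderiv v)) i = Polynomial.coeff (pderiv (map_poly emb v)) i"
      by (simp add: coeff_pderiv coeff_map_poly del: of_nat_Suc)
  qed
  have "map_poly emb M \<noteq> 0"
    using \<open>M \<noteq> 0\<close> by (simp add: poly_eq_iff coeff_map_poly)
  then have M\<omega>: "\<not> (poly (map_poly emb M) s = 0 \<and> poly (pderiv (map_poly emb M)) s = 0)" for s
    using resultant_eq_0_iff_common_root[of "map_poly emb M" "map_poly emb (pderiv M)"] res
    unfolding emb_pderiv by blast
  have hemb: "comm_ring_hom (map_poly emb)"
    by (rule comm_ring_hom_map_poly) unfold_locales
  interpret m: comm_ring_hom "map_poly emb"
    by (rule hemb)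
  define N\<omega> where "N\<omega> = map_poly emb N"
  have N\<omega>: "N\<omega> = [:- emb T, 1:] * ([:- emb T, 1:] * map_poly emb M)"
    unfolding N\<omega>_def NM m.hom_mult by (simp add: map_poly_pCons)
  \<comment> \<open>After division by \<open>h\<close> the coefficients are affine in
    \<open>f / h\<close> and \<open>g / h\<close>, so \<open>n\<close> is defined over the function
    field.\<close>
  define n where "n = Polynomial.smult (1 / emb h) N\<omega>"
  have "h \<noteq> 0"
    using h by auto
  have K: "subfield_of (function_field (emb f / emb h) (emb g / emb h))"
    by (rule subfield_function_field)
  have "Polynomial.coeff n i = emb f / emb h * const (Polynomial.coeff p i) +
      emb g / emb h * const (Polynomial.coeff q i) + const (Polynomial.coeff r i)" for i
  proof -
    have "Polynomial.coeff N i = f * [:Polynomial.coeff p i:] + g * [:Polynomial.coeff q i:] + h * [:Polynomial.coeff r i:]"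
      by (simp add: N_def C_def coeff_map_poly)
    then have eq: "Polynomial.coeff n i = 1 / emb h * (emb f * const (Polynomial.coeff p i) +
        emb g * const (Polynomial.coeff q i) + emb h * const (Polynomial.coeff r i))"
      unfolding n_def N\<omega>_def coeff_smult coeff_map_poly[of emb, OF emb_simps(1)] const_emb
      by (simp only: emb_simps(3,4))
    have "emb h \<noteq> 0"
      using \<open>h \<noteq> 0\<close> by simp
    then show ?thesis
      unfolding eq by (rule divide_combination)
  qed
  then have "n \<in> polys_over (function_field (emb f / emb h) (emb g / emb h))"
    using subfield_of_closed(5)[OF K subfield_of_closed(5)[OF K
        subfield_of_closed(6)[OF K function_field_fst function_field_const]
        subfield_of_closed(6)[OF K function_field_snd function_field_const]] function_field_const]
    unfolding polys_over_def mem_Collect_eq by metis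
  moreover have "n \<noteq> 0"
    using \<open>h \<noteq> 0\<close> \<open>map_poly emb M \<noteq> 0\<close> by (simp add: n_def N\<omega> del: mult_pCons_left)
  moreover have "poly n (emb T) = 0" "poly (pderiv n) (emb T) = 0"
    by (simp_all add: n_def N\<omega> pderiv_smult pderiv_mult del: mult_pCons_left)
  moreover have "s = emb T" if s: "poly n s = 0" "poly (pderiv n) s = 0" for s
  proof (rule ccontr)
    assume "s \<noteq> emb T"
    then have "poly (map_poly emb M) s = 0"
      using s(1) \<open>h \<noteq> 0\<close> by (simp add: n_def N\<omega> del: mult_pCons_left)
    moreover from this have "poly (pderiv (map_poly emb M)) s = 0"
      using s(2) \<open>h \<noteq> 0\<close> \<open>s \<noteq> emb T\<close> by (simp add: n_def N\<omega> pderiv_smult pderiv_mult del: mult_pCons_left)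
    ultimately show False
      using M\<omega> by blast
  qed
  ultimately show ?thesis
    unfolding T_def[symmetric] by (intro unique_multiple_root_in_subfield[OF K])
qed

section \<open>The implicit equation of a real rational curve\<close>

lemma eval2_Re_Im:
  fixes q :: "complex poly poly"
  defines "cx \<equiv> map_poly (map_poly complex_of_real)"
  shows "q = cx (map_poly (map_poly Re) q) + [:[:\<i>:]:] * cx (map_poly (map_poly Im) q)"
  unfolding cx_def
proof (rule poly_eqI, rule poly_eqI)
  fix i j
  have z: "map_poly Re 0 = 0" "map_poly Im 0 = 0" "map_poly complex_of_real 0 = 0"
    by simp_all
  show "Polynomial.coeff (Polynomial.coeff q i) j =
      Polynomial.coeff (Polynomial.coeff (map_poly (map_poly complex_of_real) (map_poly (map_poly Re) q) +
        [:[:\<i>:]:] * map_poly (map_poly complex_of_real) (map_poly (map_poly Im) q)) i) j"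
    by (simp add: coeff_map_poly complex_eq mult.commute)
qed

text \<open>The real polynomials vanishing on the curve are those vanishing at the point
  \<open>(f / h, g / h)\<close> of \<open>omega\<close>. They form a prime ideal, being the kernel
  of an evaluation in a field, and its generator \<open>P\<close> is the equation sought.
  \<open>P\<close> has no further real zeros because the ideal contains the real and imaginary parts
  of a resultant whose real zeros all lie on the curve. \<open>P\<close> also generates the complex
  relations, since these split into real and imaginary parts; the genus is then a matter of the
  field, which \<open>T\<close> identifies.\<close>

lemma rational_curve_of_genus_0:
  fixes f g h :: "complex poly" and c :: "complex \<Rightarrow> real \<times> real"
  assumes h: "\<And>u. u \<in> unit_circle \<Longrightarrow> poly h u \<noteq> 0"
    and c: "\<And>u. u \<in> unit_circle \<Longrightarrow> of_real (fst (c u)) = poly f u / poly h u"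
      "\<And>u. u \<in> unit_circle \<Longrightarrow> of_real (snd (c u)) = poly g u / poly h u"
    and inf: "infinite (fst ` c ` unit_circle)"
    and off: "\<And>u x y. u \<notin> unit_circle \<Longrightarrow> poly f u = of_real x * poly h u \<Longrightarrow>
      poly g u = of_real y * poly h u \<Longrightarrow> False"
    and deg: "Polynomial.degree f \<le> n" "Polynomial.degree g \<le> n" "Polynomial.degree h \<le> n"
    and top: "\<And>x y. Polynomial.coeff f n = of_real x * Polynomial.coeff h n \<Longrightarrow>
      Polynomial.coeff g n = of_real y * Polynomial.coeff h n \<Longrightarrow> False"
    and out: "p0 \<notin> c ` unit_circle"
    and T: "emb [:0, 1:] \<in> function_field (emb f / emb h) (emb g / emb h)"
  shows "real_algebraic_curve_of_genus (c ` unit_circle) 0"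
proof -
  define \<xi> \<eta> where "\<xi> = emb f / emb h" and "\<eta> = emb g / emb h"
  define cx where "cx = map_poly (map_poly complex_of_real)"
  define I where "I = {q. \<forall>u\<in>unit_circle. eval2 id q (fst (c u)) (snd (c u)) = 0}"
  have r: "comm_ring_hom complex_of_real"
    by unfold_locales
  interpret cx: comm_ring_hom cx
    unfolding cx_def by (intro comm_ring_hom_map_poly r)
  interpret e: comm_ring_hom "\<lambda>f. eval2 const f \<xi> \<eta>"
    by (rule comm_ring_hom_eval2[OF comm_ring_hom_const])
  note ev = comm_ring_hom_eval2[OF comm_ring_hom_id]
  have ev_mult: "eval2 id (p * q) x y = eval2 id p x y * eval2 id q x y" for p q x and y :: real
  proof -
    interpret ev: comm_ring_hom "\<lambda>f. eval2 id f x y"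
      by (rule ev)
    show ?thesis
      by (rule ev.hom_mult)
  qed
  have cx_eval: "eval2 id (cx q) (of_real x) (of_real y) = of_real (eval2 id q x y)" for q x y
    unfolding cx_def by (rule eval2_of_real)
  have const_iff: "eval2 const q \<xi> \<eta> = 0 \<longleftrightarrow>
      (\<forall>u\<in>unit_circle. eval2 id q (of_real (fst (c u))) (of_real (snd (c u))) = 0)" for q
  proof -
    have "eval2 const q \<xi> \<eta> = 0 \<longleftrightarrow> (\<forall>u\<in>unit_circle. eval2 id q (poly f u / poly h u) (poly g u / poly h u) = 0)"
      unfolding \<xi>_def \<eta>_def by (rule eval2_const_eq_0_iff) (rule h)
    then show ?thesis
      by (simp only: c cong: ball_cong)
  qed
  have I_iff: "q \<in> I \<longleftrightarrow> eval2 const (cx q) \<xi> \<eta> = 0" for q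
    unfolding const_iff cx_eval I_def by simp
  define re im where "re = map_poly (map_poly Re)" and "im = map_poly (map_poly Im)"
  have decomp: "q = cx (re q) + [:[:\<i>:]:] * cx (im q)" for q
    unfolding re_def im_def cx_def by (rule eval2_Re_Im)
  have eval_decomp: "eval2 id q (of_real x) (of_real y) =
      Complex (eval2 id (re q) x y) (eval2 id (im q) x y)" for q x y
  proof -
    interpret ev: comm_ring_hom "\<lambda>f. eval2 id f (of_real x) (of_real y :: complex)"
      by (rule ev)
    have i: "eval2 id [:[:\<i>:]:] (of_real x) (of_real y :: complex) = \<i>"
      by (simp add: eval2_pCons[OF comm_ring_hom_id] ev.hom_zero)
    have "eval2 id q (of_real x) (of_real y) = eval2 id (cx (re q) + [:[:\<i>:]:] * cx (im q)) (of_real x) (of_real y :: complex)"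
      using decomp[of q] by simp
    also have "\<dots> = of_real (eval2 id (re q) x y) + \<i> * of_real (eval2 id (im q) x y)"
      unfolding ev.hom_add ev.hom_mult i cx_eval ..
    finally show ?thesis
      by (simp add: complex_eq_iff)
  qed
  have I_Re_Im: "eval2 const q \<xi> \<eta> = 0 \<longleftrightarrow> re q \<in> I \<and> im q \<in> I" for q
    unfolding const_iff eval_decomp I_def by (auto simp: complex_eq_iff)

  \<comment> \<open>Elimination of \<open>u\<close> from \<open>f = x h\<close> and
    \<open>g = y h\<close>: two members of the pencil \<open>f - x h + t (g - y h)\<close> have the
    common solutions as their common roots. The coefficient
    \<open>[:[:0, 1:], [:of_real t:]:]\<close> is \<open>x + t y\<close>.\<close>
  define F where "F t = map_poly (\<lambda>z. [:[:z:]:]) (f + Polynomial.smult (of_real t) g) -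
    Polynomial.smult [:[:0, 1:], [:of_real t:]:] (map_poly (\<lambda>z. [:[:z:]:]) h)" for t :: real
  define G where "G t x y = f + Polynomial.smult (of_real t) g - Polynomial.smult (of_real (x + t * y)) h" for t x y
  \<comment> \<open>For bad \<open>t\<close> the degree in \<open>u\<close> drops below
    \<open>n\<close> at some real point. Two bad values would yield real \<open>x\<close>,
    \<open>y\<close> as excluded by \<open>top\<close>.\<close>
  define bad where "bad t \<longleftrightarrow> (\<exists>s :: real. Polynomial.coeff f n + of_real t * Polynomial.coeff g n = of_real s * Polynomial.coeff h n)" for t :: real
  have one_bad: "t = t'" if bad: "bad t" "bad t'" for t t'
  proof (rule ccontr)
    assume "t \<noteq> t'"
    obtain s s' :: real where s: "Polynomial.coeff f n + of_real t * Polynomial.coeff g n = of_real s * Polynomial.coeff h n"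
      "Polynomial.coeff f n + of_real t' * Polynomial.coeff g n = of_real s' * Polynomial.coeff h n"
      using bad unfolding bad_def by blast
    have "of_real (t - t') * Polynomial.coeff g n = of_real (s - s') * Polynomial.coeff h n"
      using arg_cong2[OF s, of "(-)"] by (simp add: algebra_simps)
    then have g: "Polynomial.coeff g n = of_real ((s - s') / (t - t')) * Polynomial.coeff h n"
      using \<open>t \<noteq> t'\<close> by (simp add: field_simps)
    have "Polynomial.coeff f n = of_real s * Polynomial.coeff h n - of_real t * Polynomial.coeff g n"
      using s(1) by (simp add: algebra_simps)
    also have "\<dots> = of_real (s - t * ((s - s') / (t - t'))) * Polynomial.coeff h n"
      unfolding g by (simp add: algebra_simps)
    finally show False
      using top g by blast
  qed
  \<comment> \<open>At most one of 0, 1, 2 is bad.\<close>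
  obtain t1 t2 where t: "t1 \<noteq> t2" "\<not> bad t1" "\<not> bad t2"
  proof (cases "bad 0")
    case True
    then have "\<not> bad 1" "\<not> bad 2"
      using one_bad[of 0 1] one_bad[of 0 2] by auto
    then show ?thesis
      using that[of 1 2] by simp
  next
    case False
    then show ?thesis
      using one_bad[of 1 2] that[of 0 1] that[of 0 2] by (cases "bad 1") auto
  qed
  have degG: "Polynomial.degree (G t x y) = n" "G t x y \<noteq> 0" if "\<not> bad t" for t x y
  proof -
    have "Polynomial.coeff (G t x y) n = Polynomial.coeff f n + of_real t * Polynomial.coeff g n -
        of_real (x + t * y) * Polynomial.coeff h n"
      by (simp add: G_def del: of_real_add of_real_mult)
    then have nz: "Polynomial.coeff (G t x y) n \<noteq> 0"
      using that unfolding bad_def by (metis eq_iff_diff_eq_0)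
    then show "G t x y \<noteq> 0"
      by auto
    have "Polynomial.degree (G t x y) \<le> n"
      unfolding G_def using deg
      by (intro degree_diff_le degree_add_le order.trans[OF degree_smult_le]) auto
    then show "Polynomial.degree (G t x y) = n"
      using le_degree[OF nz] by simp
  qed
  have FG: "map_poly (\<lambda>q. eval2 id q (of_real x) (of_real y)) (F t) = G t x y" for t x y
  proof -
    interpret ev: comm_ring_hom "\<lambda>q. eval2 id q (of_real x) (of_real y :: complex)"
      by (rule ev)
    have 1: "eval2 id [:[:z:]:] (of_real x) (of_real y :: complex) = z" for z
      by (simp add: eval2_pCons[OF comm_ring_hom_id] ev.hom_zero)
    have 2: "eval2 id [:[:0, 1:], [:of_real t:]:] (of_real x) (of_real y :: complex) = of_real (x + t * y)"
      by (simp add: eval2_pCons[OF comm_ring_hom_id] ev.hom_zero mult.commute)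
    show ?thesis
    proof (rule poly_eqI)
      fix i
      have "Polynomial.coeff (map_poly (\<lambda>q. eval2 id q (of_real x) (of_real y :: complex)) (F t)) i =
          eval2 id ([:[:Polynomial.coeff f i + of_real t * Polynomial.coeff g i:]:] - [:[:0, 1:], [:of_real t:]:] * [:[:Polynomial.coeff h i:]:])
            (of_real x) (of_real y)"
        by (subst coeff_map_poly) (simp_all add: F_def coeff_map_poly ev.hom_zero del: mult_pCons_left mult_pCons_right)
      also have "\<dots> = Polynomial.coeff (G t x y) i"
        unfolding ev.hom_minus ev.hom_mult 1 2 by (simp add: G_def)
      finally show "Polynomial.coeff (map_poly (\<lambda>q. eval2 id q (of_real x) (of_real y :: complex)) (F t)) i = Polynomial.coeff (G t x y) i" .
    qed
  qed
  have degF: "Polynomial.degree (F t) = n" if "\<not> bad t" for t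
  proof (rule antisym)
    have "Polynomial.degree (map_poly (\<lambda>z. [:[:z:]:]) v) \<le> Polynomial.degree v" for v :: "complex poly"
      by (rule degree_map_poly_le)
    then show "Polynomial.degree (F t) \<le> n"
      unfolding F_def using deg
      by (intro degree_diff_le order.trans[OF degree_smult_le]) (meson degree_add_le degree_smult_le order.trans)+
    show "n \<le> Polynomial.degree (F t)"
      using degree_map_poly_le[of "\<lambda>q. eval2 id q (of_real 0) (of_real 0)" "F t"] unfolding FG degG(1)[OF that] .
  qed
  define R where "R = resultant (F t1) (F t2)"
  have R: "eval2 id R (of_real x) (of_real y) = 0 \<longleftrightarrow> (x, y) \<in> c ` unit_circle" for x y
  proof -
    have "eval2 id R (of_real x) (of_real y) = resultant (G t1 x y) (G t2 x y)"
      unfolding R_def FG[symmetric]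
      by (rule comm_ring_hom.resultant_map_poly[OF ev, symmetric]) (simp_all only: FG degG(1)[OF t(2)] degG(1)[OF t(3)] degF[OF t(2)] degF[OF t(3)])
    also have "\<dots> = 0 \<longleftrightarrow> (\<exists>u. poly (G t1 x y) u = 0 \<and> poly (G t2 x y) u = 0)"
      by (rule resultant_eq_0_iff_common_root[OF degG(2)[OF t(2)]])
    also have "\<dots> \<longleftrightarrow> (\<exists>u. poly f u = of_real x * poly h u \<and> poly g u = of_real y * poly h u)"
    proof (intro ex_cong1 iffI)
      fix u assume u: "poly (G t1 x y) u = 0 \<and> poly (G t2 x y) u = 0"
      then have "poly (G t1 x y) u - poly (G t2 x y) u = 0"
        by simp
      then have "of_real (t1 - t2) * (poly g u - of_real y * poly h u) = 0"
        by (simp add: G_def algebra_simps)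
      then have g: "poly g u = of_real y * poly h u"
        using t(1) by simp
      then show "poly f u = of_real x * poly h u \<and> poly g u = of_real y * poly h u"
        using u by (simp add: G_def algebra_simps)
    qed (simp add: G_def algebra_simps)
    also have "\<dots> \<longleftrightarrow> (x, y) \<in> c ` unit_circle"
    proof
      assume "\<exists>u. poly f u = of_real x * poly h u \<and> poly g u = of_real y * poly h u"
      then obtain u where u: "poly f u = of_real x * poly h u" "poly g u = of_real y * poly h u"
        by blast
      then have circle: "u \<in> unit_circle"
        using off by blast
      then have "complex_of_real (fst (c u)) = of_real x" "complex_of_real (snd (c u)) = of_real y"
        using c h u by simp_all
      then have "c u = (x, y)"
        by (simp add: prod_eq_iff)
      then show "(x, y) \<in> c ` unit_circle"
        using circle by force
    next
      assume "(x, y) \<in> c ` unit_circle"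
      then obtain u where u: "u \<in> unit_circle" "(x, y) = c u"
        by blast
      then have "x = fst (c u)" "y = snd (c u)"
        by (metis fst_conv snd_conv)+
      then show "\<exists>u. poly f u = of_real x * poly h u \<and> poly g u = of_real y * poly h u"
        using c[OF u(1)] h[OF u(1)] by (intro exI[of _ u]) simp
    qed
    finally show ?thesis .
  qed
  have "eval2 id R (of_real (fst (c u))) (of_real (snd (c u))) = (0 :: complex)" if "u \<in> unit_circle" for u
    using R[of "fst (c u)" "snd (c u)"] that by simp
  then have "eval2 const R \<xi> \<eta> = 0"
    unfolding const_iff by blast
  then have "re R \<in> I" "im R \<in> I"
    unfolding I_Re_Im by simp_all
  \<comment> \<open>The resultant does not vanish at \<open>p0\<close>, which is off the
    curve.\<close>
  moreover have "re R \<noteq> 0 \<or> im R \<noteq> 0"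
  proof (rule ccontr)
    assume "\<not> (re R \<noteq> 0 \<or> im R \<noteq> 0)"
    then have "R = 0"
      using decomp[of R] cx.hom_zero by simp
    then have "eval2 id R (of_real (fst p0)) (of_real (snd p0) :: complex) = 0"
      by (simp add: eval2_def)
    then show False
      using R[of "fst p0" "snd p0"] out by simp
  qed
  ultimately obtain q0 where q0: "q0 \<in> I" "q0 \<noteq> 0"
    by blast
  obtain P where P: "\<And>q. q \<in> I \<longleftrightarrow> P dvd q"
  proof (rule principal_prime[of I q0])
    show "p - q \<in> I" if "p \<in> I" "q \<in> I" for p q
      using that unfolding I_iff cx.hom_minus e.hom_minus by simp
    show "p * q \<in> I" if "p \<in> I" for p q
      using that unfolding I_iff cx.hom_mult e.hom_mult by simp
    show "p \<in> I \<or> q \<in> I" if "p * q \<in> I" for p q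
      using that unfolding I_iff cx.hom_mult e.hom_mult by simp
    \<comment> \<open>A relation in \<open>x\<close> alone would leave only finitely many values of
      \<open>x\<close>.\<close>
    show "a = 0" if "[:a:] \<in> I" for a
    proof (rule ccontr)
      assume "a \<noteq> 0"
      then have fin: "finite {x. poly a x = 0}"
        by (rule poly_roots_finite)
      have "poly a x = 0" if x: "x \<in> fst ` c ` unit_circle" for x
      proof -
        obtain u where u: "u \<in> unit_circle" "x = fst (c u)"
          using x by blast
        then have "eval2 id [:a:] x (snd (c u)) = 0"
          using \<open>[:a:] \<in> I\<close> by (simp add: I_def)
        moreover have "eval2 id [:a:] x y = poly a x" for y
          by (simp add: eval2_pCons[OF comm_ring_hom_id]) (simp add: eval2_def)
        ultimately show ?thesis
          by simp
      qed
      then have "fst ` c ` unit_circle \<subseteq> {x. poly a x = 0}"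
        by blast
      from finite_subset[OF this fin] show False
        using inf by simp
    qed
  qed (use q0 in auto)
  have "c ` unit_circle = {(x, y). eval2 id P x y = 0}"
  proof (intro equalityI subsetI)
    fix p assume "p \<in> c ` unit_circle"
    moreover have "P \<in> I"
      by (simp add: P)
    ultimately show "p \<in> {(x, y). eval2 id P x y = 0}"
      by (auto simp: I_def case_prod_unfold)
  next
    fix p assume "p \<in> {(x, y). eval2 id P x y = 0}"
    then obtain x y where p: "p = (x, y)" "eval2 id P x y = 0"
      by auto
    have "eval2 id q x y = 0" if "q \<in> I" for q
      using that p(2) unfolding P by (auto simp: ev_mult elim!: dvdE)
    then have "eval2 id R (of_real x) (of_real y :: complex) = 0"
      unfolding eval_decomp using \<open>re R \<in> I\<close> \<open>im R \<in> I\<close> by (simp add: complex_eq_iff)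
    then show "p \<in> c ` unit_circle"
      using R p by simp
  qed
  moreover have "generic_point (cx P) \<xi> \<eta>"
    unfolding generic_point_def
  proof (intro allI iffI)
    fix q assume "eval2 const q \<xi> \<eta> = 0"
    then have "P dvd re q" "P dvd im q"
      unfolding I_Re_Im P by simp_all
    then have "cx P dvd cx (re q) + [:[:\<i>:]:] * cx (im q)"
      by (intro dvd_add dvd_mult cx.hom_dvd)
    then show "cx P dvd q"
      using decomp[of q] by simp
  next
    fix q assume "cx P dvd q"
    then obtain s where q: "q = cx P * s"
      by (rule dvdE)
    have "eval2 const (cx P) \<xi> \<eta> = 0"
      using P[of P] unfolding I_iff by simp
    then show "eval2 const q \<xi> \<eta> = 0"
      unfolding q e.hom_mult by simp
  qed
  moreover have "field_has_genus (function_field \<xi> \<eta>) 0"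
    using function_field_eq_rational_functions[of \<xi> \<eta>] T emb_divide_rational genus_rational_functions
    unfolding \<xi>_def \<eta>_def by simp
  moreover have "infinite (c ` unit_circle)"
    using inf by blast
  ultimately show ?thesis
    unfolding real_algebraic_curve_of_genus_def curve_has_genus_def cx_def by blast
qed

section \<open>Orientation of points on the circle\<close>

text \<open>The determinant with rows \<open>(r, Re u, Im u)\<close>,
  \<open>(s, Re v, Im v)\<close>, \<open>(t, Re w, Im w)\<close>, expanded along the first
  column.\<close>

definition det3 :: "real \<Rightarrow> complex \<Rightarrow> real \<Rightarrow> complex \<Rightarrow> real \<Rightarrow> complex \<Rightarrow> real"
  where "det3 r u s v t w = r * Im (cnj v * w) - s * Im (cnj u * w) + t * Im (cnj u * v)"

text \<open>Twice the signed area of the triangle, positive in counterclockwise order.\<close>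

definition ori :: "complex \<Rightarrow> complex \<Rightarrow> complex \<Rightarrow> real"
  where "ori a b c = Im (cnj (b - a) * (c - a))"

lemma det3_ori: "det3 1 a 1 b 1 c = ori a b c"
  by (simp add: det3_def ori_def algebra_simps)

lemma ori_rotate: "ori b c a = ori a b c"
  and ori_swap: "ori a c b = - ori a b c"
  by (simp_all add: ori_def algebra_simps)

lemma det3_rotate: "det3 s v t w r u = det3 r u s v t w"
  by (simp add: det3_def algebra_simps)

text \<open>The sides of an inscribed triangle are twice the sines of the half arcs, and on a unit
  circle twice the area is half the product of the sides; the signs come along.\<close>

lemma ori_cis:
  "ori (cis r) (cis s) (cis t) = 4 * sin ((s - r) / 2) * sin ((t - s) / 2) * sin ((t - r) / 2)"
proof -
  define p q where "p = (s - r) / 2" and "q = (t - s) / 2"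
  have s: "s = r + 2 * p" and t: "t = r + 2 * p + 2 * q"
    by (simp_all add: p_def q_def field_simps)
  have "ori (cis r) (cis s) (cis t) = sin (t - s) + sin (s - r) - sin (t - r)"
    by (simp add: ori_def sin_diff algebra_simps)
  also have "\<dots> = sin (2 * q) + sin (2 * p) - sin (2 * (p + q))"
    by (simp add: s t algebra_simps)
  also have "\<dots> = 4 * sin p * sin q * sin (p + q)"
  proof -
    have *: "cos p ^ 2 = 1 - sin p ^ 2" "cos q ^ 2 = 1 - sin q ^ 2"
      by (simp_all add: cos_squared_eq)
    have "sin (2 * q) + sin (2 * p) - sin (2 * (p + q)) =
        2 * sin q * cos q * (1 + sin p ^ 2 - cos p ^ 2) + 2 * sin p * cos p * (1 + sin q ^ 2 - cos q ^ 2)"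
      unfolding sin_double sin_add cos_add by (simp add: algebra_simps power2_eq_square)
    also have "\<dots> = 4 * sin p * sin q * sin (p + q)"
      unfolding * sin_add by (simp add: algebra_simps power2_eq_square)
    finally show ?thesis .
  qed
  finally show ?thesis
    by (simp add: s t field_simps)
qed

lemma ori_cis_pos:
  assumes "r < s" "s < t" "t < r + 2 * pi"
  shows "ori (cis r) (cis s) (cis t) > 0"
  unfolding ori_cis using assms by (intro mult_pos_pos sin_gt_zero) auto

lemma ccw_order_ori:
  assumes "ccw_order a b c d"
  shows "ori a b c > 0" "ori a b d > 0" "ori a c d > 0" "ori b c d > 0"
  using assms unfolding ccw_order_def by (auto intro!: ori_cis_pos)

lemma ccw_order_rotate:
  assumes "ccw_order a b c d"
  shows "ccw_order b c d a"
proof -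
  obtain r s t w where *: "r < s" "s < t" "t < w" "w < r + 2 * pi"
    "a = cis r" "b = cis s" "c = cis t" "d = cis w"
    using assms unfolding ccw_order_def by blast
  then have "a = cis (r + 2 * pi)"
    by (simp add: cis_mult[symmetric])
  with * show ?thesis
    unfolding ccw_order_def by (intro exI[of _ s] exI[of _ t] exI[of _ w] exI[of _ "r + 2 * pi"]) auto
qed

section \<open>Balanced points of a charge distribution on the circle\<close>

definition balanced :: "complex set \<Rightarrow> (complex \<Rightarrow> real) \<Rightarrow> complex \<Rightarrow> bool"
  where "balanced E r u \<longleftrightarrow>
    (\<Sum>a\<in>E. r a / (cmod (u - a))\<^sup>2) = 0 \<and> (\<Sum>a\<in>E. of_real (r a / (cmod (u - a))\<^sup>2) * a) = 0"

definition aff :: "real \<Rightarrow> complex \<Rightarrow> complex \<Rightarrow> real"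
  where "aff k w a = k + Re (w * a)"

lemma ori_aff: "\<exists>k w. \<forall>z. ori a b z = aff k w z"
proof (intro exI allI)
  fix z
  show "ori a b z = aff (- Im (cnj (b - a) * a)) (- \<i> * cnj (b - a)) z"
    by (simp add: ori_def aff_def algebra_simps)
qed

lemma sum_aff:
  assumes "(\<Sum>a\<in>E. w a) = (0 :: real)" "(\<Sum>a\<in>E. of_real (w a) * a) = (0 :: complex)"
  shows "(\<Sum>a\<in>E. w a * aff k z a) = 0"
proof -
  have "(\<Sum>a\<in>E. w a * aff k z a) = k * (\<Sum>a\<in>E. w a) + (\<Sum>a\<in>E. Re (z * (of_real (w a) * a)))"
    unfolding aff_def sum_distrib_left sum.distrib[symmetric]
    by (intro sum.cong) (auto simp: algebra_simps)
  also have "(\<Sum>a\<in>E. Re (z * (of_real (w a) * a))) = Re (z * (\<Sum>a\<in>E. of_real (w a) * a))"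
    by (simp only: Re_sum[symmetric] sum_distrib_left)
  finally show ?thesis
    using assms by simp
qed

text \<open>Since \<open>a * cnj a = 1\<close> on the circle, a product of two affine functions is
  an affine function plus the real part of a multiple of \<open>a^2\<close>.\<close>

lemma sum_aff2:
  assumes E: "E \<subseteq> unit_circle"
    and 0: "(\<Sum>a\<in>E. w a) = (0 :: real)"
    and 1: "(\<Sum>a\<in>E. of_real (w a) * a) = (0 :: complex)"
    and 2: "(\<Sum>a\<in>E. of_real (w a) * a\<^sup>2) = (0 :: complex)"
  shows "(\<Sum>a\<in>E. w a * (aff k z a * aff l v a)) = 0"
proof -
  have "w a * (aff k z a * aff l v a) =
      w a * aff (k * l + Re (z * cnj v) / 2) (of_real k * v + of_real l * z) a
      + Re (z * v * (of_real (w a) * a\<^sup>2)) / 2" if "a \<in> E" for a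
  proof -
    have n: "Re a * Re a = 1 - Im a * Im a"
      using E that by (auto simp: cmod_def power2_eq_square algebra_simps)
    have n': "Re a * (Re a * c) = c - Im a * (Im a * c)" for c
      unfolding mult.assoc[symmetric] n by (simp add: algebra_simps)
    have "aff k z a * aff l v a =
      aff (k * l + Re (z * cnj v) / 2) (of_real k * v + of_real l * z) a + Re (z * v * a\<^sup>2) / 2"
      unfolding aff_def power2_eq_square
      by (simp add: field_simps) (simp add: n' algebra_simps)
    then have "w a * (aff k z a * aff l v a) = w a * aff (k * l + Re (z * cnj v) / 2) (of_real k * v + of_real l * z) a
      + w a * Re (z * v * a\<^sup>2) / 2" by (simp add: algebra_simps)
    moreover have "Re (z * v * (of_real (w a) * a\<^sup>2)) = w a * Re (z * v * a\<^sup>2)"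
      by (simp add: algebra_simps)
    ultimately show ?thesis
      by simp
  qed
  then have "(\<Sum>a\<in>E. w a * (aff k z a * aff l v a)) =
      (\<Sum>a\<in>E. w a * aff (k * l + Re (z * cnj v) / 2) (of_real k * v + of_real l * z) a)
      + (\<Sum>a\<in>E. Re (z * v * (of_real (w a) * a\<^sup>2))) / 2"
    by (simp add: sum.distrib sum_divide_distrib)
  also have "(\<Sum>a\<in>E. Re (z * v * (of_real (w a) * a\<^sup>2))) = Re (z * v * (\<Sum>a\<in>E. of_real (w a) * a\<^sup>2))"
    by (simp only: Re_sum[symmetric] sum_distrib_left)
  finally show ?thesis
    using sum_aff[OF 0 1] 2 by simp
qed

text \<open>As \<open>cnj a = 1 / a\<close> on the circle, the squared distance is a Laurent
  polynomial in \<open>a\<close> with exponents -1, 0, 1. Multiplying a weight by it gives a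
  recurrence between its moments.\<close>

lemma cmod_diff_circle:
  assumes "a \<in> unit_circle"
  shows "complex_of_real ((cmod (u - a))\<^sup>2) = (1 + u * cnj u) - cnj u * a - u * cnj a"
    and "complex_of_real ((cmod (u - a))\<^sup>2) * a = (1 + u * cnj u) * a - cnj u * a\<^sup>2 - u"
proof -
  have n: "a * cnj a = 1"
    using assms by (simp add: complex_norm_square[symmetric])
  show *: "complex_of_real ((cmod (u - a))\<^sup>2) = (1 + u * cnj u) - cnj u * a - u * cnj a"
    unfolding complex_norm_square using n by (simp add: algebra_simps)
  show "complex_of_real ((cmod (u - a))\<^sup>2) * a = (1 + u * cnj u) * a - cnj u * a\<^sup>2 - u"
    unfolding * using n by (simp add: algebra_simps power2_eq_square)
qed

text \<open>The moments of \<open>r a / \<bar>u - a\<bar>\<^sup>2 \<bar>v - a\<bar>\<^sup>2\<close> of order at most 2 in absolute value satisfy two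
  recurrences of length 2, whose characteristic polynomials have resultant
  \<open>\<bar>u - v\<bar>\<^sup>2 \<bar>1 - v cnj u\<bar>\<^sup>2\<close>.\<close>

lemma moments_zero:
  fixes g0 g1 g2 u v :: complex
  assumes uv: "u \<noteq> v" "v * cnj u \<noteq> 1"
    and g0: "cnj g0 = g0"
    and u0: "(1 + u * cnj u) * g0 = cnj u * g1 + u * cnj g1"
    and u1: "(1 + u * cnj u) * g1 = cnj u * g2 + u * g0"
    and v0: "(1 + v * cnj v) * g0 = cnj v * g1 + v * cnj g1"
    and v1: "(1 + v * cnj v) * g1 = cnj v * g2 + v * g0"
  shows "g0 = 0" "g1 = 0" "g2 = 0"
proof -
  define u' v' h1 where "u' = cnj u" and "v' = cnj v" and "h1 = cnj g1"
  have w: "(1 + u * u') * g0 = u' * g1 + u * h1" "(1 + u * u') * g1 = u' * g2 + u * g0"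
    "(1 + v * v') * g0 = v' * g1 + v * h1" "(1 + v * v') * g1 = v' * g2 + v * g0"
    using u0 u1 v0 v1 by (simp_all add: u'_def v'_def h1_def)
  \<comment> \<open>Eliminating \<open>g2\<close> between the order 1 equations and
    \<open>h1\<close> between the order 0 equations leaves two equations in \<open>g0\<close> and
    \<open>g1\<close>, with determinant \<open>e0^2 + e1 * f0\<close> up to sign.\<close>
  define e0 e1 f0 where "e0 = v' * u - u' * v" and "e1 = u' * (1 + v * v') - v' * (1 + u * u')"
    and "f0 = u * (1 + v * v') - v * (1 + u * u')"
  have res: "e0\<^sup>2 + e1 * f0 = (u - v) * (u' - v') * (1 - v * u') * (1 - u * v')"
    by (simp add: e0_def e1_def f0_def algebra_simps power2_eq_square)
  have "v' * ((1 + u * u') * g1) - u' * ((1 + v * v') * g1) = v' * (u' * g2 + u * g0) - u' * (v' * g2 + v * g0)"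
    using w by simp
  then have k1: "e0 * g0 + e1 * g1 = 0"
    by (simp add: e0_def e1_def algebra_simps)
  have "v * ((1 + u * u') * g0) - u * ((1 + v * v') * g0) = v * (u' * g1 + u * h1) - u * (v' * g1 + v * h1)"
    using w by simp
  then have k2: "f0 * g0 - e0 * g1 = 0"
    by (simp add: e0_def f0_def algebra_simps)
  have "(e0\<^sup>2 + e1 * f0) * g0 = e0 * (e0 * g0 + e1 * g1) + e1 * (f0 * g0 - e0 * g1)"
    "(e0\<^sup>2 + e1 * f0) * g1 = f0 * (e0 * g0 + e1 * g1) - e0 * (f0 * g0 - e0 * g1)"
    by (simp_all add: algebra_simps power2_eq_square)
  then have "(e0\<^sup>2 + e1 * f0) * g0 = 0" "(e0\<^sup>2 + e1 * f0) * g1 = 0"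
    using k1 k2 by simp_all
  moreover have "(u - v) * (u' - v') * (1 - v * u') * (1 - u * v') \<noteq> 0"
  proof -
    have "1 - u * v' = cnj (1 - v * u')" "u' - v' = cnj (u - v)"
      by (simp_all add: u'_def v'_def)
    moreover have "1 - v * u' \<noteq> 0" "u - v \<noteq> 0"
      using uv by (simp_all add: u'_def)
    ultimately show ?thesis
      by (simp only: mult_eq_0_iff complex_cnj_zero_iff) simp
  qed
  ultimately show g: "g0 = 0" "g1 = 0"
    unfolding res by simp_all
  \<comment> \<open>As \<open>u \<noteq> v\<close>, one of them is nonzero.\<close>
  have "cnj u * g2 = 0" "cnj v * g2 = 0"
    using u1 v1 g by simp_all
  then show "g2 = 0"
    using uv by auto
qed

text \<open>Multiplying \<open>w\<close> by \<open>|v - a|^2\<close> gives the weight for which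
  \<open>u\<close> is balanced; expanding this factor on the circle turns the balance equations into
  recurrences. It will be applied with \<open>u\<close> and \<open>v\<close> exchanged as well, and
  with \<open>v = u\<close> for double zeros.\<close>

lemma balanced_moments:
  assumes E: "E \<subseteq> unit_circle" and u: "balanced E r u" "u \<notin> E"
    and v: "v \<notin> E" and w_def: "\<And>a. w a = r a / ((cmod (u - a))\<^sup>2 * (cmod (v - a))\<^sup>2)"
  shows "(1 + v * cnj v) * (\<Sum>a\<in>E. of_real (w a)) =
      cnj v * (\<Sum>a\<in>E. of_real (w a) * a) + v * (\<Sum>a\<in>E. of_real (w a) * cnj a)"
    and "(1 + v * cnj v) * (\<Sum>a\<in>E. of_real (w a) * a) =
      cnj v * (\<Sum>a\<in>E. of_real (w a) * a\<^sup>2) + v * (\<Sum>a\<in>E. of_real (w a))"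
proof -
  have w: "w a * (cmod (v - a))\<^sup>2 = r a / (cmod (u - a))\<^sup>2" if "a \<in> E" for a
    using that v by (auto simp: w_def)
  have "(\<Sum>a\<in>E. of_real (w a) * complex_of_real ((cmod (v - a))\<^sup>2)) = 0"
    using u(1) unfolding balanced_def of_real_mult[symmetric] of_real_sum[symmetric]
    by (simp only: w of_real_0 cong: sum.cong)
  moreover have "(\<Sum>a\<in>E. of_real (w a) * complex_of_real ((cmod (v - a))\<^sup>2)) =
      (\<Sum>a\<in>E. (1 + v * cnj v) * of_real (w a) - (cnj v * (of_real (w a) * a) + v * (of_real (w a) * cnj a)))"
    by (intro sum.cong refl, subst cmod_diff_circle(1)) (use E in \<open>auto simp: algebra_simps\<close>)
  ultimately show "(1 + v * cnj v) * (\<Sum>a\<in>E. of_real (w a)) =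
      cnj v * (\<Sum>a\<in>E. of_real (w a) * a) + v * (\<Sum>a\<in>E. of_real (w a) * cnj a)"
    by (simp add: sum_subtractf sum.distrib sum_distrib_left)
  have "(\<Sum>a\<in>E. of_real (w a) * (complex_of_real ((cmod (v - a))\<^sup>2) * a)) = 0"
    using u(1) unfolding balanced_def of_real_mult[symmetric] mult.assoc[symmetric]
    by (simp only: w cong: sum.cong)
  moreover have "(\<Sum>a\<in>E. of_real (w a) * (complex_of_real ((cmod (v - a))\<^sup>2) * a)) =
      (\<Sum>a\<in>E. (1 + v * cnj v) * (of_real (w a) * a) - (cnj v * (of_real (w a) * a\<^sup>2) + v * of_real (w a)))"
    by (intro sum.cong refl, subst cmod_diff_circle(2)) (use E in \<open>auto simp: algebra_simps\<close>)
  ultimately show "(1 + v * cnj v) * (\<Sum>a\<in>E. of_real (w a) * a) =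
      cnj v * (\<Sum>a\<in>E. of_real (w a) * a\<^sup>2) + v * (\<Sum>a\<in>E. of_real (w a))"
    by (simp add: sum_subtractf sum.distrib sum_distrib_left)
qed

lemma sum_pos_contradiction:
  fixes f :: "'a \<Rightarrow> real"
  assumes "finite E" "sum f E = 0" "\<And>a. a \<in> E \<Longrightarrow> f a \<ge> 0" "b \<in> E" "f b > 0"
  shows False
  using assms by (metis less_irrefl sum_nonneg_eq_0_iff)

text \<open>Affine functions sum to 0 against a balanced weight, so no line can have the positive
  charges on one side and the negative ones on the other.\<close>

lemma balanced_one_line:
  assumes "finite E" "balanced E r u"
    and "\<And>a. a \<in> E \<Longrightarrow> r a * aff k z a \<ge> 0" "b \<in> E" "b \<noteq> u" "r b * aff k z b > 0"
  shows False
proof (rule sum_pos_contradiction[OF assms(1)])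
  show "(\<Sum>a\<in>E. r a / (cmod (u - a))\<^sup>2 * aff k z a) = 0"
    using assms(2) by (intro sum_aff) (auto simp: balanced_def)
  show "0 \<le> r a / (cmod (u - a))\<^sup>2 * aff k z a" if "a \<in> E" for a
    using assms(3)[OF that] by simp
  show "0 < r b / (cmod (u - b))\<^sup>2 * aff k z b"
    using assms by simp
qed (fact assms)

text \<open>Balance at two points kills the moments up to order 2 of the weight with both
  denominators, hence its sum against a product of two lines. The condition
  \<open>v * cnj u \<noteq> 1\<close> excludes the reflection of \<open>u\<close>, at which the same
  charges are balanced as at \<open>u\<close>.\<close>

lemma balanced_two_lines:
  assumes E: "finite E" "E \<subseteq> unit_circle"
    and u: "balanced E r u" "u \<notin> E" and v: "balanced E r v" "v \<notin> E"
    and uv: "u \<noteq> v" "v * cnj u \<noteq> 1"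
    and sgn: "\<And>a. a \<in> E \<Longrightarrow> r a * (aff k z a * aff l y a) \<ge> 0"
    and b: "b \<in> E" "r b * (aff k z b * aff l y b) > 0"
  shows False
proof (rule sum_pos_contradiction[OF E(1)])
  define w where "w a = r a / ((cmod (u - a))\<^sup>2 * (cmod (v - a))\<^sup>2)" for a
  note 1 = balanced_moments[OF E(2) u v(2), of w, OF w_def]
  have "w a = r a / ((cmod (v - a))\<^sup>2 * (cmod (u - a))\<^sup>2)" for a
    by (simp add: w_def)
  note 2 = balanced_moments[OF E(2) v u(2), of w, OF this]
  have cnj: "(\<Sum>a\<in>E. of_real (w a) * cnj a) = cnj (\<Sum>a\<in>E. of_real (w a) * a)"
    "cnj (\<Sum>a\<in>E. of_real (w a)) = (\<Sum>a\<in>E. of_real (w a))"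
    by simp_all
  note 3 = moments_zero[OF uv cnj(2) 2[unfolded cnj(1)] 1[unfolded cnj(1)]]
  show "(\<Sum>a\<in>E. w a * (aff k z a * aff l y a)) = 0"
    using E 3 by (intro sum_aff2) (simp_all flip: of_real_sum)
  show "0 \<le> w a * (aff k z a * aff l y a)" if "a \<in> E" for a
    using sgn[OF that] by (simp add: w_def)
  show "0 < w b * (aff k z b * aff l y b)"
    unfolding w_def times_divide_eq_left by (rule divide_pos_pos[OF b(2)], intro mult_pos_pos) (use b u v in auto)
qed (fact b)

text \<open>A critical point off the circle which is double, hence so is its reflection.\<close>

lemma balanced_double:
  assumes E: "finite E" "E \<subseteq> unit_circle"
    and u: "balanced E r u" "u \<notin> E" "cmod u \<noteq> 1"
    and double: "(\<Sum>a\<in>E. of_real (r a) / (u - a)\<^sup>2) = 0"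
    and sgn: "\<And>a. a \<in> E \<Longrightarrow> r a * (aff k z a * aff l y a) \<ge> 0"
    and b: "b \<in> E" "r b * (aff k z b * aff l y b) > 0"
  shows False
proof (rule sum_pos_contradiction[OF E(1)])
  define w where "w a = r a / ((cmod (u - a))\<^sup>2 * (cmod (u - a))\<^sup>2)" for a
  define g where "g k = (\<Sum>a\<in>E. of_real (w a) * a ^ k)" for k :: nat
  have rec: "(1 + u * cnj u) * g 0 = cnj u * g 1 + u * cnj (g 1)"
    "(1 + u * cnj u) * g 1 = cnj u * g 2 + u * g 0"
    using balanced_moments[OF E(2) u(1,2,2), of w, OF w_def] by (simp_all add: g_def)
  have "(\<Sum>a\<in>E. of_real (r a) / (u - a)\<^sup>2) =
      (\<Sum>a\<in>E. (cnj u)\<^sup>2 * of_real (w a) - 2 * cnj u * cnj (of_real (w a) * a) + cnj (of_real (w a) * a\<^sup>2))"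
  proof (intro sum.cong refl)
    fix a assume "a \<in> E"
    then have "u \<noteq> a"
      using u by auto
    have "complex_of_real (w a) = of_real (r a) / (((u - a) * cnj (u - a)) * ((u - a) * cnj (u - a)))"
      unfolding w_def of_real_divide of_real_mult complex_norm_square ..
    \<comment> \<open>By \<open>1 / (u - a) = cnj (u - a) / |u - a|^2\<close>, the second order zero
      becomes a third relation between the moments of \<open>w\<close>.\<close>
    then have "of_real (r a) / (u - a)\<^sup>2 = of_real (w a) * (cnj u - cnj a)\<^sup>2"
      using \<open>u \<noteq> a\<close> by (simp add: power2_eq_square)
    then show "of_real (r a) / (u - a)\<^sup>2 = (cnj u)\<^sup>2 * of_real (w a) - 2 * cnj u * cnj (of_real (w a) * a) + cnj (of_real (w a) * a\<^sup>2)"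
      by (simp add: power2_eq_square algebra_simps)
  qed
  also have "\<dots> = (cnj u)\<^sup>2 * g 0 - 2 * cnj u * cnj (g 1) + cnj (g 2)"
    by (simp add: g_def sum.distrib sum_subtractf sum_distrib_left mult.assoc)
  finally have "(cnj u)\<^sup>2 * g 0 - 2 * cnj u * cnj (g 1) + cnj (g 2) = 0"
    using double by simp
  then have "cnj ((cnj u)\<^sup>2 * g 0 - 2 * cnj u * cnj (g 1) + cnj (g 2)) = 0"
    by simp
  moreover have g0: "cnj (g 0) = g 0"
    by (simp add: g_def)
  ultimately have g2: "g 2 = 2 * u * g 1 - u\<^sup>2 * g 0"
    by (simp add: algebra_simps)
  have u1: "1 - u * cnj u \<noteq> 0"
  proof
    assume "1 - u * cnj u = 0"
    then have "complex_of_real ((cmod u)\<^sup>2) = of_real 1"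
      unfolding complex_norm_square by simp
    then have "(cmod u)\<^sup>2 = 1"
      unfolding of_real_eq_iff .
    then show False
      using u(3) norm_ge_zero[of u] by (simp add: power2_eq_1_iff)
  qed
  \<comment> \<open>With this value of \<open>g 2\<close> the recurrences acquire the factor
    \<open>1 - u * cnj u\<close>, nonzero off the circle.\<close>
  have "(1 - u * cnj u) * (g 1 - u * g 0) = 0"
    using rec(2) unfolding g2 by (simp add: algebra_simps power2_eq_square)
  then have g1: "g 1 = u * g 0"
    using u1 by simp
  have "(1 - u * cnj u) * g 0 = 0"
    using rec(1) unfolding g1 by (simp add: algebra_simps g0)
  then have "g 0 = 0" "g 1 = 0" "g 2 = 0"
    using u1 g1 g2 by simp_all
  then show "(\<Sum>a\<in>E. w a * (aff k z a * aff l y a)) = 0"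
    using E by (intro sum_aff2) (simp_all add: g_def flip: of_real_sum)
  show "0 \<le> w a * (aff k z a * aff l y a)" if "a \<in> E" for a
    using sgn[OF that] by (simp add: w_def)
  show "0 < w b * (aff k z b * aff l y b)"
    unfolding w_def times_divide_eq_left by (rule divide_pos_pos[OF b(2)]) (use b u in auto)
qed (fact b)

section \<open>Four families of weights in cyclic order\<close>

text \<open>The weight \<open>m a / |u - a|^2\<close> times \<open>family_prod S u\<close>, and so
  without poles: for \<open>u\<close> in \<open>S\<close> only the weight of \<open>u\<close> itself
  survives.\<close>

definition family_weight :: "(complex \<Rightarrow> real) \<Rightarrow> complex set \<Rightarrow> complex \<Rightarrow> complex \<Rightarrow> real"
  where "family_weight m S u a = m a * (\<Prod>b\<in>S - {a}. (cmod (u - b))\<^sup>2)"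

definition family_det ::
    "(complex \<Rightarrow> real) \<Rightarrow> complex set \<Rightarrow> complex set \<Rightarrow> complex set \<Rightarrow> complex \<Rightarrow> real"
  where "family_det m S T R u =
    det3 (\<Sum>a\<in>S. family_weight m S u a) (\<Sum>a\<in>S. of_real (family_weight m S u a) * a)
      (\<Sum>a\<in>T. family_weight m T u a) (\<Sum>a\<in>T. of_real (family_weight m T u a) * a)
      (\<Sum>a\<in>R. family_weight m R u a) (\<Sum>a\<in>R. of_real (family_weight m R u a) * a)"

definition family_prod :: "complex set \<Rightarrow> complex \<Rightarrow> real"
  where "family_prod S u = (\<Prod>b\<in>S. (cmod (u - b))\<^sup>2)"

text \<open>Cramer's rule for the coefficient \<open>y\<close> of \<open>A\<close> in a relation
  that equates a mean of \<open>A\<close> and \<open>B\<close> with a mean of \<open>C\<close> and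
  \<open>D\<close>, numerator and denominator being multiplied by all four
  \<open>family_prod\<close>. The other coordinate is the same formula for
  \<open>C D B A\<close>.\<close>

definition coord ::
    "(complex \<Rightarrow> real) \<Rightarrow> complex set \<Rightarrow> complex set \<Rightarrow> complex set \<Rightarrow> complex set \<Rightarrow> complex \<Rightarrow> real"
  where "coord m A B C D u =
    family_prod A u * family_det m C B D u /
      (family_prod A u * family_det m C B D u + family_prod B u * family_det m A C D u)"

lemma family_det_rotate: "family_det m T R S u = family_det m S T R u"
  unfolding family_det_def by (rule det3_rotate)

text \<open>By multilinearity the determinant is a weighted sum of signed areas, which are all
  positive for families in cyclic order.\<close>

lemma det3_expand:
  "det3 (\<Sum>a\<in>S. f a) (\<Sum>a\<in>S. of_real (f a) * a) (\<Sum>b\<in>T. g b) (\<Sum>b\<in>T. of_real (g b) * b)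
     (\<Sum>c\<in>R. h c) (\<Sum>c\<in>R. of_real (h c) * c) =
   (\<Sum>a\<in>S. \<Sum>b\<in>T. \<Sum>c\<in>R. f a * g b * h c * ori a b c)"
proof -
  have 1: "det3 (\<Sum>a\<in>S. f a) (\<Sum>a\<in>S. of_real (f a) * a) s v t w = (\<Sum>a\<in>S. f a * det3 1 a s v t w)"
    for S :: "complex set" and f s v t w
  proof -
    have "Im (cnj (\<Sum>a\<in>S. of_real (f a) * a) * z) = (\<Sum>a\<in>S. f a * Im (cnj a * z))" for z
      by (simp only: cnj_sum sum_distrib_right Im_sum) (simp add: algebra_simps)
    then have "det3 (\<Sum>a\<in>S. f a) (\<Sum>a\<in>S. of_real (f a) * a) s v t w =
        (\<Sum>a\<in>S. f a * Im (cnj v * w) - s * (f a * Im (cnj a * w)) + t * (f a * Im (cnj a * v)))"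
      unfolding det3_def by (simp only: sum_distrib_left sum_distrib_right sum_subtractf sum.distrib)
    then show ?thesis
      by (simp add: det3_def algebra_simps)
  qed
  let ?g = "\<Sum>b\<in>T. g b" and ?g' = "\<Sum>b\<in>T. of_real (g b) * b"
    and ?h = "\<Sum>c\<in>R. h c" and ?h' = "\<Sum>c\<in>R. of_real (h c) * c"
  have 2: "det3 1 a ?g ?g' ?h ?h' = (\<Sum>b\<in>T. g b * det3 1 b ?h ?h' 1 a)" for a
    using 1[where S = T and f = g] det3_rotate[of ?g ?g' ?h ?h' 1 a] by simp
  have 3: "det3 1 b ?h ?h' 1 a = (\<Sum>c\<in>R. h c * ori a b c)" for a b
  proof -
    have "ori c a b = ori a b c" for c
      by (rule trans[OF ori_rotate ori_rotate])
    then show ?thesis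
      using 1[where S = R and f = h] det3_rotate[of ?h ?h' 1 a 1 b] by (simp add: det3_ori)
  qed
  show ?thesis
    unfolding 1[where S = S and f = f] 2 3 sum_distrib_left mult.assoc ..
qed

lemma family_weight_nonneg:
  "(\<And>a. a \<in> S \<Longrightarrow> m a > 0) \<Longrightarrow> a \<in> S \<Longrightarrow> family_weight m S u a \<ge> 0"
  unfolding family_weight_def by (intro mult_nonneg_nonneg prod_nonneg) (auto intro: less_imp_le)

lemma family_weight_pos:
  assumes "finite S" "S \<noteq> {}" "\<And>a. a \<in> S \<Longrightarrow> m a > 0"
  obtains a where "a \<in> S" "family_weight m S u a > 0"
proof -
  \<comment> \<open>If \<open>u\<close> is in \<open>S\<close>, all other weights vanish, so
    \<open>u\<close> must be chosen.\<close>
  obtain a where a: "a \<in> S" "u \<in> S \<Longrightarrow> a = u"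
    using assms(2) by blast
  then have "family_weight m S u a > 0"
    using assms unfolding family_weight_def
    by (intro mult_pos_pos prod_pos) auto
  with a that show ?thesis by blast
qed

lemma family_det_pos:
  assumes S: "finite S" "S \<noteq> {}" "\<And>a. a \<in> S \<Longrightarrow> m a > 0"
    and T: "finite T" "T \<noteq> {}" "\<And>a. a \<in> T \<Longrightarrow> m a > 0"
    and R: "finite R" "R \<noteq> {}" "\<And>a. a \<in> R \<Longrightarrow> m a > 0"
    and ori: "\<And>a b c. a \<in> S \<Longrightarrow> b \<in> T \<Longrightarrow> c \<in> R \<Longrightarrow> ori a b c > 0"
  shows "family_det m S T R u > 0"
proof -
  obtain a where a: "a \<in> S" "family_weight m S u a > 0"
    using family_weight_pos[OF S] .
  obtain b where b: "b \<in> T" "family_weight m T u b > 0"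
    using family_weight_pos[OF T] .
  obtain c where c: "c \<in> R" "family_weight m R u c > 0"
    using family_weight_pos[OF R] .
  note p = a b c
  let ?f = "\<lambda>a b c. family_weight m S u a * family_weight m T u b * family_weight m R u c * ori a b c"
  have nn: "?f a b c \<ge> 0" if "a \<in> S" "b \<in> T" "c \<in> R" for a b c
    using that family_weight_nonneg[OF S(3)] family_weight_nonneg[OF T(3)]
      family_weight_nonneg[OF R(3)] ori[OF that] by simp
  have "0 < ?f a b c"
    using p ori[of a b c] by simp
  also have "\<dots> \<le> (\<Sum>c\<in>R. ?f a b c)"
    using p nn R by (intro member_le_sum) auto
  also have "\<dots> \<le> (\<Sum>b\<in>T. \<Sum>c\<in>R. ?f a b c)"
    using p nn T by (intro member_le_sum[of b T "\<lambda>b. \<Sum>c\<in>R. ?f a b c"] sum_nonneg) auto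
  also have "\<dots> \<le> (\<Sum>a\<in>S. \<Sum>b\<in>T. \<Sum>c\<in>R. ?f a b c)"
    using p nn S by (intro member_le_sum[of a S "\<lambda>a. \<Sum>b\<in>T. \<Sum>c\<in>R. ?f a b c"] sum_nonneg) auto
  finally show ?thesis
    unfolding family_det_def det3_expand .
qed

lemma family_prod_nonneg: "family_prod S u \<ge> 0"
  unfolding family_prod_def by (intro prod_nonneg) auto

lemma family_prod_pos: "finite S \<Longrightarrow> u \<notin> S \<Longrightarrow> family_prod S u > 0"
  unfolding family_prod_def by (intro prod_pos) auto

lemma family_prod_eq_0: "finite S \<Longrightarrow> family_prod S u = 0 \<longleftrightarrow> u \<in> S"
  unfolding family_prod_def by auto

lemma continuous_on_family_prod: "continuous_on U (family_prod S)"
  unfolding family_prod_def[abs_def] by (intro continuous_intros)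

lemma continuous_on_family_det: "continuous_on U (family_det m S T R)"
  unfolding family_det_def[abs_def] det3_def family_weight_def
  by (intro continuous_intros)

lemma family_weight_normalized:
  assumes "finite S" "u \<notin> S" "a \<in> S"
  shows "family_weight m S u a = m a / (cmod (u - a))\<^sup>2 * family_prod S u"
proof -
  have "family_prod S u = (cmod (u - a))\<^sup>2 * (\<Prod>b\<in>S - {a}. (cmod (u - b))\<^sup>2)"
    unfolding family_prod_def using assms by (intro prod.remove)
  then show ?thesis
    using assms by (auto simp: family_weight_def)
qed

definition moment0 :: "(complex \<Rightarrow> real) \<Rightarrow> complex set \<Rightarrow> complex \<Rightarrow> real"
  where "moment0 m S u = (\<Sum>a\<in>S. m a / (cmod (u - a))\<^sup>2)"

definition moment1 :: "(complex \<Rightarrow> real) \<Rightarrow> complex set \<Rightarrow> complex \<Rightarrow> complex"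
  where "moment1 m S u = (\<Sum>a\<in>S. of_real (m a / (cmod (u - a))\<^sup>2) * a)"

lemma family_det_normalized:
  assumes "finite S" "u \<notin> S" "finite T" "u \<notin> T" "finite R" "u \<notin> R"
  shows "family_det m S T R u = family_prod S u * family_prod T u * family_prod R u *
    det3 (moment0 m S u) (moment1 m S u) (moment0 m T u) (moment1 m T u) (moment0 m R u) (moment1 m R u)"
proof -
  have *: "(\<Sum>a\<in>S. family_weight m S u a) = family_prod S u * moment0 m S u"
    "(\<Sum>a\<in>S. of_real (family_weight m S u a) * a) = of_real (family_prod S u) * moment1 m S u"
    if "finite S" "u \<notin> S" for S
    using that by (simp_all add: moment0_def moment1_def sum_distrib_left family_weight_normalized mult_ac)
  show ?thesis
    unfolding family_det_def *[OF assms(1,2)] *[OF assms(3,4)] *[OF assms(5,6)]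
    by (simp add: det3_def algebra_simps)
qed

text \<open>\<open>A\<close>, \<open>B\<close>, \<open>C\<close>, \<open>D\<close> are the values of
  \<open>alpha\<close>, \<open>beta\<close>, \<open>gamma\<close>, \<open>delta\<close>, so the
  counterclockwise order is \<open>A\<close>, \<open>C\<close>, \<open>B\<close>, \<open>D\<close>;
  \<open>m a\<close> is the share of the period that has angle \<open>a\<close>.\<close>

locale circular_weights =
  fixes A B C D :: "complex set" and m :: "complex \<Rightarrow> real"
  assumes fin: "finite A" "finite B" "finite C" "finite D"
    and ne: "A \<noteq> {}" "B \<noteq> {}" "C \<noteq> {}" "D \<noteq> {}"
    and circ: "A \<subseteq> unit_circle" "B \<subseteq> unit_circle" "C \<subseteq> unit_circle" "D \<subseteq> unit_circle"
    and pos: "\<And>a. a \<in> A \<union> B \<union> C \<union> D \<Longrightarrow> m a > 0"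
    and mass: "sum m A = 1" "sum m B = 1" "sum m C = 1" "sum m D = 1"
    and ccw: "\<And>a b c d. a \<in> A \<Longrightarrow> b \<in> B \<Longrightarrow> c \<in> C \<Longrightarrow> d \<in> D \<Longrightarrow> ccw_order a c b d"
begin

text \<open>Transfers statements about \<open>A\<close> to the other families; on the square it is
  the quarter turn of \<open>point_rotated\<close>.\<close>

lemma rotated: "circular_weights C D B A m"
proof
  show "ccw_order a c b d" if "a \<in> C" "b \<in> D" "c \<in> B" "d \<in> A" for a b c d
    by (rule ccw_order_rotate) (rule ccw[OF that(4,3,1,2)])
  show "m a > 0" if "a \<in> C \<union> D \<union> B \<union> A" for a
    using that by (intro pos) blast
qed (fact fin ne circ mass)+

lemma ori_pos:
  assumes "a \<in> A" "b \<in> B" "c \<in> C" "d \<in> D"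
  shows "ori a c b > 0" "ori a c d > 0" "ori a b d > 0" "ori c b d > 0"
  using ccw_order_ori[OF ccw[OF assms]] by simp_all

lemma disjoint: "A \<inter> B = {}" "A \<inter> C = {}" "A \<inter> D = {}" "B \<inter> C = {}" "B \<inter> D = {}" "C \<inter> D = {}"
proof -
  obtain a b c d where *: "a \<in> A" "b \<in> B" "c \<in> C" "d \<in> D"
    using ne by blast
  have 0: "ori x x y = 0" "ori x y x = 0" "ori x y y = 0" for x y
    by (simp_all add: ori_def algebra_simps)
  show "A \<inter> B = {}"
    using ori_pos(1)[OF _ _ *(3,4)] 0 by (metis disjoint_iff less_irrefl)
  show "A \<inter> C = {}"
    using ori_pos(1)[OF _ *(2) _ *(4)] 0 by (metis disjoint_iff less_irrefl)
  show "A \<inter> D = {}"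
    using ori_pos(2)[OF _ *(2,3)] 0 by (metis disjoint_iff less_irrefl)
  show "B \<inter> C = {}"
    using ori_pos(4)[OF *(1) _ _ *(4)] 0 by (metis disjoint_iff less_irrefl)
  show "B \<inter> D = {}"
    using ori_pos(4)[OF *(1) _ *(3)] 0 by (metis disjoint_iff less_irrefl)
  show "C \<inter> D = {}"
    using ori_pos(4)[OF *(1,2)] 0 by (metis disjoint_iff less_irrefl)
qed

definition angles :: "complex set"
  where "angles = A \<union> B \<union> C \<union> D"

text \<open>For \<open>a\<close> in \<open>angles\<close>, the residue at \<open>a\<close> of the
  derivative of the action at \<open>p\<close>.\<close>

definition charge :: "real \<times> real \<Rightarrow> complex \<Rightarrow> real"
  where "charge p a = (if a \<in> A then snd p * m a else if a \<in> B then (1 - snd p) * m a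
    else if a \<in> C then - fst p * m a else - (1 - fst p) * m a)"

lemma charge_simps:
  "a \<in> A \<Longrightarrow> charge p a = snd p * m a" "a \<in> B \<Longrightarrow> charge p a = (1 - snd p) * m a"
  "a \<in> C \<Longrightarrow> charge p a = - fst p * m a" "a \<in> D \<Longrightarrow> charge p a = - (1 - fst p) * m a"
  using disjoint disjoint_iff[of _ A] disjoint_iff[of _ B] disjoint_iff[of C D]
  unfolding charge_def by (metis IntI empty_iff)+

lemma finite_angles: "finite angles" and angles_circle: "angles \<subseteq> unit_circle"
  using fin circ by (auto simp: angles_def)

lemma sum_angles:
  fixes f :: "complex \<Rightarrow> 'b :: comm_monoid_add"
  shows "sum f angles = sum f A + sum f B + sum f C + sum f D"
proof -
  have "(A \<union> B \<union> C) \<inter> D = {}" "(A \<union> B) \<inter> C = {}"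
    using disjoint by blast+
  then show ?thesis
    unfolding angles_def using disjoint(1) fin by (simp only: sum.union_disjoint finite_UnI)
qed

lemma sum_charge:
  fixes g :: "complex \<Rightarrow> 'b :: real_vector"
  shows "(\<Sum>a\<in>angles. charge p a *\<^sub>R g a) =
    snd p *\<^sub>R (\<Sum>a\<in>A. m a *\<^sub>R g a) + (1 - snd p) *\<^sub>R (\<Sum>a\<in>B. m a *\<^sub>R g a)
    - fst p *\<^sub>R (\<Sum>a\<in>C. m a *\<^sub>R g a) - (1 - fst p) *\<^sub>R (\<Sum>a\<in>D. m a *\<^sub>R g a)"
proof -
  have *: "(\<Sum>a\<in>S. charge p a *\<^sub>R g a) = c *\<^sub>R (\<Sum>a\<in>S. m a *\<^sub>R g a)"
    if "\<And>a. a \<in> S \<Longrightarrow> charge p a = c * m a" for S c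
    unfolding scaleR_sum_right by (intro sum.cong refl) (simp add: that)
  have "(\<Sum>a\<in>A. charge p a *\<^sub>R g a) = snd p *\<^sub>R (\<Sum>a\<in>A. m a *\<^sub>R g a)"
    "(\<Sum>a\<in>B. charge p a *\<^sub>R g a) = (1 - snd p) *\<^sub>R (\<Sum>a\<in>B. m a *\<^sub>R g a)"
    "(\<Sum>a\<in>C. charge p a *\<^sub>R g a) = - fst p *\<^sub>R (\<Sum>a\<in>C. m a *\<^sub>R g a)"
    "(\<Sum>a\<in>D. charge p a *\<^sub>R g a) = - (1 - fst p) *\<^sub>R (\<Sum>a\<in>D. m a *\<^sub>R g a)"
    by (intro * charge_simps; assumption)+
  then show ?thesis
    unfolding sum_angles
    by (simp only: scaleR_minus_left diff_conv_add_uminus)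
qed

lemma sum_charge_1: "(\<Sum>a\<in>angles. charge p a) = 0"
  using sum_charge[of p "\<lambda>_. 1 :: real"] mass by simp

lemma det_pos:
  "family_det m C B D u > 0" "family_det m A C D u > 0"
  "family_det m A B D u > 0" "family_det m A C B u > 0"
proof -
  obtain a b c d where "a \<in> A" "b \<in> B" "c \<in> C" "d \<in> D"
    using ne by blast
  then show "family_det m C B D u > 0" "family_det m A C D u > 0"
    "family_det m A B D u > 0" "family_det m A C B u > 0"
    using ori_pos by (auto intro!: family_det_pos fin ne pos)
qed

definition point :: "complex \<Rightarrow> real \<times> real"
  where "point u = (coord m C D B A u, coord m A B C D u)"

text \<open>\<open>A\<close> and \<open>B\<close> are disjoint, so the two products never vanish
  together. This extends the parametrization across the angles.\<close>

lemma coord_denom_pos: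
  "family_prod A u * family_det m C B D u + family_prod B u * family_det m A C D u > 0"
proof (cases "u \<in> A")
  case True
  then have "family_prod B u > 0"
    using fin disjoint by (auto intro!: family_prod_pos)
  then show ?thesis
    using det_pos[of u] family_prod_nonneg[of A u] by (simp add: add_nonneg_pos)
next
  case False
  then have "family_prod A u > 0"
    using fin by (auto intro!: family_prod_pos)
  then show ?thesis
    using det_pos[of u] family_prod_nonneg[of B u] by (simp add: add_pos_nonneg)
qed

lemma coord_range: "coord m A B C D u \<ge> 0" "coord m A B C D u \<le> 1"
  "coord m A B C D u = 0 \<longleftrightarrow> u \<in> A" "coord m A B C D u = 1 \<longleftrightarrow> u \<in> B"
proof -
  define s t where "s = family_prod A u * family_det m C B D u" and "t = family_prod B u * family_det m A C D u"
  have *: "s \<ge> 0" "t \<ge> 0" "s + t > 0" "s = 0 \<longleftrightarrow> u \<in> A" "t = 0 \<longleftrightarrow> u \<in> B"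
    using coord_denom_pos[of u] det_pos[of u] family_prod_nonneg[of A u] family_prod_nonneg[of B u]
      family_prod_eq_0[OF fin(1)] family_prod_eq_0[OF fin(2)]
    by (simp_all add: s_def t_def)
  have c: "coord m A B C D u = s / (s + t)"
    by (simp add: coord_def s_def t_def)
  show "coord m A B C D u \<ge> 0" "coord m A B C D u \<le> 1"
    "coord m A B C D u = 0 \<longleftrightarrow> u \<in> A" "coord m A B C D u = 1 \<longleftrightarrow> u \<in> B"
    unfolding c using * by (auto simp: divide_simps)
qed

lemma continuous_on_coord: "continuous_on U (coord m A B C D)"
  unfolding coord_def[abs_def]
  by (intro continuous_intros continuous_on_family_prod continuous_on_family_det)
    (use coord_denom_pos in \<open>simp add: less_le\<close>)

lemma coord_normalized:
  assumes "u \<notin> angles"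
  defines "d \<equiv> \<lambda>S T R. det3 (moment0 m S u) (moment1 m S u) (moment0 m T u) (moment1 m T u)
    (moment0 m R u) (moment1 m R u)"
  shows "coord m A B C D u = d C B D / (d C B D + d A C D)"
    and "d C B D > 0" "d A C D > 0"
proof -
  have u: "u \<notin> A" "u \<notin> B" "u \<notin> C" "u \<notin> D"
    using assms by (auto simp: angles_def)
  define P where "P = family_prod A u * family_prod B u * family_prod C u * family_prod D u"
  have *: "family_prod A u * family_det m C B D u = P * d C B D"
    "family_prod B u * family_det m A C D u = P * d A C D"
    unfolding d_def P_def by (simp_all add: family_det_normalized[OF fin(3) u(3) fin(2) u(2) fin(4) u(4)]
        family_det_normalized[OF fin(1) u(1) fin(3) u(3) fin(4) u(4)])
  have P: "P > 0" "family_prod A u > 0" "family_prod B u > 0"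
    using fin u family_prod_pos by (auto simp: P_def)
  show "coord m A B C D u = d C B D / (d C B D + d A C D)"
    unfolding coord_def * distrib_left[symmetric] using P by simp
  have "P * d C B D > 0" "P * d A C D > 0"
    unfolding *[symmetric] using det_pos[of u] P by simp_all
  then show "d C B D > 0" "d A C D > 0"
    using P by (simp_all add: zero_less_mult_iff)
qed

lemma balanced_moments_iff:
  assumes "u \<notin> angles"
  shows "balanced angles (charge (x, y)) u \<longleftrightarrow>
    y * moment0 m A u + (1 - y) * moment0 m B u = x * moment0 m C u + (1 - x) * moment0 m D u \<and>
    y *\<^sub>R moment1 m A u + (1 - y) *\<^sub>R moment1 m B u = x *\<^sub>R moment1 m C u + (1 - x) *\<^sub>R moment1 m D u"
proof -
  have "(\<Sum>a\<in>angles. charge (x, y) a / (cmod (u - a))\<^sup>2) =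
      y * moment0 m A u + (1 - y) * moment0 m B u - x * moment0 m C u - (1 - x) * moment0 m D u"
    using sum_charge[of "(x, y)" "\<lambda>a. 1 / (cmod (u - a))\<^sup>2"] by (simp add: moment0_def)
  moreover have "(\<Sum>a\<in>angles. of_real (charge (x, y) a / (cmod (u - a))\<^sup>2) * a) =
      y *\<^sub>R moment1 m A u + (1 - y) *\<^sub>R moment1 m B u - x *\<^sub>R moment1 m C u - (1 - x) *\<^sub>R moment1 m D u"
    using sum_charge[of "(x, y)" "\<lambda>a. (1 / (cmod (u - a))\<^sup>2) *\<^sub>R a"]
    by (simp add: moment1_def scaleR_conv_of_real)
  ultimately show ?thesis
    unfolding balanced_def by (simp only:) (simp add: algebra_simps)
qed

text \<open>By \<open>|u - a|^2 = 1 + |u|^2 - 2 Re (cnj u * a)\<close>, one linear functional takes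
  the value 1 on the moment vectors of all families. It provides the normalization that Cramer's
  rule for a homogeneous relation lacks.\<close>

lemma moment_relation:
  assumes "S \<subseteq> unit_circle" "u \<notin> S" "sum m S = 1"
  shows "(1 + (cmod u)\<^sup>2) * moment0 m S u - 2 * Re (cnj u * moment1 m S u) = 1"
proof -
  have "(1 + (cmod u)\<^sup>2) * (m a / (cmod (u - a))\<^sup>2) - 2 * Re (cnj u * (of_real (m a / (cmod (u - a))\<^sup>2) * a)) = m a"
    if "a \<in> S" for a
  proof -
    have "(Re a)\<^sup>2 + (Im a)\<^sup>2 = 1"
      using assms that by (auto simp: cmod_def)
    then have *: "(cmod (u - a))\<^sup>2 = 1 + (cmod u)\<^sup>2 - 2 * Re (cnj u * a)"
      unfolding cmod_power2 by (simp add: power2_eq_square algebra_simps)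
    have "cnj u * (of_real (m a / (cmod (u - a))\<^sup>2) * a) = of_real (m a / (cmod (u - a))\<^sup>2) * (cnj u * a)"
      by (simp only: mult_ac)
    then have "(1 + (cmod u)\<^sup>2) * (m a / (cmod (u - a))\<^sup>2) - 2 * Re (cnj u * (of_real (m a / (cmod (u - a))\<^sup>2) * a)) =
        m a / (cmod (u - a))\<^sup>2 * (1 + (cmod u)\<^sup>2 - 2 * Re (cnj u * a))"
      by (simp only: Re_complex_of_real times_complex.simps Im_complex_of_real)
        (simp add: algebra_simps add_divide_distrib)
    also have "\<dots> = m a"
      using assms that unfolding *[symmetric] by auto
    finally show ?thesis .
  qed
  then have "(\<Sum>a\<in>S. (1 + (cmod u)\<^sup>2) * (m a / (cmod (u - a))\<^sup>2) - 2 * Re (cnj u * (of_real (m a / (cmod (u - a))\<^sup>2) * a))) = 1"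
    using assms(3) by simp
  then show ?thesis
    unfolding moment0_def moment1_def sum_distrib_left Re_sum by (simp only: sum_subtractf)
qed

text \<open>Balance is a relation between four vectors in three dimensions, with coefficients
  \<open>y\<close>, \<open>1 - y\<close>, \<open>- x\<close>, \<open>- (1 - x)\<close>. Any three of
  them are independent, so the relation is unique up to a factor and given by the minors, whose
  signs the cyclic order controls. By \<open>moment_relation\<close> the two pairs of minors have
  equal sums, so one factor normalizes both.\<close>

lemma balanced_iff:
  assumes u: "u \<notin> angles"
  shows "balanced angles (charge p) u \<longleftrightarrow> p = point u"
proof -
  obtain x y where p: "p = (x, y)" by force
  have u': "u \<notin> A" "u \<notin> B" "u \<notin> C" "u \<notin> D"
    using u by (auto simp: angles_def)
  interpret R: circular_weights C D B A m
    by (rule rotated)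
  have R: "R.angles = angles"
    by (auto simp: R.angles_def angles_def)
  define a b c d a' b' c' d' where s: "a = moment0 m A u" "b = moment0 m B u" "c = moment0 m C u" "d = moment0 m D u"
    "a' = moment1 m A u" "b' = moment1 m B u" "c' = moment1 m C u" "d' = moment1 m D u"
  note cn = coord_normalized[OF u, folded s]
  note rn = R.coord_normalized[unfolded R, OF u, folded s]
  let ?cbd = "det3 c c' b b' d d'" and ?acd = "det3 a a' c c' d d'"
  let ?abd = "det3 a a' b b' d d'" and ?acb = "det3 a a' c c' b b'"
  have rot: "det3 b b' d d' a a' = ?abd" "det3 c c' b b' a a' = ?acb"
    by (simp_all add: det3_def algebra_simps)
  have P: "?cbd > 0" "?acd > 0" "?abd > 0" "?acb > 0"
    using cn rn rot by simp_all
  have pt: "point u = (?abd / (?abd + ?acb), ?cbd / (?cbd + ?acd))"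
    by (simp add: point_def cn rn rot)
  have "balanced angles (charge p) u \<longleftrightarrow> y * a + (1 - y) * b = x * c + (1 - x) * d \<and>
      y *\<^sub>R a' + (1 - y) *\<^sub>R b' = x *\<^sub>R c' + (1 - x) *\<^sub>R d'"
    unfolding p balanced_moments_iff[OF u] s ..
  also have "\<dots> \<longleftrightarrow> p = point u"
  proof
    assume *: "y * a + (1 - y) * b = x * c + (1 - x) * d \<and>
      y *\<^sub>R a' + (1 - y) *\<^sub>R b' = x *\<^sub>R c' + (1 - x) *\<^sub>R d'"
    \<comment> \<open>The determinant with the vectors of \<open>C\<close> and \<open>D\<close>
      kills the right-hand side of the balance.\<close>
    have "y * ?acd - (1 - y) * ?cbd = det3 (y * a + (1 - y) * b) (y *\<^sub>R a' + (1 - y) *\<^sub>R b') c c' d d'"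
      by (simp add: det3_def algebra_simps)
    also have "\<dots> = 0"
      unfolding conjunct1[OF *] conjunct2[OF *] by (simp add: det3_def algebra_simps)
    finally have "y = ?cbd / (?cbd + ?acd)"
      using P by (simp add: field_simps)
    moreover have "x * ?acb - (1 - x) * ?abd = det3 (x * c + (1 - x) * d) (x *\<^sub>R c' + (1 - x) *\<^sub>R d') b b' a a'"
      by (simp add: det3_def algebra_simps)
    then have "x * ?acb - (1 - x) * ?abd = 0"
      unfolding conjunct1[OF *, symmetric] conjunct2[OF *, symmetric] by (simp add: det3_def algebra_simps)
    then have "x = ?abd / (?abd + ?acb)"
      using P by (simp add: field_simps)
    ultimately show "p = point u"
      by (simp add: p pt)
  next
    \<comment> \<open>The identity between four vectors with their minors as coefficients.\<close>
    have cramer: "?cbd * a + ?acd * b = ?abd * c + ?acb * d"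
      "?cbd *\<^sub>R a' + ?acd *\<^sub>R b' = ?abd *\<^sub>R c' + ?acb *\<^sub>R d'"
      by (simp_all add: det3_def complex_eq_iff algebra_simps)
    define l where "l = (\<lambda>s w. (1 + (cmod u)\<^sup>2) * s - 2 * Re (cnj u * w))"
    have l: "l a a' = 1" "l b b' = 1" "l c c' = 1" "l d d' = 1"
      unfolding l_def s by (intro moment_relation circ u' mass)+
    have "?cbd * l a a' + ?acd * l b b' = l (?cbd * a + ?acd * b) (?cbd *\<^sub>R a' + ?acd *\<^sub>R b')"
      by (simp add: l_def algebra_simps)
    also have "\<dots> = ?abd * l c c' + ?acb * l d d'"
      unfolding cramer by (simp add: l_def algebra_simps)
    finally have S: "?cbd + ?acd = ?abd + ?acb"
      using l by simp
    assume "p = point u"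
    then have xy: "x = ?abd / (?abd + ?acb)" "y = ?cbd / (?abd + ?acb)"
      "1 - x = ?acb / (?abd + ?acb)" "1 - y = ?acd / (?abd + ?acb)"
      using P S pt[unfolded S] by (simp_all add: p field_simps)
    show "y * a + (1 - y) * b = x * c + (1 - x) * d \<and>
      y *\<^sub>R a' + (1 - y) *\<^sub>R b' = x *\<^sub>R c' + (1 - x) *\<^sub>R d'"
    proof
      show "y * a + (1 - y) * b = x * c + (1 - x) * d"
        unfolding xy(3,4) unfolding xy(1,2) times_divide_eq_left add_divide_distrib[symmetric] cramer ..
      have "y *\<^sub>R a' + (1 - y) *\<^sub>R b' = (1 / (?abd + ?acb)) *\<^sub>R (?cbd *\<^sub>R a' + ?acd *\<^sub>R b')"
        unfolding xy(3,4) unfolding xy(1,2) by (simp add: scaleR_add_right)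
      also have "\<dots> = x *\<^sub>R c' + (1 - x) *\<^sub>R d'"
        unfolding cramer xy(3,4) unfolding xy(1,2) by (simp add: scaleR_add_right)
      finally show "y *\<^sub>R a' + (1 - y) *\<^sub>R b' = x *\<^sub>R c' + (1 - x) *\<^sub>R d'" .
    qed
  qed
  finally show ?thesis .
qed

text \<open>From an angle of \<open>A\<close> on, the families follow as \<open>C\<close>,
  \<open>B\<close>, \<open>D\<close>; \<open>c1\<close>, \<open>c2\<close> are the first and last
  points of \<open>C\<close>, and \<open>d1\<close>, \<open>d2\<close> those of \<open>D\<close>.
  The chords \<open>c2 d2\<close> and \<open>c1 d1\<close> both separate \<open>C\<close> from
  \<open>D\<close>, in opposite senses; \<open>c2 d1\<close> has \<open>C\<close> and
  \<open>D\<close> on one side and cuts off \<open>B\<close>.\<close>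

lemma arc_extremes:
  obtains c1 c2 d1 d2 where "c1 \<in> C" "c2 \<in> C" "d1 \<in> D" "d2 \<in> D"
    "\<And>c. c \<in> C \<Longrightarrow> ori c2 d2 c \<ge> 0" "\<And>d. d \<in> D \<Longrightarrow> ori c2 d2 d \<le> 0"
    "\<And>c. c \<in> C \<Longrightarrow> ori c1 d1 c \<le> 0" "\<And>d. d \<in> D \<Longrightarrow> ori c1 d1 d \<ge> 0"
    "\<And>c. c \<in> C \<Longrightarrow> ori c2 d1 c \<ge> 0" "\<And>d. d \<in> D \<Longrightarrow> ori c2 d1 d \<ge> 0"
proof -
  obtain a b where ab: "a \<in> A" "b \<in> B"
    using ne by blast
  \<comment> \<open>The argument counted from \<open>a\<close>: the cut is away from the arcs of
    \<open>C\<close> and \<open>D\<close>, so \<open>t\<close> orders their points linearly.\<close>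
  define t where "t z = Arg2pi (z / a)" for z
  have t: "z = a * cis (t z)" "0 \<le> t z" "t z < 2 * pi" if "cmod z = 1" for z
  proof -
    have "cmod a = 1"
      using ab circ by auto
    then show "z = a * cis (t z)"
      using that Arg2pi_eq[of "z / a"] unfolding t_def
      by (auto simp: norm_divide cis_conv_exp field_simps)
  qed (auto simp: t_def Arg2pi_ge_0 Arg2pi_lt_2pi)
  have ord: "t c < t d" if cd: "c \<in> C" "d \<in> D" for c d
  proof -
    obtain r s w v where *: "r < s" "s < w" "w < v" "v < r + 2 * pi"
      "a = cis r" "c = cis s" "b = cis w" "d = cis v"
      using ccw[OF ab cd] unfolding ccw_order_def by blast
    have "t c = s - r" "t d = v - r"
      unfolding t_def * cis_divide by (rule Arg2pi_unique[of 1], use * in \<open>auto simp: cis_conv_exp\<close>)+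
    then show ?thesis
      using * by simp
  qed
  have o: "ori u v w > 0" if "t u < t v" "t v < t w" "cmod u = 1" "cmod v = 1" "cmod w = 1" for u v w
  proof -
    have "cmod a = 1"
      using ab circ by auto
    then have "a = cis (Arg a)"
      using cis_Arg[of a] by (metis norm_zero zero_neq_one sgn_eq div_by_1 of_real_1)
    then have "u = cis (Arg a + t u)" "v = cis (Arg a + t v)" "w = cis (Arg a + t w)"
      using t(1)[of u] t(1)[of v] t(1)[of w] that by (simp_all flip: cis_mult)
    then show ?thesis
      using that t(2)[of u] t(3)[of w] ori_cis_pos[of "Arg a + t u" "Arg a + t v" "Arg a + t w"] by simp
  qed
  have inj: "z = z'" if "t z = t z'" "cmod z = 1" "cmod z' = 1" for z z'
    using t(1)[of z] t(1)[of z'] that by metis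
  have n: "cmod z = 1" if "z \<in> C \<union> D" for z
    using that circ by auto
  obtain c1 where c1: "c1 \<in> C" "\<And>c. c \<in> C \<Longrightarrow> t c1 \<le> t c"
    using ex_min_if_finite[of "t ` C"] fin ne by (metis (no_types, lifting) finite_imageI image_iff image_is_empty linorder_not_le)
  obtain c2 where c2: "c2 \<in> C" "\<And>c. c \<in> C \<Longrightarrow> t c \<le> t c2"
    using Max_in[of "t ` C"] Max_ge[of "t ` C"] fin ne by (metis (no_types, lifting) finite_imageI imageE imageI image_is_empty)
  obtain d1 where d1: "d1 \<in> D" "\<And>d. d \<in> D \<Longrightarrow> t d1 \<le> t d"
    using Min_in[of "t ` D"] Min_le[of "t ` D"] fin ne by (metis (no_types, lifting) finite_imageI imageE imageI image_is_empty)
  obtain d2 where d2: "d2 \<in> D" "\<And>d. d \<in> D \<Longrightarrow> t d \<le> t d2"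
    using Max_in[of "t ` D"] Max_ge[of "t ` D"] fin ne by (metis (no_types, lifting) finite_imageI imageE imageI image_is_empty)
  have z: "ori x y x = 0" "ori x y y = 0" for x y
    by (simp_all add: ori_def algebra_simps)
  have O: "ori u v w \<ge> 0 \<and> ori v w u \<ge> 0 \<and> ori u w v \<le> 0"
    if "t u \<le> t v" "t v \<le> t w" "u \<in> C \<union> D" "v \<in> C \<union> D" "w \<in> C \<union> D" for u v w
  proof -
    have "ori u v w \<ge> 0"
    proof (cases "t u < t v \<and> t v < t w")
      case True
      then show ?thesis using o[of u v w] n that by auto
    next
      case False
      then have "u = v \<or> v = w"
        using inj n that by (metis linorder_not_le order_antisym)
      then show ?thesis
        by (auto simp: ori_def algebra_simps)
    qed
    then show ?thesis
      using ori_rotate[of v w u] ori_swap[of u w v] by simp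
  qed
  show ?thesis
  proof (rule that[OF c1(1) c2(1) d1(1) d2(1)])
    fix c assume c: "c \<in> C"
    show "ori c2 d2 c \<ge> 0"
      using O[of c c2 d2] c c2 d2 ord[of c2 d2] by auto
    show "ori c1 d1 c \<le> 0"
      using O[of c1 c d1] c c1 d1 ord[of c d1] by auto
    show "ori c2 d1 c \<ge> 0"
      using O[of c c2 d1] c c2 d1 ord[of c2 d1] by auto
  next
    fix d assume d: "d \<in> D"
    show "ori c2 d2 d \<le> 0"
      using O[of c2 d d2] d c2 d2 ord[of c2 d] by auto
    show "ori c1 d1 d \<ge> 0"
      using O[of c1 d1 d] d c1 d1 ord[of c1 d1] by auto
    show "ori c2 d1 d \<ge> 0"
      using O[of c2 d1 d] d c2 d1 ord[of c2 d1] by auto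
  qed
qed

text \<open>The residues change sign four times around the circle; so does a product of two lines.\<close>

lemma two_separating_lines:
  assumes p: "p \<in> unit_square"
  obtains k z l w b where "\<And>a. a \<in> angles \<Longrightarrow> charge p a * (aff k z a * aff l w a) \<ge> 0"
    "b \<in> angles" "charge p b * (aff k z b * aff l w b) > 0"
proof -
  obtain c1 c2 d1 d2 where cd: "c1 \<in> C" "c2 \<in> C" "d1 \<in> D" "d2 \<in> D"
    and o: "\<And>c. c \<in> C \<Longrightarrow> ori c2 d2 c \<ge> 0" "\<And>d. d \<in> D \<Longrightarrow> ori c2 d2 d \<le> 0"
    "\<And>c. c \<in> C \<Longrightarrow> ori c1 d1 c \<le> 0" "\<And>d. d \<in> D \<Longrightarrow> ori c1 d1 d \<ge> 0"
    using arc_extremes by metis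
  obtain k z l w where kz: "\<And>a. ori c2 d2 a = aff k z a" "\<And>a. ori c1 d1 a = aff l w a"
    using ori_aff by metis
  have xy: "0 \<le> fst p" "fst p \<le> 1" "0 \<le> snd p" "snd p \<le> 1"
    using p by (auto simp: unit_square_def)
  obtain a0 b0 where ab: "a0 \<in> A" "b0 \<in> B"
    using ne by blast
  have oA: "ori c2 d2 a * ori c1 d1 a > 0" if "a \<in> A" for a
    using ori_pos(2)[OF that ab(2) cd(2,4)] ori_pos(2)[OF that ab(2) cd(1,3)]
    by (simp add: ori_rotate[symmetric, of a])
  have oB: "ori c2 d2 b * ori c1 d1 b > 0" if "b \<in> B" for b
    using ori_pos(4)[OF ab(1) that cd(2,4)] ori_pos(4)[OF ab(1) that cd(1,3)]
    by (simp add: ori_swap[of c2 b] ori_swap[of c1 b] zero_less_mult_iff)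
  have oC: "ori c2 d2 c * ori c1 d1 c \<le> 0" if "c \<in> C" for c
    using o(1,3)[OF that] by (simp add: mult_nonneg_nonpos)
  have oD: "ori c2 d2 d * ori c1 d1 d \<le> 0" if "d \<in> D" for d
    using o(2,4)[OF that] by (simp add: mult_nonpos_nonneg)
  have m: "m a > 0" if "a \<in> angles" for a
    using that pos by (simp add: angles_def)
  show ?thesis
  proof (rule that)
    fix a assume a: "a \<in> angles"
    then consider "a \<in> A" | "a \<in> B" | "a \<in> C" | "a \<in> D"
      by (auto simp: angles_def)
    then show "charge p a * (aff k z a * aff l w a) \<ge> 0"
    proof cases
      case 1
      then show ?thesis
        using oA[OF 1] m[OF a] xy unfolding kz by (simp add: charge_simps)
    next
      case 2
      then show ?thesis
        using oB[OF 2] m[OF a] xy unfolding kz by (simp add: charge_simps)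
    next
      case 3
      then show ?thesis
        using oC[OF 3] m[OF a] xy unfolding kz by (simp add: charge_simps mult_nonneg_nonpos)
    next
      case 4
      have "(1 - fst p) * m a * (ori c2 d2 a * ori c1 d1 a) \<le> 0"
        using mult_nonneg_nonpos[of "(1 - fst p) * m a", OF _ oD[OF 4]] m[OF a] xy by simp
      then show ?thesis
        using 4 unfolding kz by (simp add: charge_simps algebra_simps)
    qed
  next
    \<comment> \<open>One of \<open>snd p\<close> and \<open>1 - snd p\<close> is positive, so
      \<open>A\<close> or \<open>B\<close> carries charge.\<close>
    show "(if snd p > 0 then a0 else b0) \<in> angles"
      using ab by (auto simp: angles_def)
    show "charge p (if snd p > 0 then a0 else b0) *
        (aff k z (if snd p > 0 then a0 else b0) * aff l w (if snd p > 0 then a0 else b0)) > 0"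
      using oA[OF ab(1)] oB[OF ab(2)] m[of a0] m[of b0] ab xy unfolding kz
      by (auto simp: charge_simps angles_def)
  qed
qed

end

section \<open>Critical points\<close>

lemma unit_circle_cis:
  assumes "a \<in> unit_circle"
  obtains t where "a = cis t"
proof
  show "a = cis (Arg a)"
    using assms cis_Arg[of a] by (cases "a = 0") (auto simp: sgn_eq)
qed

text \<open>Seen from \<open>a\<close>, \<open>b\<close> precedes \<open>c\<close> and
  \<open>c\<close> precedes \<open>d\<close>. The identity between the sines of the half arcs is
  Ptolemy's theorem for the quadrilateral.\<close>

lemma ori_trans:
  assumes circ: "a \<in> unit_circle" "b \<in> unit_circle" "c \<in> unit_circle" "d \<in> unit_circle"
    and pos: "ori a b c > 0" "ori a c d > 0"
  shows "ori a b d > 0"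
proof -
  obtain r s t w where cis: "a = cis r" "b = cis s" "c = cis t" "d = cis w"
    using unit_circle_cis circ by metis
  define p q v where "p = (s - r) / 2" and "q = (t - r) / 2" and "v = (w - r) / 2"
  have o: "ori a b c = 4 * sin p * sin (q - p) * sin q" "ori a c d = 4 * sin q * sin (v - q) * sin v"
    "ori a b d = 4 * sin p * sin (v - p) * sin v"
    unfolding cis ori_cis by (simp_all add: p_def q_def v_def field_simps)
  have "sin q * sin (v - p) = sin v * sin (q - p) + sin p * sin (v - q)"
    unfolding sin_diff by (simp add: algebra_simps)
  then have "4 * sin p * sin v * sin q * (sin q * sin (v - p)) =
    4 * sin p * sin v * sin q * (sin v * sin (q - p) + sin p * sin (v - q))"
    by simp
  then have "(sin q)\<^sup>2 * ori a b d = (sin v)\<^sup>2 * ori a b c + (sin p)\<^sup>2 * ori a c d"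
    unfolding o power2_eq_square by (simp add: algebra_simps)
  also have "\<dots> > 0"
  proof -
    have "sin p \<noteq> 0"
      using pos(1) unfolding o(1) by auto
    then show ?thesis
      using pos by (simp add: add_nonneg_pos)
  qed
  finally show ?thesis
    using zero_less_mult_pos2 zero_le_power2[of "sin q"] by (metis mult_nonneg_nonpos not_le)
qed

text \<open>With \<open>1 / (u - a) = cnj (u - a) / |u - a|^2\<close> a zero means
  \<open>z = s * u\<close> for the two sums \<open>s\<close>, \<open>z\<close> of
  \<open>balanced\<close>. Expanding the total charge 0 gives a second relation, and together they
  yield \<open>(1 - |u|^2) * s = 0\<close>.\<close>

lemma balanced_critical_off_circle:
  assumes E: "E \<subseteq> unit_circle" "sum r E = 0" and u: "cmod u \<noteq> 1"
  shows "(\<Sum>a\<in>E. of_real (r a) / (u - a)) = 0 \<longleftrightarrow> balanced E r u"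
proof -
  define s where "s = (\<Sum>a\<in>E. r a / (cmod (u - a))\<^sup>2)"
  define z where "z = (\<Sum>a\<in>E. of_real (r a / (cmod (u - a))\<^sup>2) * a)"
  have ne: "u \<noteq> a" if "a \<in> E" for a
    using E u that by auto
  have w: "of_real (r a) / (u - a) = cnj (of_real (r a / (cmod (u - a))\<^sup>2) * (u - a))" if "a \<in> E" for a
  proof -
    have "cnj (of_real (r a / (cmod (u - a))\<^sup>2) * (u - a)) = of_real (r a) / ((u - a) * cnj (u - a)) * cnj (u - a)"
      unfolding of_real_divide complex_norm_square by simp
    then show ?thesis
      using ne[OF that] by simp
  qed
  have F: "(\<Sum>a\<in>E. of_real (r a) / (u - a)) = cnj (of_real s * u - z)"
    unfolding s_def z_def of_real_sum sum_distrib_right sum_subtractf[symmetric] cnj_sum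
    by (intro sum.cong refl, subst w) (auto simp: algebra_simps diff_divide_distrib)
  have "0 = (\<Sum>a\<in>E. of_real (r a / (cmod (u - a))\<^sup>2) * complex_of_real ((cmod (u - a))\<^sup>2))"
  proof -
    have "of_real (r a / (cmod (u - a))\<^sup>2) * complex_of_real ((cmod (u - a))\<^sup>2) = of_real (r a)" if "a \<in> E" for a
      using ne[OF that] by simp
    then show ?thesis
      using E(2) by (simp flip: of_real_sum)
  qed
  also have "\<dots> = (\<Sum>a\<in>E. (1 + u * cnj u) * of_real (r a / (cmod (u - a))\<^sup>2)
      - cnj u * (of_real (r a / (cmod (u - a))\<^sup>2) * a) - u * cnj (of_real (r a / (cmod (u - a))\<^sup>2) * a))"
    by (intro sum.cong refl, subst cmod_diff_circle(1)) (use E in \<open>auto simp: algebra_simps simp del: of_real_divide\<close>)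
  also have "\<dots> = (1 + u * cnj u) * of_real s - cnj u * z - u * cnj z"
    unfolding s_def z_def of_real_sum sum_distrib_left cnj_sum sum_subtractf ..
  finally have S: "(1 + u * cnj u) * of_real s = cnj u * z + u * cnj z"
    by (simp add: algebra_simps)
  have u1: "1 - u * cnj u \<noteq> 0"
  proof
    assume "1 - u * cnj u = 0"
    then have "complex_of_real ((cmod u)\<^sup>2) = of_real 1"
      unfolding complex_norm_square by simp
    then have "(cmod u)\<^sup>2 = 1"
      unfolding of_real_eq_iff .
    then show False
      using u norm_ge_zero[of u] by (simp add: power2_eq_1_iff)
  qed
  have "s = 0" if "z = of_real s * u"
    using S u1 unfolding that by (simp add: algebra_simps)
  moreover have "cnj (of_real s * u - z) = 0 \<longleftrightarrow> z = of_real s * u"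
    unfolding complex_cnj_zero_iff by auto
  ultimately show ?thesis
    unfolding F balanced_def s_def[symmetric] z_def[symmetric] by auto
qed

text \<open>On the circle \<open>1 / (u - a)^2 = - cnj (u * a) / |u - a|^2\<close>, so the second
  order sum is the first moment \<open>z\<close> up to conjugation and a unit. Here the derivative
  replaces the relation from the total charge, which degenerates at modulus 1.\<close>

lemma balanced_critical_on_circle:
  assumes E: "E \<subseteq> unit_circle" and u: "u \<in> unit_circle" "u \<notin> E"
  shows "(\<Sum>a\<in>E. of_real (r a) / (u - a)) = 0 \<and> (\<Sum>a\<in>E. of_real (r a) / (u - a)\<^sup>2) = 0
    \<longleftrightarrow> balanced E r u"
proof -
  define s where "s = (\<Sum>a\<in>E. r a / (cmod (u - a))\<^sup>2)"
  define z where "z = (\<Sum>a\<in>E. of_real (r a / (cmod (u - a))\<^sup>2) * a)"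
  have ne: "u \<noteq> a" if "a \<in> E" for a
    using u that by auto
  have w: "of_real (r a) / (u - a) = cnj (of_real (r a / (cmod (u - a))\<^sup>2) * (u - a))"
    "of_real (r a) / (u - a)\<^sup>2 = - cnj (u * (of_real (r a / (cmod (u - a))\<^sup>2) * a))" if "a \<in> E" for a
  proof -
    have *: "complex_of_real ((cmod (u - a))\<^sup>2) = (u - a) * cnj (u - a)"
      by (rule complex_norm_square)
    then show 1: "of_real (r a) / (u - a) = cnj (of_real (r a / (cmod (u - a))\<^sup>2) * (u - a))"
      unfolding of_real_divide using ne[OF that] by simp
    have n: "u * cnj u = 1" "a * cnj a = 1"
      using u E that by (auto simp: complex_norm_square[symmetric])
    have "(u - a) * cnj (u * a) = - cnj (u - a)"
      using n by (simp add: algebra_simps)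
    then have k: "cnj (u * a) = - cnj (u - a) / (u - a)"
      using ne[OF that] by (simp add: field_simps)
    have "cnj (u - a) \<noteq> 0"
      using ne[OF that] by simp
    then have "of_real (r a) / (u - a)\<^sup>2 = - (of_real (r a) / ((u - a) * cnj (u - a)) * cnj (u * a))"
      unfolding k using ne[OF that] by (simp add: power2_eq_square del: complex_cnj_diff)
    then show "of_real (r a) / (u - a)\<^sup>2 = - cnj (u * (of_real (r a / (cmod (u - a))\<^sup>2) * a))"
      unfolding of_real_divide * by (simp add: mult_ac)
  qed
  have F: "(\<Sum>a\<in>E. of_real (r a) / (u - a)) = cnj (of_real s * u - z)"
    unfolding s_def z_def of_real_sum sum_distrib_right sum_subtractf[symmetric] cnj_sum
    by (intro sum.cong refl, subst w(1)) (auto simp: algebra_simps diff_divide_distrib)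
  have G: "(\<Sum>a\<in>E. of_real (r a) / (u - a)\<^sup>2) = - cnj (u * z)"
    unfolding z_def sum_distrib_left cnj_sum sum_negf[symmetric]
    by (intro sum.cong refl w(2))
  have "u \<noteq> 0"
    using u by auto
  then show ?thesis
    unfolding F G balanced_def s_def[symmetric] z_def[symmetric] by auto
qed

context circular_weights begin

lemma point_in_square: "point u \<in> unit_square"
  and fst_point: "fst (point u) = 0 \<longleftrightarrow> u \<in> C" "fst (point u) = 1 \<longleftrightarrow> u \<in> D"
  and snd_point: "snd (point u) = 0 \<longleftrightarrow> u \<in> A" "snd (point u) = 1 \<longleftrightarrow> u \<in> B"
proof -
  interpret R: circular_weights C D B A m
    by (rule rotated)
  show "point u \<in> unit_square" "fst (point u) = 0 \<longleftrightarrow> u \<in> C" "fst (point u) = 1 \<longleftrightarrow> u \<in> D"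
    "snd (point u) = 0 \<longleftrightarrow> u \<in> A" "snd (point u) = 1 \<longleftrightarrow> u \<in> B"
    using coord_range R.coord_range by (simp_all add: point_def unit_square_def)
qed

lemma continuous_on_point: "continuous_on U point"
proof -
  interpret R: circular_weights C D B A m
    by (rule rotated)
  show ?thesis
    unfolding point_def[abs_def]
    by (intro continuous_on_Pair continuous_on_coord R.continuous_on_coord)
qed

lemma coord_swap: "coord m B A D C u = 1 - coord m A B C D u"
proof -
  have *: "family_det m D A C u = family_det m A C D u" "family_det m B D C u = family_det m C B D u"
    by (simp_all add: family_det_rotate[symmetric])
  show ?thesis
    unfolding coord_def * using coord_denom_pos[of u] by (simp add: field_simps)
qed

text \<open>Without charge on \<open>A\<close>, the positive charges are on \<open>B\<close> and the
  others on \<open>C\<close> and \<open>D\<close>; the chord from the last point of \<open>C\<close>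
  to the first of \<open>D\<close> separates them.\<close>

lemma separating_line:
  assumes "0 \<le> fst p" "fst p \<le> 1" "snd p = 0"
  obtains k z b where "\<And>a. a \<in> angles \<Longrightarrow> charge p a * aff k z a \<ge> 0"
    "b \<in> B" "charge p b * aff k z b > 0"
proof -
  obtain c2 d1 where cd: "c2 \<in> C" "d1 \<in> D"
    and o: "\<And>c. c \<in> C \<Longrightarrow> ori c2 d1 c \<ge> 0" "\<And>d. d \<in> D \<Longrightarrow> ori c2 d1 d \<ge> 0"
    using arc_extremes by metis
  have o': "ori d1 c2 a = - ori c2 d1 a" for a
    by (simp add: ori_def algebra_simps)
  obtain k z where kz: "\<And>a. ori d1 c2 a = aff k z a"
    using ori_aff by metis
  obtain a0 b0 where ab: "a0 \<in> A" "b0 \<in> B"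
    using ne by blast
  have oB: "ori d1 c2 b > 0" if "b \<in> B" for b
    using ori_pos(4)[OF ab(1) that cd] by (simp add: o' ori_swap[of c2 b])
  show ?thesis
  proof (rule that[of k z b0])
    fix a assume "a \<in> angles"
    then consider "a \<in> A" | "a \<in> B" | "a \<in> C" | "a \<in> D"
      by (auto simp: angles_def)
    then show "charge p a * aff k z a \<ge> 0"
    proof cases
      case 1
      then show ?thesis
        using assms by (simp add: charge_simps)
    next
      case 2
      then show ?thesis
        using oB[OF 2] pos[of a] assms unfolding kz by (simp add: charge_simps)
    next
      case 3
      then show ?thesis
        using o(1)[OF 3] o'[of a] pos[of a] assms unfolding kz[symmetric] by (simp add: charge_simps)
    next
      case 4
      have "(1 - fst p) * m a * ori c2 d1 a \<ge> 0"
        using o(2)[OF 4] pos[of a] 4 assms by simp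
      then show ?thesis
        using o'[of a] 4 unfolding kz[symmetric] by (simp add: charge_simps algebra_simps)
    qed
  next
    show "b0 \<in> B" "charge p b0 * aff k z b0 > 0"
      using oB[OF ab(2)] pos[of b0] ab assms unfolding kz by (simp_all add: charge_simps)
  qed
qed

text \<open>\<open>point u\<close> is here only a limit of solutions, since the system is singular.
  Of Cramer's rule there remains that the moment vector of \<open>B\<close>, \<open>C\<close>,
  \<open>D\<close>, taken with the charges of \<open>point u\<close>, is a multiple of
  \<open>(1, u)\<close>. This is the vanishing of the form, from which \<open>A\<close> has
  disappeared.\<close>

lemma critical_at_angle:
  assumes u: "u \<in> A"
  shows "(\<Sum>a\<in>angles. of_real (charge (point u) a) / (u - a)) = 0"
proof -
  have u': "u \<notin> B" "u \<notin> C" "u \<notin> D" "u \<in> unit_circle"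
    using u disjoint circ by auto
  define x where "x = fst (point u)"
  have p: "point u = (x, 0)"
    using u by (simp add: x_def prod_eq_iff snd_point)
  define b c d b' c' d' where s: "b = moment0 m B u" "c = moment0 m C u" "d = moment0 m D u"
    "b' = moment1 m B u" "c' = moment1 m C u" "d' = moment1 m D u"
  define w where "w = family_weight m A u u"
  have w: "w > 0"
    unfolding w_def family_weight_def using pos u fin by (intro mult_pos_pos prod_pos) auto
  have wA: "family_weight m A u a = (if a = u then w else 0)" if "a \<in> A" for a
    using that u fin by (auto simp: w_def family_weight_def)
  have sA: "(\<Sum>a\<in>A. family_weight m A u a) = w" "(\<Sum>a\<in>A. of_real (family_weight m A u a) * a) = of_real w * u"
    using u fin by (simp_all add: wA if_distrib[of of_real] if_distrib[of "\<lambda>z. z * _"] cong: if_cong)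
  have sS: "(\<Sum>a\<in>S. family_weight m S u a) = family_prod S u * moment0 m S u"
    "(\<Sum>a\<in>S. of_real (family_weight m S u a) * a) = of_real (family_prod S u) * moment1 m S u"
    if "finite S" "u \<notin> S" for S
    using that by (simp_all add: moment0_def moment1_def sum_distrib_left family_weight_normalized mult_ac)
  note sB = sS[OF fin(2) u'(1), folded s] and sC = sS[OF fin(3) u'(2), folded s] and sD = sS[OF fin(4) u'(3), folded s]
  define P where "P = w * family_prod B u * family_prod C u * family_prod D u"
  have dets: "family_prod C u * family_det m A B D u = P * det3 1 u b b' d d'"
    "family_prod D u * family_det m A C B u = P * det3 1 u c c' b b'"
    unfolding family_det_def sA sB sC sD P_def by (simp_all add: det3_def algebra_simps)
  have P: "P > 0"
    unfolding P_def using w u' fin by (intro mult_pos_pos family_prod_pos)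
  have "det3 1 u b b' d d' > 0" "det3 1 u c c' b b' > 0"
    using mult_pos_pos[OF family_prod_pos[OF fin(3) u'(2)] det_pos(3)[of u], unfolded dets]
      mult_pos_pos[OF family_prod_pos[OF fin(4) u'(3)] det_pos(4)[of u], unfolded dets]
      zero_less_mult_pos[OF _ P] by blast+
  moreover have "x = det3 1 u b b' d d' / (det3 1 u b b' d d' + det3 1 u c c' b b')"
    unfolding x_def point_def coord_def fst_conv
    using dets P family_det_rotate[of m B D A] family_det_rotate[of m C B A]
    by (simp flip: distrib_left)
  ultimately have "x * det3 1 u c c' b b' = (1 - x) * det3 1 u b b' d d'"
    by (simp add: field_simps)
  \<comment> \<open>The defect of balance of \<open>B\<close>, \<open>C\<close>, \<open>D\<close>.
    By \<open>det0\<close> it depends linearly on \<open>(1, u)\<close> and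
    \<open>(b, b')\<close>.\<close>
  define v v' where "v = b - x * c - (1 - x) * d" and "v' = b' - x *\<^sub>R c' - (1 - x) *\<^sub>R d'"
  have det0: "det3 1 u v v' b b' = 0"
    using \<open>x * _ = _\<close> by (simp add: v_def v'_def det3_def algebra_simps)
  \<comment> \<open>This functional is 1 on \<open>(b, b')\<close> but 0 on \<open>(1, u)\<close>
    and on \<open>(v, v')\<close>, so \<open>(v, v')\<close> has no part along
    \<open>(b, b')\<close>.\<close>
  have ell: "2 * b - 2 * Re (cnj u * b') = 1" "2 * c - 2 * Re (cnj u * c') = 1" "2 * d - 2 * Re (cnj u * d') = 1"
    using moment_relation[OF circ(2) u'(1) mass(2)] moment_relation[OF circ(3) u'(2) mass(3)]
      moment_relation[OF circ(4) u'(3) mass(4)] u'(4) by (simp_all add: s)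
  have "Re (cnj u * v') = Re (cnj u * b') - x * Re (cnj u * c') - (1 - x) * Re (cnj u * d')"
    by (simp add: v'_def algebra_simps)
  moreover have "Re (cnj u * b') = b - 1 / 2" "Re (cnj u * c') = c - 1 / 2" "Re (cnj u * d') = d - 1 / 2"
    using ell by linarith+
  ultimately have vv: "Re (cnj u * v') = v"
    unfolding v_def by (simp only:) (simp add: algebra_simps)
  have n: "u * cnj u = 1"
    using u'(4) by (simp add: complex_norm_square[symmetric])
  define y where "y = Im (cnj u * v')"
  define q where "q = cnj u * b'"
  have "u * (cnj u * v') = v'" "u * (cnj u * b') = b'"
    using n by (simp_all flip: mult.assoc)
  then have v': "v' = u * Complex v y" and b': "b' = u * q"
    using vv by (simp_all add: y_def q_def complex_eq_iff)
  have q: "cnj u * b' = q" "cnj u * v' = Complex v y"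
    using vv by (simp_all add: q_def y_def complex_eq_iff)
  have "cnj v' * b' = (u * cnj u) * (cnj (Complex v y) * q)"
    unfolding v' b' by (simp only: complex_cnj_mult mult_ac)
  then have "det3 1 u v v' b b' = y * (b - Re q)"
    unfolding det3_def q n by (simp add: algebra_simps)
  moreover have "b - Re q = 1 / 2"
    using ell(1) unfolding q by simp
  ultimately have "y = 0"
    using det0 by simp
  then have v'': "v' = of_real v * u"
    unfolding v' by (simp add: complex_eq_iff)
  have "(\<Sum>a\<in>angles. of_real (charge (point u) a) / (u - a)) =
      (\<Sum>a\<in>angles. charge (x, 0) a *\<^sub>R ((1 / (cmod (u - a))\<^sup>2) *\<^sub>R cnj (u - a)))"
  proof (intro sum.cong refl)
    fix a assume "a \<in> angles"
    have "1 / (u - a) = (1 / (cmod (u - a))\<^sup>2) *\<^sub>R cnj (u - a)"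
      unfolding scaleR_conv_of_real of_real_divide complex_norm_square
      by (cases "u = a") (simp_all del: complex_cnj_diff add: complex_cnj_diff[symmetric])
    then show "of_real (charge (point u) a) / (u - a) = charge (x, 0) a *\<^sub>R ((1 / (cmod (u - a))\<^sup>2) *\<^sub>R cnj (u - a))"
      unfolding p by (metis scaleR_conv_of_real times_divide_eq_right mult.right_neutral)
  qed
  also have "\<dots> = (\<Sum>a\<in>B. m a *\<^sub>R (1 / (cmod (u - a))\<^sup>2) *\<^sub>R cnj (u - a))
      - x *\<^sub>R (\<Sum>a\<in>C. m a *\<^sub>R (1 / (cmod (u - a))\<^sup>2) *\<^sub>R cnj (u - a))
      - (1 - x) *\<^sub>R (\<Sum>a\<in>D. m a *\<^sub>R (1 / (cmod (u - a))\<^sup>2) *\<^sub>R cnj (u - a))"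
    unfolding sum_charge by simp
  also have "\<dots> = cnj (of_real b * u - b') - x *\<^sub>R cnj (of_real c * u - c')
      - (1 - x) *\<^sub>R cnj (of_real d * u - d')"
  proof -
    have "(\<Sum>a\<in>S. m a *\<^sub>R (1 / (cmod (u - a))\<^sup>2) *\<^sub>R cnj (u - a)) =
        cnj (of_real (moment0 m S u) * u - moment1 m S u)" for S
      unfolding moment0_def moment1_def of_real_sum sum_distrib_right sum_subtractf[symmetric] cnj_sum
      by (intro sum.cong refl) (simp add: scaleR_conv_of_real algebra_simps diff_divide_distrib)
    then show ?thesis
      by (simp only: s)
  qed
  also have "\<dots> = cnj (of_real v * u - v')"
    by (simp add: v_def v'_def scaleR_conv_of_real algebra_simps)
  also have "\<dots> = 0"
    by (simp add: v'')
  finally show ?thesis .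
qed

text \<open>Reflection in the circle divides all \<open>|u - a|^2\<close> by the same number
  \<open>|u|^2\<close>, which does not affect balance.\<close>

lemma point_reflect:
  assumes "u \<noteq> 0" "cmod u \<noteq> 1"
  shows "point (1 / cnj u) = point u"
proof -
  have "cmod (1 / cnj u) \<noteq> 1"
    using assms by (simp add: norm_divide)
  then have nin: "1 / cnj u \<notin> angles" "u \<notin> angles"
    using angles_circle assms by auto
  have d: "(cmod (1 / cnj u - a))\<^sup>2 = (cmod (u - a))\<^sup>2 / (cmod u)\<^sup>2" if "a \<in> angles" for a
  proof -
    have a: "cmod a = 1" "a * cnj a = 1"
      using that angles_circle by (auto simp: complex_norm_square[symmetric])
    have "1 / cnj u - a = - a * cnj (u - a) / cnj u"
      using a assms by (simp add: field_simps)
    then have "cmod (1 / cnj u - a) = cmod (u - a) / cmod u"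
      using a by (simp add: norm_mult norm_divide del: complex_cnj_diff)
    then show ?thesis
      by (simp add: power_divide)
  qed
  let ?w = "\<lambda>a. charge (point u) a / (cmod (u - a))\<^sup>2"
  have "balanced angles (charge (point u)) u"
    using balanced_iff[OF nin(2)] by simp
  then have b: "(\<Sum>a\<in>angles. ?w a) = 0" "(\<Sum>a\<in>angles. of_real (?w a) * a) = 0"
    by (simp_all only: balanced_def)
  have w: "charge (point u) a / (cmod (1 / cnj u - a))\<^sup>2 = (cmod u)\<^sup>2 * ?w a" if "a \<in> angles" for a
    unfolding d[OF that] by simp
  have "balanced angles (charge (point u)) (1 / cnj u)"
    unfolding balanced_def
  proof
    have "(\<Sum>a\<in>angles. charge (point u) a / (cmod (1 / cnj u - a))\<^sup>2) = (\<Sum>a\<in>angles. (cmod u)\<^sup>2 * ?w a)"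
      by (intro sum.cong refl w)
    then show "(\<Sum>a\<in>angles. charge (point u) a / (cmod (1 / cnj u - a))\<^sup>2) = 0"
      unfolding sum_distrib_left[symmetric] b(1) by simp
    have "(\<Sum>a\<in>angles. of_real (charge (point u) a / (cmod (1 / cnj u - a))\<^sup>2) * a) =
        (\<Sum>a\<in>angles. of_real ((cmod u)\<^sup>2) * (of_real (?w a) * a))"
      by (intro sum.cong refl, subst w) (simp_all add: mult.assoc)
    then show "(\<Sum>a\<in>angles. of_real (charge (point u) a / (cmod (1 / cnj u - a))\<^sup>2) * a) = 0"
      using b(2) unfolding sum_distrib_left[symmetric] by simp
  qed
  then show ?thesis
    using balanced_iff[OF nin(1)] by simp
qed

text \<open>All angles have distance 1 from 0, so balance at 0 is the vanishing of the first moment.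
  This moment is also the leading coefficient of the form at infinity.\<close>

lemma balanced_0:
  assumes "(\<Sum>a\<in>angles. of_real (charge p a) * a) = 0"
  shows "p = point 0"
proof -
  have nin: "0 \<notin> angles"
    using angles_circle by auto
  have 1: "charge p a / (cmod (0 - a))\<^sup>2 = charge p a" if "a \<in> angles" for a
    using angles_circle that by auto
  have "(\<Sum>a\<in>angles. charge p a / (cmod (0 - a))\<^sup>2) = (\<Sum>a\<in>angles. charge p a)"
    by (intro sum.cong refl 1)
  moreover have "(\<Sum>a\<in>angles. of_real (charge p a / (cmod (0 - a))\<^sup>2) * a) = (\<Sum>a\<in>angles. of_real (charge p a) * a)"
    by (intro sum.cong refl) (simp only: 1)
  ultimately have "balanced angles (charge p) 0"
    unfolding balanced_def using assms sum_charge_1[of p] by simp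
  then show ?thesis
    using balanced_iff[OF nin] by simp
qed

lemma critical_off_circle:
  assumes "cmod u \<noteq> 1"
  shows "(\<Sum>a\<in>angles. of_real (charge p a) / (u - a)) = 0 \<longleftrightarrow> p = point u"
proof -
  have "u \<notin> angles"
    using angles_circle assms by auto
  then show ?thesis
    unfolding balanced_critical_off_circle[OF angles_circle sum_charge_1 assms] by (rule balanced_iff)
qed

lemma double_critical_on_circle:
  assumes "u \<in> unit_circle" "u \<notin> angles"
  shows "(\<Sum>a\<in>angles. of_real (charge p a) / (u - a)) = 0 \<and>
    (\<Sum>a\<in>angles. of_real (charge p a) / (u - a)\<^sup>2) = 0 \<longleftrightarrow> p = point u"
  unfolding balanced_critical_on_circle[OF angles_circle assms] balanced_iff[OF assms(2)] ..

text \<open>A zero off the circle already forces \<open>p = point u\<close>, hence \<open>p\<close>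
  in the unit square; only then are the signs of the charges known.\<close>

lemma no_double_critical_off_circle:
  assumes "cmod u \<noteq> 1" "(\<Sum>a\<in>angles. of_real (charge p a) / (u - a)) = 0"
    "(\<Sum>a\<in>angles. of_real (charge p a) / (u - a)\<^sup>2) = 0"
  shows False
proof -
  have p: "p = point u" and u: "u \<notin> angles"
    using critical_off_circle assms angles_circle by auto
  obtain k z l w b where *: "\<And>a. a \<in> angles \<Longrightarrow> charge p a * (aff k z a * aff l w a) \<ge> 0"
    "b \<in> angles" "charge p b * (aff k z b * aff l w b) > 0"
    using two_separating_lines[of p] point_in_square[of u] p by metis
  have "balanced angles (charge p) u"
    using balanced_iff[OF u] p by simp
  from balanced_double[OF finite_angles angles_circle this u assms(1,3) *] show False .
qed

section \<open>The reduced form at \<open>y = 0\<close>, without the family \<open>A\<close>\<close>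

lemma reduced_sum:
  assumes "snd p = 0"
  shows "(\<Sum>a\<in>angles. of_real (charge p a) * g a) = (\<Sum>a\<in>angles - A. of_real (charge p a) * (g a :: complex))"
  using assms finite_angles by (intro sum.mono_neutral_right) (auto simp: charge_simps)

lemma reduced_not_balanced:
  assumes "0 \<le> fst p" "fst p \<le> 1" "snd p = 0" "s \<notin> angles - A"
  shows "\<not> balanced (angles - A) (charge p) s"
proof
  assume bal: "balanced (angles - A) (charge p) s"
  obtain k z b where *: "\<And>a. a \<in> angles \<Longrightarrow> charge p a * aff k z a \<ge> 0" "b \<in> B" "charge p b * aff k z b > 0"
    by (rule separating_line[OF assms(1-3)]) (rule that)
  have "b \<in> angles - A"
    using *(2) disjoint by (auto simp: angles_def)
  with assms(4) show False
    by (intro balanced_one_line[OF _ bal, of k z b]) (use finite_angles * in auto)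
qed

text \<open>The reduced charges are never balanced, by \<open>separating_line\<close>; off the
  circle a simple zero would balance them, on the circle a double one.\<close>

lemma reduced_no_double_zero:
  assumes p: "0 \<le> fst p" "fst p \<le> 1" "snd p = 0" and s: "s \<notin> angles - A"
    and "(\<Sum>a\<in>angles - A. of_real (charge p a) / (s - a)) = 0"
    and "(\<Sum>a\<in>angles - A. of_real (charge p a) / (s - a)\<^sup>2) = 0"
  shows False
proof -
  have sum: "sum (charge p) (angles - A) = 0"
  proof -
    have "sum (charge p) angles = sum (charge p) (angles - A)"
      using p(3) finite_angles by (intro sum.mono_neutral_right) (auto simp: charge_simps)
    then show ?thesis
      using sum_charge_1 by simp
  qed
  have circle: "angles - A \<subseteq> unit_circle"
    using angles_circle by auto
  show False
  proof (cases "cmod s = 1")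
    case True
    then show False
      using balanced_critical_on_circle[OF circle _ s, of "charge p"] assms(5,6) reduced_not_balanced[OF p s]
      by simp
  next
    case False
    then show False
      using balanced_critical_off_circle[OF circle sum False] assms(5) reduced_not_balanced[OF p s]
      by simp
  qed
qed

text \<open>There is no zero at infinity: it would also be one at 0, and
  \<open>snd (point 0)\<close> is positive because 0 is not an angle.\<close>

lemma reduced_moment:
  assumes "0 \<le> fst p" "fst p \<le> 1" "snd p = 0"
  shows "(\<Sum>a\<in>angles. of_real (charge p a) * a) \<noteq> 0"
proof
  assume "(\<Sum>a\<in>angles. of_real (charge p a) * a) = 0"
  then have "p = point 0"
    by (rule balanced_0)
  then have "0 \<in> A"
    using snd_point(1)[of 0] assms by simp
  then show False
    using circ by auto
qed

lemma on_circle: "a \<in> A \<Longrightarrow> cmod a = 1" "a \<in> B \<Longrightarrow> cmod a = 1" "a \<in> C \<Longrightarrow> cmod a = 1"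
  "a \<in> D \<Longrightarrow> cmod a = 1" "a \<in> angles \<Longrightarrow> cmod a = 1"
  using circ angles_circle by auto

text \<open>\<open>A\<close> lies on an arc free of the other families, so a chord with both ends in
  \<open>A\<close> has them all on one side. Which side is open, as no order is imposed inside a
  family.\<close>

lemma same_side:
  assumes "s \<in> A" "t \<in> A"
  shows "(\<forall>a\<in>angles - A. ori t s a > 0) \<or> (\<forall>a\<in>angles - A. ori s t a > 0) \<or> s = t"
proof -
  have *: "\<forall>a\<in>angles - A. ori t s a > 0" if st: "s \<in> A" "t \<in> A" and c: "c \<in> C" "ori t s c > 0" for s t c
  proof -
    have B: "ori t s b > 0" if "b \<in> B" for b
    proof -
      obtain d where "d \<in> D" using ne by blast
      then show ?thesis
        using ori_trans[of t s c b] st c that ori_pos(1)[OF st(2) that c(1)] on_circle by auto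
    qed
    have D: "ori t s d > 0" if "d \<in> D" for d
    proof -
      obtain b where "b \<in> B" using ne by blast
      then show ?thesis
        using ori_trans[of t s c d] st c that ori_pos(2)[OF st(2) _ c(1) that] on_circle by auto
    qed
    have C: "ori t s c' > 0" if c': "c' \<in> C" for c'
    proof -
      obtain b d where bd: "b \<in> B" "d \<in> D" using ne by blast
      have "ori t c' d > 0" "ori s c' d > 0"
        using ori_pos(2)[OF st(2) bd(1) c' bd(2)] ori_pos(2)[OF st(1) bd(1) c' bd(2)] by simp_all
      moreover have "ori d t s > 0"
        using D[OF bd(2)] ori_rotate[of t s d] by simp
      moreover have "ori d s c' > 0"
        using \<open>ori s c' d > 0\<close> ori_rotate[of s c' d] by simp
      ultimately have "ori t s c' > 0 \<or> ori d t c' > 0"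
        using ori_trans[of d t s c'] st bd c' on_circle by auto
      moreover have "ori t c' d = ori d t c'"
        using ori_rotate[of t c' d] by simp
      \<comment> \<open>Seen from \<open>s\<close>, \<open>c'\<close> comes before \<open>d\<close>
        and \<open>d\<close> before \<open>t\<close>.\<close>
      have "ori s c' t > 0"
        using ori_trans[of s c' d t] \<open>ori s c' d > 0\<close> \<open>ori d t s > 0\<close> ori_rotate[of s d t] ori_rotate[of d t s]
          st bd c' on_circle by auto
      then show ?thesis
        using ori_rotate[of s c' t] ori_rotate[of t s c'] by simp
    qed
    show ?thesis
      using B C D by (auto simp: angles_def)
  qed
  obtain c b d where c: "c \<in> C" "b \<in> B" "d \<in> D" using ne by blast
  have "ori t s c > 0 \<or> ori s t c > 0 \<or> s = t"
  proof -
    have o: "ori s t c = - ori t s c"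
      by (simp add: ori_def algebra_simps)
    obtain x where x: "t = cis x"
      using unit_circle_cis[of t] on_circle assms by auto
    obtain y where y: "s = cis y"
      using unit_circle_cis[of s] on_circle assms by auto
    obtain z where z: "c = cis z"
      using unit_circle_cis[of c] on_circle c by auto
    note cis = x y z
    have "s = t \<or> t = c \<or> s = c" if "ori t s c = 0"
    proof -
      have "sin ((y - x) / 2) = 0 \<or> sin ((z - y) / 2) = 0 \<or> sin ((z - x) / 2) = 0"
        using that unfolding cis ori_cis by auto
      moreover have *: "cis v = cis w" if s0: "sin ((v - w) / 2) = 0" for v w
      proof -
        obtain k :: int where "(v - w) / 2 = of_int k * pi"
          using s0 unfolding sin_zero_iff_int2 by blast
        then have "v = w + 2 * pi * of_int k"
          by (simp add: field_simps)
        then show ?thesis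
          by (simp flip: cis_mult)
      qed
      ultimately show ?thesis
        unfolding cis using *[of y x] *[of z y] *[of z x] by auto
    qed
    moreover have "t \<noteq> c" "s \<noteq> c"
      using assms c disjoint by auto
    ultimately show ?thesis
      using o by linarith
  qed
  then show ?thesis
    using *[OF assms c(1)] *[OF assms(2,1) c(1)] by blast
qed

text \<open>Two zeros at \<open>s\<close>, \<open>t\<close> make the charges \<open>r a / ori t s a\<close> balanced; the denominator
  has constant sign on the other families.\<close>

lemma reduced_one_zero:
  assumes p: "0 \<le> fst p" "fst p \<le> 1" "snd p = 0"
    and st: "s \<in> A" "t \<in> A" "s \<noteq> t"
    and zero: "(\<Sum>a\<in>angles - A. of_real (charge p a) / (s - a)) = 0"
      "(\<Sum>a\<in>angles - A. of_real (charge p a) / (t - a)) = 0"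
  shows False
proof -
  define E where "E = angles - A"
  have fE: "finite E"
    using finite_angles by (simp add: E_def)
  have ne0: "s \<noteq> 0" "t \<noteq> 0" "a \<noteq> 0" "s \<noteq> a" "t \<noteq> a" "cmod a = 1" if "a \<in> E" for a
    using on_circle(1)[OF st(1)] on_circle(1)[OF st(2)] on_circle(5)[of a] that st by (auto simp: E_def)
  have ori: "complex_of_real (ori t s a) * (2 * \<i>) * (s * t * a) = (t - s) * ((t - a) * (s - a))" if a: "a \<in> E" for a
  proof -
    have "cnj z = 1 / z" if "cmod z = 1" for z
      using that complex_norm_square[of z] by (cases "z = 0") (auto simp: field_simps)
    then have n: "cnj s = 1 / s" "cnj t = 1 / t" "cnj a = 1 / a"
      using st a on_circle by (auto simp: E_def)
    have "complex_of_real (ori t s a) * (2 * \<i>) = cnj (s - t) * (a - t) - (s - t) * cnj (a - t)"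
      unfolding ori_def by (simp add: complex_eq_iff algebra_simps)
    also have "\<dots> = (1 / s - 1 / t) * (a - t) - (s - t) * (1 / a - 1 / t)"
      by (simp add: n)
    also have "\<dots> = (t - s) / (s * t) * (a - t) - (s - t) * ((t - a) / (a * t))"
      using ne0[OF a] by (simp add: diff_frac_eq)
    finally have "complex_of_real (ori t s a) * (2 * \<i>) * (s * t * a) =
        (t - s) / (s * t) * (a - t) * (s * t * a) - (s - t) * ((t - a) / (a * t)) * (s * t * a)"
      by (simp only: left_diff_distrib)
    also have "\<dots> = (t - s) * (a - t) * a - (s - t) * (t - a) * s"
      using ne0[OF a] by simp
    finally show ?thesis
      by (simp add: algebra_simps)
  qed
  \<comment> \<open>The factor in \<open>1 / ori t s a = k * a / ((t - a) * (s - a))\<close>, which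
    is the identity \<open>ori\<close> solved for the reciprocal.\<close>
  define k where "k = 2 * \<i> * (s * t) / (t - s)"
  have sum0: "(\<Sum>a\<in>E. complex_of_real (charge p a)) = 0"
    using reduced_sum[OF p(3), of "\<lambda>_. 1"] sum_charge_1[of p] by (simp add: E_def flip: of_real_sum)
  \<comment> \<open>Partial fractions: both moments of \<open>w\<close> become combinations of the
    two vanishing sums and the total charge 0.\<close>
  have pf: "a / ((t - a) * (s - a)) = (s / (s - a) - t / (t - a)) / (t - s)"
    "a\<^sup>2 / ((t - a) * (s - a)) = 1 + (s\<^sup>2 / (s - a) - t\<^sup>2 / (t - a)) / (t - s)" if "a \<in> E" for a
  proof -
    have nz: "s - a \<noteq> 0" "t - a \<noteq> 0" "t - s \<noteq> 0"
      using ne0[OF that] st(3) by simp_all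
    have "s / (s - a) - t / (t - a) = (t - s) * (a / ((t - a) * (s - a)))"
      unfolding diff_frac_eq[OF nz(1,2)] by (simp add: algebra_simps)
    then show "a / ((t - a) * (s - a)) = (s / (s - a) - t / (t - a)) / (t - s)"
      using nz(3) by simp
    have "s\<^sup>2 / (s - a) - t\<^sup>2 / (t - a) = (t - s) * ((a\<^sup>2 - (t - a) * (s - a)) / ((t - a) * (s - a)))"
      unfolding diff_frac_eq[OF nz(1,2)] by (simp add: algebra_simps power2_eq_square)
    also have "(a\<^sup>2 - (t - a) * (s - a)) / ((t - a) * (s - a)) = a\<^sup>2 / ((t - a) * (s - a)) - 1"
      unfolding diff_divide_distrib using nz by simp
    finally show "a\<^sup>2 / ((t - a) * (s - a)) = 1 + (s\<^sup>2 / (s - a) - t\<^sup>2 / (t - a)) / (t - s)"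
      using nz(3) by simp
  qed
  define w where "w a = charge p a / ori t s a" for a
  have w: "of_real (w a) = k * (of_real (charge p a) * (a / ((t - a) * (s - a))))" if "a \<in> E" for a
  proof -
    have nz: "(t - s) * ((t - a) * (s - a)) \<noteq> 0"
      using ne0[OF that] st(3) by simp
    then have "complex_of_real (ori t s a) \<noteq> 0"
      unfolding ori[OF that, symmetric] by auto
    with nz have "of_real (charge p a) / complex_of_real (ori t s a) =
        2 * \<i> * (s * t) * (of_real (charge p a) * a) / ((t - s) * ((t - a) * (s - a)))"
      unfolding ori[OF that, symmetric] by (subst frac_eq_eq) simp_all
    then show ?thesis
      by (simp add: w_def k_def)
  qed
  have "(\<Sum>a\<in>E. of_real (w a)) = (\<Sum>a\<in>E. k * (s * (of_real (charge p a) / (s - a)) - t * (of_real (charge p a) / (t - a))) / (t - s))"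
    by (intro sum.cong refl) (simp add: w pf(1), simp add: algebra_simps diff_divide_distrib)
  also have "\<dots> = k * (s * (\<Sum>a\<in>E. of_real (charge p a) / (s - a)) - t * (\<Sum>a\<in>E. of_real (charge p a) / (t - a))) / (t - s)"
    unfolding sum_distrib_left sum_subtractf[symmetric] sum_divide_distrib ..
  also have "\<dots> = 0"
    using zero by (simp add: E_def)
  finally have w0: "(\<Sum>a\<in>E. w a) = 0"
    by (simp flip: of_real_sum)
  have "(\<Sum>a\<in>E. of_real (w a) * a) = (\<Sum>a\<in>E. k * (of_real (charge p a) + (s\<^sup>2 * (of_real (charge p a) / (s - a)) - t\<^sup>2 * (of_real (charge p a) / (t - a))) / (t - s)))"
  proof (intro sum.cong refl)
    fix a assume a: "a \<in> E"
    have "of_real (w a) * a = k * (of_real (charge p a) * (a\<^sup>2 / ((t - a) * (s - a))))"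
      by (simp add: w[OF a] power2_eq_square)
    then show "of_real (w a) * a = k * (of_real (charge p a) + (s\<^sup>2 * (of_real (charge p a) / (s - a)) - t\<^sup>2 * (of_real (charge p a) / (t - a))) / (t - s))"
      unfolding pf(2)[OF a] by (simp add: algebra_simps diff_divide_distrib)
  qed
  also have "\<dots> = k * ((\<Sum>a\<in>E. of_real (charge p a)) + (s\<^sup>2 * (\<Sum>a\<in>E. of_real (charge p a) / (s - a)) - t\<^sup>2 * (\<Sum>a\<in>E. of_real (charge p a) / (t - a))) / (t - s))"
    unfolding sum_distrib_left sum_subtractf[symmetric] sum_divide_distrib sum.distrib[symmetric] ..
  also have "\<dots> = 0"
    using zero sum0 by (simp add: E_def)
  finally have w1: "(\<Sum>a\<in>E. of_real (w a) * a) = 0" .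
  obtain l z b where *: "\<And>a. a \<in> angles \<Longrightarrow> charge p a * aff l z a \<ge> 0" "b \<in> B" "charge p b * aff l z b > 0"
    by (rule separating_line[OF p]) (rule that)
  have b: "b \<in> E"
    using *(2) disjoint by (auto simp: E_def angles_def)
  have "(\<forall>a\<in>E. ori t s a > 0) \<or> (\<forall>a\<in>E. - ori t s a > 0)"
    using same_side[OF st(1,2)] st(3) ori_swap[of s t] ori_rotate[of _ t s] ori_rotate[of t _ s]
    unfolding E_def by (auto simp: ori_def algebra_simps)
  then have "\<exists>e :: real. \<forall>a\<in>E. e * ori t s a > 0"
  proof (elim disjE)
    assume "\<forall>a\<in>E. ori t s a > 0"
    then show ?thesis
      by (intro exI[of _ 1]) simp
  next
    assume "\<forall>a\<in>E. - ori t s a > 0"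
    then show ?thesis
      by (intro exI[of _ "- 1"]) simp
  qed
  then obtain e :: real where e: "\<And>a. a \<in> E \<Longrightarrow> e * ori t s a > 0"
    by blast
  have "(\<Sum>a\<in>E. e * (w a * aff l z a)) = 0"
    using sum_aff[OF w0 w1] by (simp flip: sum_distrib_left)
  moreover have nn: "e * (w a * aff l z a) = charge p a * aff l z a * (e * ori t s a) / (ori t s a)\<^sup>2" if "a \<in> E" for a
    using e[OF that] by (auto simp: w_def power2_eq_square)
  have "e * (w a * aff l z a) \<ge> 0" if "a \<in> E" for a
    unfolding nn[OF that] using *(1)[of a] that e[OF that] by (simp add: E_def)
  moreover have "e * (w b * aff l z b) > 0"
    unfolding nn[OF b] using *(3) e[OF b] by (auto intro!: divide_pos_pos mult_pos_pos)
  ultimately show False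
    using sum_pos_contradiction[OF fE _ _ b] by blast
qed

lemma point_inj_A:
  assumes "s \<in> A" "t \<in> A" "point s = point t"
  shows "s = t"
proof (rule ccontr)
  assume "s \<noteq> t"
  have p: "0 \<le> fst (point s)" "fst (point s) \<le> 1" "snd (point s) = 0"
    using point_in_square[of s] snd_point(1)[of s] assms by (auto simp: unit_square_def)
  have "(\<Sum>a\<in>angles - A. of_real (charge (point s) a) / (s - a)) = 0"
    "(\<Sum>a\<in>angles - A. of_real (charge (point s) a) / (t - a)) = 0"
    using critical_at_angle[OF assms(1)] critical_at_angle[OF assms(2)] assms(3)
      reduced_sum[OF p(3), of "\<lambda>a. 1 / (s - a)"] reduced_sum[OF p(3), of "\<lambda>a. 1 / (t - a)"] by simp_all
  with reduced_one_zero[OF p assms(1,2) \<open>s \<noteq> t\<close>] show False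
    by simp
qed

lemma point_rotated: "circular_weights.point C D B A m u = (1 - snd (point u), fst (point u))"
proof -
  interpret R: circular_weights C D B A m
    by (rule rotated)
  show ?thesis
    by (simp add: R.point_def point_def coord_swap)
qed

text \<open>The values 0 and 1 of the coordinates tell the angles of each family apart from all
  other parameters; inside a family \<open>point_inj_A\<close> and its rotations apply, elsewhere
  \<open>balanced_two_lines\<close>.\<close>

lemma point_inj: "inj_on point (cball 0 1)"
proof
  fix u v :: complex
  assume uv: "u \<in> cball 0 1" "v \<in> cball 0 1" "point u = point v"
  interpret R: circular_weights C D B A m
    by (rule rotated)
  interpret R2: circular_weights B A D C m
    by (rule R.rotated)
  interpret R3: circular_weights D C A B m
    by (rule R2.rotated)
  have R: "R.point u = R.point v" "R2.point u = R2.point v" "R3.point u = R3.point v"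
    using uv(3) by (simp_all add: point_rotated R.point_rotated R2.point_rotated)
  show "u = v"
  proof (cases "u \<in> angles")
    case True
    then consider "u \<in> A" | "u \<in> B" | "u \<in> C" | "u \<in> D"
      by (auto simp: angles_def)
    then show ?thesis
    proof cases
      case 1 then show ?thesis using point_inj_A[of u v] snd_point(1)[of u] snd_point(1)[of v] uv(3) by simp
    next
      case 2 then show ?thesis using R2.point_inj_A[of u v] snd_point(2)[of u] snd_point(2)[of v] uv(3) R by simp
    next
      case 3 then show ?thesis using R.point_inj_A[of u v] fst_point(1)[of u] fst_point(1)[of v] uv(3) R by simp
    next
      case 4 then show ?thesis using R3.point_inj_A[of u v] fst_point(2)[of u] fst_point(2)[of v] uv(3) R by simp
    qed
  next
    case u: False
    then have v: "v \<notin> angles"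
      using snd_point[of u] snd_point[of v] fst_point[of u] fst_point[of v] uv(3) by (simp add: angles_def)
    show ?thesis
    proof (rule ccontr)
      assume "u \<noteq> v"
      \<comment> \<open>In the closed disc, a point whose reflection also lies in the disc is on the
        circle and equals its reflection.\<close>
      have "v * cnj u \<noteq> 1"
      proof
        assume 1: "v * cnj u = 1"
        then have "cmod v * cmod u = 1"
          by (metis complex_mod_cnj norm_mult norm_one)
        moreover have "cmod u \<le> 1" "cmod v \<le> 1"
          using uv by auto
        ultimately have "cmod u = 1"
          by (metis dual_order.antisym mult_cancel_right1 mult_left_le norm_ge_zero mult.commute)
        then have "u * cnj u = 1"
          by (simp add: complex_norm_square[symmetric])
        then have "u * (v * cnj u) = v"
          by (simp add: mult_ac)
        with 1 \<open>u \<noteq> v\<close> show False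
          by simp
      qed
      moreover obtain k z l w b where "\<And>a. a \<in> angles \<Longrightarrow> charge (point u) a * (aff k z a * aff l w a) \<ge> 0"
        "b \<in> angles" "charge (point u) b * (aff k z b * aff l w b) > 0"
        by (rule two_separating_lines[OF point_in_square[of u]]) (rule that)
      moreover have "balanced angles (charge (point u)) u" "balanced angles (charge (point u)) v"
        using balanced_iff u v uv(3) by simp_all
      ultimately show False
        using balanced_two_lines[OF finite_angles angles_circle _ u _ v \<open>u \<noteq> v\<close>] by blast
    qed
  qed
qed

end

section \<open>Numerators of partial fractions\<close>

text \<open>The numerator of the sum of \<open>r a / (z - a)\<close> over the common denominator,
  kept unreduced so that its form does not depend on which \<open>r a\<close> vanish.\<close>

definition residue_poly :: "complex set \<Rightarrow> (complex \<Rightarrow> complex) \<Rightarrow> complex poly"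
  where "residue_poly E r = (\<Sum>a\<in>E. Polynomial.smult (r a) (\<Prod>b\<in>E - {a}. [:- b, 1:]))"

lemma poly_residue_poly:
  assumes "finite E" "s \<notin> E"
  shows "poly (residue_poly E r) s = (\<Prod>b\<in>E. s - b) * (\<Sum>a\<in>E. r a / (s - a))"
proof -
  have "r a * (\<Prod>b\<in>E - {a}. s - b) = (\<Prod>b\<in>E. s - b) * (r a / (s - a))" if "a \<in> E" for a
  proof -
    have "(\<Prod>b\<in>E. s - b) = (s - a) * (\<Prod>b\<in>E - {a}. s - b)"
      using assms that by (intro prod.remove)
    moreover have "s - a \<noteq> 0"
      using assms that by auto
    ultimately show ?thesis
      by simp
  qed
  then show ?thesis
    unfolding residue_poly_def by (simp add: poly_sum poly_prod sum_distrib_left)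
qed

lemma poly_residue_poly_pole:
  assumes "finite E" "s \<in> E"
  shows "poly (residue_poly E r) s = r s * (\<Prod>b\<in>E - {s}. s - b)"
proof -
  have "poly (residue_poly E r) s = (\<Sum>a\<in>E. r a * (\<Prod>b\<in>E - {a}. s - b))"
    unfolding residue_poly_def by (simp add: poly_sum poly_prod)
  also have "\<dots> = (\<Sum>a\<in>{s}. r a * (\<Prod>b\<in>E - {a}. s - b))"
    using assms by (intro sum.mono_neutral_right) (auto simp: prod_zero_iff)
  finally show ?thesis
    by simp
qed

lemma poly_pderiv_residue_poly:
  assumes E: "finite E" "s \<notin> E" and 0: "(\<Sum>a\<in>E. r a / (s - a)) = 0"
  shows "poly (pderiv (residue_poly E r)) s = - (\<Prod>b\<in>E. s - b) * (\<Sum>a\<in>E. r a / (s - a)\<^sup>2)"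
proof -
  define p where "p = (\<Prod>b\<in>E. [:- b, 1:])"
  define F where "F z = (\<Sum>a\<in>E. r a / (z - a))" for z
  have p: "poly p z = (\<Prod>b\<in>E. z - b)" for z
    by (simp add: p_def poly_prod)
  have "(F has_field_derivative (\<Sum>a\<in>E. - (r a / (s - a)\<^sup>2))) (at s)"
    unfolding F_def
  proof (rule DERIV_sum)
    fix a assume "a \<in> E"
    then have "s \<noteq> a"
      using E by auto
    then show "((\<lambda>z. r a / (z - a)) has_field_derivative - (r a / (s - a)\<^sup>2)) (at s)"
      by (auto intro!: derivative_eq_intros simp: power2_eq_square)
  qed
  then have "((\<lambda>z. poly p z * F z) has_field_derivative
      (poly (pderiv p) s * F s + (\<Sum>a\<in>E. - (r a / (s - a)\<^sup>2)) * poly p s)) (at s)"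
    by (intro DERIV_mult poly_DERIV)
  moreover have "\<forall>\<^sub>F z in nhds s. z \<in> - E"
    using E by (intro eventually_nhds_in_open) (auto intro: finite_imp_closed)
  then have "\<forall>\<^sub>F z in nhds s. poly p z * F z = poly (residue_poly E r) z"
    by eventually_elim (use E in \<open>simp add: poly_residue_poly p F_def\<close>)
  ultimately have "((\<lambda>z. poly (residue_poly E r) z) has_field_derivative
      (poly (pderiv p) s * F s + (\<Sum>a\<in>E. - (r a / (s - a)\<^sup>2)) * poly p s)) (at s)"
    by (subst (asm) DERIV_cong_ev[OF refl _ refl])
  then have "poly (pderiv (residue_poly E r)) s = poly (pderiv p) s * F s + (\<Sum>a\<in>E. - (r a / (s - a)\<^sup>2)) * poly p s"
    using poly_DERIV DERIV_unique by blast
  then show ?thesis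
    using 0 by (simp add: F_def p sum_negf mult.commute)
qed

lemma residue_poly_remove:
  assumes "finite E" "s \<in> E" "r s = 0"
  shows "residue_poly E r = [:- s, 1:] * residue_poly (E - {s}) r"
proof -
  have "residue_poly E r = (\<Sum>a\<in>E - {s}. Polynomial.smult (r a) (\<Prod>b\<in>E - {a}. [:- b, 1:]))"
    unfolding residue_poly_def using assms by (intro sum.mono_neutral_right) auto
  also have "\<dots> = (\<Sum>a\<in>E - {s}. [:- s, 1:] * Polynomial.smult (r a) (\<Prod>b\<in>E - {s} - {a}. [:- b, 1:]))"
  proof (intro sum.cong refl)
    fix a assume "a \<in> E - {s}"
    then have "(\<Prod>b\<in>E - {a}. [:- b, 1:]) = [:- s, 1:] * (\<Prod>b\<in>E - {a} - {s}. [:- b, 1:])"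
      using assms by (intro prod.remove) auto
    moreover have "E - {a} - {s} = E - {s} - {a}"
      by auto
    ultimately show "Polynomial.smult (r a) (\<Prod>b\<in>E - {a}. [:- b, 1:]) =
        [:- s, 1:] * Polynomial.smult (r a) (\<Prod>b\<in>E - {s} - {a}. [:- b, 1:])"
      by (simp only: mult_smult_right)
  qed
  finally show ?thesis
    unfolding residue_poly_def by (simp only: sum_distrib_left)
qed

lemma residue_poly_lincomb:
  "residue_poly E (\<lambda>a. c * r a + s a) = Polynomial.smult c (residue_poly E r) + residue_poly E s"
  unfolding residue_poly_def by (simp add: smult_add_left sum.distrib smult_sum2)

lemma prod_linear_coeffs:
  fixes S :: "complex set"
  assumes "finite S"
  shows "Polynomial.degree (\<Prod>b\<in>S. [:- b, 1:]) = card S"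
    and "Polynomial.coeff (\<Prod>b\<in>S. [:- b, 1:]) (card S) = 1"
    and "S \<noteq> {} \<Longrightarrow> Polynomial.coeff (\<Prod>b\<in>S. [:- b, 1:]) (card S - 1) = - (\<Sum>b\<in>S. b)"
  using assms
proof (induction S)
  case (insert b S)
  let ?p = "\<Prod>b\<in>S. [:- b, 1:]"
  have p: "(\<Prod>b\<in>insert b S. [:- b, 1:]) = pCons 0 ?p - Polynomial.smult b ?p"
    using insert by simp
  {
    case 1
    have "?p \<noteq> 0"
      using insert by (simp add: prod_zero_iff)
    then show ?case
      using insert degree_mult_eq[of "[:- b, 1:]" ?p] by simp
  next
    case 2
    have "Polynomial.coeff ?p (Suc (card S)) = 0"
      using insert by (intro coeff_eq_0) simp
    then show ?case
      using insert unfolding p by simp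
  next
    case 3
    show ?case
    proof (cases "S = {}")
      case False
      then obtain k where "card S = Suc k"
        using insert by (metis card_gt_0_iff gr0_conv_Suc)
      then show ?thesis
        using insert False unfolding p by simp
    qed simp
  }
qed simp_all

text \<open>The total residue is the coefficient of degree \<open>card E - 1\<close>. When it
  vanishes, the next coefficient is the first moment, whose vanishing means a zero at
  infinity.\<close>

lemma residue_poly_degree:
  assumes E: "finite E" "card E \<ge> 2" and 0: "sum r E = 0"
  shows "Polynomial.degree (residue_poly E r) \<le> card E - 2"
    and "Polynomial.coeff (residue_poly E r) (card E - 2) = (\<Sum>a\<in>E. r a * a)"
proof -
  have card: "card (E - {a}) = card E - 1" if "a \<in> E" for a
    using that E by simp
  have ne: "E - {a} \<noteq> {}" if "a \<in> E" for a
  proof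
    assume "E - {a} = {}"
    then have "card (E - {a}) = 0"
      by (simp only: card.empty)
    then show False
      using card[OF that] E(2) by linarith
  qed
  have top: "Polynomial.coeff (residue_poly E r) (card E - 1) = sum r E"
    unfolding residue_poly_def coeff_sum coeff_smult
  proof (intro sum.cong refl)
    fix a assume "a \<in> E"
    then show "r a * Polynomial.coeff (\<Prod>b\<in>E - {a}. [:- b, 1:]) (card E - 1) = r a"
      using prod_linear_coeffs(2)[of "E - {a}"] E(1) card[of a] by simp
  qed
  have "Polynomial.degree (residue_poly E r) \<le> card E - 1"
    unfolding residue_poly_def
  proof (intro degree_sum_le E(1))
    fix a assume "a \<in> E"
    then have "Polynomial.degree (\<Prod>b\<in>E - {a}. [:- b, 1:]) = card E - 1"
      using prod_linear_coeffs(1)[of "E - {a}"] E(1) card[of a] by simp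
    then show "Polynomial.degree (Polynomial.smult (r a) (\<Prod>b\<in>E - {a}. [:- b, 1:])) \<le> card E - 1"
      by (metis degree_smult_le)
  qed
  show "Polynomial.degree (residue_poly E r) \<le> card E - 2"
  proof (rule degree_le, intro allI impI)
    fix i assume "i > card E - 2"
    then consider "i = card E - 1" | "i > card E - 1"
      by linarith
    then show "Polynomial.coeff (residue_poly E r) i = 0"
    proof cases
      case 1
      then show ?thesis
        using top 0 by simp
    next
      case 2
      then show ?thesis
        using \<open>Polynomial.degree (residue_poly E r) \<le> card E - 1\<close> by (intro coeff_eq_0) simp
    qed
  qed
  \<comment> \<open>The subleading coefficient of the product without \<open>a\<close> is
    \<open>a\<close> minus the sum over \<open>E\<close>; the latter drops out with the total
    residue.\<close>
  have "Polynomial.coeff (residue_poly E r) (card E - 2) = (\<Sum>a\<in>E. r a * (a - (\<Sum>b\<in>E. b)))"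
    unfolding residue_poly_def coeff_sum coeff_smult
  proof (intro sum.cong refl)
    fix a assume a: "a \<in> E"
    have "(\<Sum>b\<in>E. b) = a + (\<Sum>b\<in>E - {a}. b)"
      using E a by (intro sum.remove)
    then show "r a * Polynomial.coeff (\<Prod>b\<in>E - {a}. [:- b, 1:]) (card E - 2) = r a * (a - (\<Sum>b\<in>E. b))"
      using prod_linear_coeffs(3)[of "E - {a}"] E card[OF a] ne[OF a] by (simp add: numeral_2_eq_2)
  qed
  also have "\<dots> = (\<Sum>a\<in>E. r a * a) - sum r E * (\<Sum>b\<in>E. b)"
    by (simp add: right_diff_distrib sum_subtractf sum_distrib_right)
  finally show "Polynomial.coeff (residue_poly E r) (card E - 2) = (\<Sum>a\<in>E. r a * a)"
    using 0 by simp
qed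

section \<open>Real functions on the circle given by Laurent polynomials\<close>

text \<open>Real trigonometric polynomials; their continuation off the circle may have a pole at 0,
  whence the power of \<open>u\<close>.\<close>

definition laurent_on_circle :: "(complex \<Rightarrow> real) \<Rightarrow> bool"
  where "laurent_on_circle \<phi> \<longleftrightarrow>
    (\<exists>p n. \<forall>u\<in>unit_circle. of_real (\<phi> u) = poly p u / u ^ n)"

lemma laurent_const: "laurent_on_circle (\<lambda>u. c)"
  unfolding laurent_on_circle_def by (intro exI[of _ "[:of_real c:]"] exI[of _ 0]) simp

lemma laurent_add:
  assumes "laurent_on_circle \<phi>" "laurent_on_circle \<psi>"
  shows "laurent_on_circle (\<lambda>u. \<phi> u + \<psi> u)"
proof -
  obtain p n where p: "\<And>u. u \<in> unit_circle \<Longrightarrow> complex_of_real (\<phi> u) = poly p u / u ^ n"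
    using assms(1) unfolding laurent_on_circle_def by blast
  obtain q k where q: "\<And>u. u \<in> unit_circle \<Longrightarrow> complex_of_real (\<psi> u) = poly q u / u ^ k"
    using assms(2) unfolding laurent_on_circle_def by blast
  have "complex_of_real (\<phi> u + \<psi> u) = poly (p * Polynomial.monom 1 k + q * Polynomial.monom 1 n) u / u ^ (n + k)"
    if u: "u \<in> unit_circle" for u
  proof -
    have "u \<noteq> 0"
      using u by auto
    then show ?thesis
      unfolding of_real_add p[OF u] q[OF u] by (simp add: poly_monom power_add add_frac_eq)
  qed
  then show ?thesis
    unfolding laurent_on_circle_def by blast
qed

lemma laurent_mult:
  assumes "laurent_on_circle \<phi>" "laurent_on_circle \<psi>"
  shows "laurent_on_circle (\<lambda>u. \<phi> u * \<psi> u)"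
proof -
  obtain p n where p: "\<And>u. u \<in> unit_circle \<Longrightarrow> complex_of_real (\<phi> u) = poly p u / u ^ n"
    using assms(1) unfolding laurent_on_circle_def by blast
  obtain q k where q: "\<And>u. u \<in> unit_circle \<Longrightarrow> complex_of_real (\<psi> u) = poly q u / u ^ k"
    using assms(2) unfolding laurent_on_circle_def by blast
  have "complex_of_real (\<phi> u * \<psi> u) = poly (p * q) u / u ^ (n + k)" if u: "u \<in> unit_circle" for u
    unfolding of_real_mult p[OF u] q[OF u] by (simp add: power_add)
  then show ?thesis
    unfolding laurent_on_circle_def by blast
qed

lemma laurent_sum: "(\<And>a. a \<in> S \<Longrightarrow> laurent_on_circle (\<phi> a)) \<Longrightarrow> laurent_on_circle (\<lambda>u. \<Sum>a\<in>S. \<phi> a u)"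
  by (induction S rule: infinite_finite_induct) (simp_all add: laurent_const laurent_add)

lemma laurent_prod: "(\<And>a. a \<in> S \<Longrightarrow> laurent_on_circle (\<phi> a)) \<Longrightarrow> laurent_on_circle (\<lambda>u. \<Prod>a\<in>S. \<phi> a u)"
  by (induction S rule: infinite_finite_induct) (simp_all add: laurent_const laurent_mult)

lemma laurent_dist:
  assumes "a \<in> unit_circle"
  shows "laurent_on_circle (\<lambda>u. (cmod (u - a))\<^sup>2)"
  unfolding laurent_on_circle_def
proof (intro exI ballI)
  fix u :: complex assume u: "u \<in> unit_circle"
  have "u * cnj u = 1" "a * cnj a = 1" "u \<noteq> 0"
    using u assms by (auto simp: complex_norm_square[symmetric])
  then have "complex_of_real ((cmod (u - a))\<^sup>2) * u = 2 * u - a - cnj a * u * u"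
    unfolding complex_norm_square by (simp add: algebra_simps)
  then show "complex_of_real ((cmod (u - a))\<^sup>2) = poly [:- a, 2, - cnj a:] u / u ^ 1"
    using \<open>u \<noteq> 0\<close> by (simp add: eq_divide_eq algebra_simps)
qed

lemma laurent_family_prod: "S \<subseteq> unit_circle \<Longrightarrow> laurent_on_circle (family_prod S)"
  unfolding family_prod_def[abs_def] by (intro laurent_prod laurent_dist) auto

lemma laurent_family_det:
  assumes "S \<subseteq> unit_circle" "T \<subseteq> unit_circle" "R \<subseteq> unit_circle"
  shows "laurent_on_circle (family_det m S T R)"
  unfolding family_det_def[abs_def] det3_expand family_weight_def
  by (intro laurent_sum laurent_mult laurent_const laurent_prod laurent_dist) (use assms in auto)

lemma laurent_quotients:
  assumes "laurent_on_circle \<phi>1" "laurent_on_circle \<psi>1" "\<And>u. u \<in> unit_circle \<Longrightarrow> \<psi>1 u \<noteq> 0"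
    and "laurent_on_circle \<phi>2" "laurent_on_circle \<psi>2" "\<And>u. u \<in> unit_circle \<Longrightarrow> \<psi>2 u \<noteq> 0"
  shows "\<exists>f g h. \<forall>u\<in>unit_circle. poly h u \<noteq> 0 \<and>
    of_real (\<phi>1 u / \<psi>1 u) = poly f u / poly h u \<and> of_real (\<phi>2 u / \<psi>2 u) = poly g u / poly h u"
proof -
  have *: "\<exists>p q. \<forall>u\<in>unit_circle. poly q u \<noteq> 0 \<and> of_real (\<phi> u / \<psi> u) = poly p u / poly q u"
    if l1: "laurent_on_circle \<phi>" and l2: "laurent_on_circle \<psi>" and nz: "\<And>u. u \<in> unit_circle \<Longrightarrow> \<psi> u \<noteq> 0" for \<phi> \<psi>
  proof -
    obtain p n where p: "\<And>u. u \<in> unit_circle \<Longrightarrow> complex_of_real (\<phi> u) = poly p u / u ^ n"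
      using l1 unfolding laurent_on_circle_def by blast
    obtain q k where q: "\<And>u. u \<in> unit_circle \<Longrightarrow> complex_of_real (\<psi> u) = poly q u / u ^ k"
      using l2 unfolding laurent_on_circle_def by blast
    show ?thesis
    proof (intro exI ballI conjI)
      fix u :: complex assume u: "u \<in> unit_circle"
      have "u \<noteq> 0" "poly q u \<noteq> 0"
        using u nz[OF u] q[OF u] by auto
      then show "poly (q * Polynomial.monom 1 n) u \<noteq> 0"
        by (simp add: poly_monom)
      show "complex_of_real (\<phi> u / \<psi> u) = poly (p * Polynomial.monom 1 k) u / poly (q * Polynomial.monom 1 n) u"
        unfolding of_real_divide p[OF u] q[OF u] by (simp add: poly_monom mult.commute)
    qed
  qed
  obtain p1 q1 where 1: "\<And>u. u \<in> unit_circle \<Longrightarrow> poly q1 u \<noteq> 0"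
    "\<And>u. u \<in> unit_circle \<Longrightarrow> of_real (\<phi>1 u / \<psi>1 u) = poly p1 u / poly q1 u"
    using *[OF assms(1-3)] by blast
  obtain p2 q2 where 2: "\<And>u. u \<in> unit_circle \<Longrightarrow> poly q2 u \<noteq> 0"
    "\<And>u. u \<in> unit_circle \<Longrightarrow> of_real (\<phi>2 u / \<psi>2 u) = poly p2 u / poly q2 u"
    using *[OF assms(4-6)] by blast
  show ?thesis
  proof (intro exI ballI conjI)
    fix u :: complex assume u: "u \<in> unit_circle"
    show "poly (q1 * q2) u \<noteq> 0"
      using 1(1)[OF u] 2(1)[OF u] by simp
    show "of_real (\<phi>1 u / \<psi>1 u) = poly (p1 * q2) u / poly (q1 * q2) u"
      "of_real (\<phi>2 u / \<psi>2 u) = poly (p2 * q1) u / poly (q1 * q2) u"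
      unfolding 1(2)[OF u] 2(2)[OF u] using 1(1)[OF u] 2(1)[OF u] by simp_all
  qed
qed

text \<open>A common root of \<open>f\<close>, \<open>g\<close>, \<open>h\<close> would solve
  \<open>f = x h\<close>, \<open>g = y h\<close> for all \<open>x\<close>, \<open>y\<close> and
  spoil the elimination. As \<open>h\<close> has no root on the circle, such factors can be
  cancelled without changing the values there.\<close>

lemma reduce_common_roots:
  fixes f g h :: "complex poly"
  assumes "\<And>u. u \<in> unit_circle \<Longrightarrow> poly h u \<noteq> 0 \<and> x u = poly f u / poly h u \<and> y u = poly g u / poly h u"
  shows "\<exists>f g h. (\<forall>u\<in>unit_circle. poly h u \<noteq> 0 \<and> x u = poly f u / poly h u \<and> y u = poly g u / poly h u) \<and>
    \<not> (\<exists>u. poly f u = 0 \<and> poly g u = 0 \<and> poly h u = 0)"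
  using assms
proof (induction "Polynomial.degree h" arbitrary: f g h rule: less_induct)
  case less
  show ?case
  proof (cases "\<exists>u. poly f u = 0 \<and> poly g u = 0 \<and> poly h u = 0")
    case False
    then show ?thesis
      using less.prems by blast
  next
    case True
    then obtain v where v: "poly f v = 0" "poly g v = 0" "poly h v = 0"
      by blast
    obtain f1 g1 h1 where 1: "f = [:- v, 1:] * f1" "g = [:- v, 1:] * g1" "h = [:- v, 1:] * h1"
      using v unfolding poly_eq_0_iff_dvd by (metis dvdE)
    have "h \<noteq> 0"
      using less.prems[of 1] by auto
    then have "h1 \<noteq> 0"
      using 1 by auto
    then have deg: "Polynomial.degree h1 < Polynomial.degree h"
      using degree_mult_eq[of "[:- v, 1:]" h1] 1(3) by simp
    have "v \<notin> unit_circle"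
      using v less.prems by blast
    show ?thesis
    proof (rule less.hyps[OF deg, of f1 g1])
      fix u :: complex assume u: "u \<in> unit_circle"
      then have "poly [:- v, 1:] u \<noteq> 0"
        using \<open>v \<notin> unit_circle\<close> by auto
      then show "poly h1 u \<noteq> 0 \<and> x u = poly f1 u / poly h1 u \<and> y u = poly g1 u / poly h1 u"
        using less.prems[OF u] unfolding 1 poly_mult by simp
    qed
  qed
qed

text \<open>The value at infinity is the conjugate of the value at 0.\<close>

lemma real_on_circle_reflection:
  fixes f h :: "complex poly"
  assumes real: "\<And>u. u \<in> unit_circle \<Longrightarrow> poly h u \<noteq> 0 \<and> of_real (x u) = poly f u / poly h u"
    and deg: "Polynomial.degree f \<le> n" "Polynomial.degree h \<le> n"
  shows "poly f 0 * cnj (Polynomial.coeff h n) = cnj (Polynomial.coeff f n) * poly h 0"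
proof -
  \<comment> \<open>Reversed and conjugated coefficients: on the circle this is
    \<open>u ^ n * cnj (poly v u)\<close>, at 0 it is the conjugate of the top coefficient of
    \<open>v\<close>.\<close>
  define refl where "refl v = (\<Sum>i\<le>n. Polynomial.monom (cnj (Polynomial.coeff v (n - i))) i)" for v
  have refl: "poly (refl v) u = u ^ n * cnj (poly v u)" if u: "u \<in> unit_circle" and v: "Polynomial.degree v \<le> n" for v u
  proof -
    have n: "u * cnj u = 1"
      using u by (simp add: complex_norm_square[symmetric])
    have "u ^ n * cnj (poly v u) = (\<Sum>i\<le>n. cnj (Polynomial.coeff v i) * (u ^ n * cnj u ^ i))"
    proof -
      have "poly v u = (\<Sum>i\<le>n. Polynomial.coeff v i * u ^ i)"
        using arg_cong[OF poly_as_sum_of_monoms'[OF v], of "\<lambda>p. poly p u"] by (simp add: poly_sum poly_monom)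
      then show ?thesis
        by (simp add: sum_distrib_left mult_ac)
    qed
    also have "\<dots> = (\<Sum>i\<le>n. cnj (Polynomial.coeff v i) * u ^ (n - i))"
    proof (intro sum.cong refl)
      fix i assume "i \<in> {..n}"
      then have "u ^ n = u ^ (n - i) * u ^ i"
        by (simp flip: power_add)
      then have "u ^ n * cnj u ^ i = u ^ (n - i) * (u * cnj u) ^ i"
        by (simp add: power_mult_distrib)
      then show "cnj (Polynomial.coeff v i) * (u ^ n * cnj u ^ i) = cnj (Polynomial.coeff v i) * u ^ (n - i)"
        by (simp add: n)
    qed
    also have "\<dots> = (\<Sum>i\<le>n. cnj (Polynomial.coeff v (n - i)) * u ^ i)"
      by (rule sum.reindex_bij_witness[of _ "\<lambda>i. n - i" "\<lambda>i. n - i"]) auto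
    also have "\<dots> = poly (refl v) u"
      by (simp add: refl_def poly_sum poly_monom)
    finally show ?thesis ..
  qed
  have refl0: "poly (refl v) 0 = cnj (Polynomial.coeff v n)" for v
    by (simp add: poly_0_coeff_0 refl_def coeff_sum)
  have "f * refl h - refl f * h = 0"
  proof (rule poly_zero_on_circle)
    fix u :: complex assume u: "u \<in> unit_circle"
    have "cnj (poly f u / poly h u) = poly f u / poly h u"
      using real[OF u] by (metis complex_cnj_complex_of_real)
    then have "cnj (poly f u) * poly h u = poly f u * cnj (poly h u)"
      using real[OF u] by (simp add: frac_eq_eq)
    then show "poly (f * refl h - refl f * h) u = 0"
      using refl[OF u deg(1)] refl[OF u deg(2)] by (simp add: algebra_simps)
  qed
  then have "poly (f * refl h - refl f * h) 0 = 0"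
    by simp
  then show ?thesis
    by (simp add: refl0)
qed

section \<open>Parametrization of the arctic curve\<close>

context circular_weights begin

definition numerator :: "real \<times> real \<Rightarrow> complex poly"
  where "numerator p = residue_poly angles (\<lambda>a. of_real (charge p a))"

text \<open>The charges are affine in \<open>p\<close>, hence so is \<open>numerator\<close>; this
  is its slope in \<open>x\<close>.\<close>

definition numerator_x :: "complex poly"
  where "numerator_x = residue_poly angles (\<lambda>a. of_real (charge (1, 0) a - charge (0, 0) a))"

definition numerator_y :: "complex poly"
  where "numerator_y = residue_poly angles (\<lambda>a. of_real (charge (0, 1) a - charge (0, 0) a))"

lemma numerator_affine:
  "numerator p = Polynomial.smult (of_real (fst p)) numerator_x +
    Polynomial.smult (of_real (snd p)) numerator_y + numerator (0, 0)"
proof -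
  have "charge p a = fst p * (charge (1, 0) a - charge (0, 0) a) +
      (snd p * (charge (0, 1) a - charge (0, 0) a) + charge (0, 0) a)" for a
    unfolding charge_def by (simp add: algebra_simps)
  then have "numerator p = residue_poly angles (\<lambda>a. of_real (fst p) * of_real (charge (1, 0) a - charge (0, 0) a) +
      (of_real (snd p) * of_real (charge (0, 1) a - charge (0, 0) a) + of_real (charge (0, 0) a)))"
    unfolding numerator_def by (metis (no_types) of_real_add of_real_mult)
  also have "\<dots> = Polynomial.smult (of_real (fst p)) numerator_x +
    (Polynomial.smult (of_real (snd p)) numerator_y + numerator (0, 0))"
    unfolding residue_poly_lincomb numerator_x_def numerator_y_def numerator_def ..
  finally show ?thesis
    by (simp only: add.assoc)
qed

lemma card_angles: "card angles \<ge> 2"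
proof -
  obtain a b where ab: "a \<in> A" "b \<in> B"
    using ne by blast
  then have "a \<noteq> b" "{a, b} \<subseteq> angles"
    using disjoint by (auto simp: angles_def)
  then have "card {a, b} = 2"
    by simp
  moreover have "card {a, b} \<le> card angles"
    by (rule card_mono) (fact finite_angles, fact)
  ultimately show ?thesis
    by linarith
qed

lemma degree_numerators:
  "Polynomial.degree (numerator p) \<le> card angles - 2"
  "Polynomial.degree numerator_x \<le> card angles - 2"
  "Polynomial.degree numerator_y \<le> card angles - 2"
  unfolding numerator_def numerator_x_def numerator_y_def
  by (intro residue_poly_degree(1) finite_angles card_angles;
      simp add: sum_subtractf sum_charge_1 flip: of_real_sum)+

lemma numerator_eq_0_iff:
  assumes "u \<notin> angles"
  shows "poly (numerator p) u = 0 \<longleftrightarrow> (\<Sum>a\<in>angles. of_real (charge p a) / (u - a)) = 0"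
  unfolding numerator_def poly_residue_poly[OF finite_angles assms]
  using assms finite_angles by (auto simp: prod_zero_iff)

lemma pderiv_numerator_eq_0_iff:
  assumes "u \<notin> angles" "poly (numerator p) u = 0"
  shows "poly (pderiv (numerator p)) u = 0 \<longleftrightarrow> (\<Sum>a\<in>angles. of_real (charge p a) / (u - a)\<^sup>2) = 0"
proof -
  have "poly (pderiv (numerator p)) u = - (\<Prod>b\<in>angles. u - b) * (\<Sum>a\<in>angles. of_real (charge p a) / (u - a)\<^sup>2)"
    using assms(2) unfolding numerator_eq_0_iff[OF assms(1)] unfolding numerator_def
    by (rule poly_pderiv_residue_poly[OF finite_angles assms(1)])
  then show ?thesis
    using assms(1) finite_angles by (auto simp: prod_zero_iff)
qed

lemma charge_at_angle:
  assumes "u \<in> angles"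
  shows "charge (point u) u = 0"
proof -
  consider "u \<in> A" | "u \<in> B" | "u \<in> C" | "u \<in> D"
    using assms by (auto simp: angles_def)
  then show ?thesis
    by cases (simp_all add: charge_simps snd_point fst_point)
qed

lemma numerator_point:
  assumes "u \<in> unit_circle"
  shows "poly (numerator (point u)) u = 0"
proof (cases "u \<in> angles")
  case True
  then show ?thesis
    unfolding numerator_def poly_residue_poly_pole[OF finite_angles True] by (simp add: charge_at_angle)
next
  case False
  then show ?thesis
    using double_critical_on_circle[OF assms False, of "point u"] by (simp add: numerator_eq_0_iff)
qed

lemma pderiv_numerator_point:
  assumes "u \<in> unit_circle" "u \<notin> angles"
  shows "poly (pderiv (numerator (point u))) u = 0"
  using double_critical_on_circle[OF assms, of "point u"] assms
  by (simp add: pderiv_numerator_eq_0_iff numerator_point)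

section \<open>The numerator at an angle of the first family\<close>

lemma point_A:
  assumes "a \<in> A"
  shows "0 \<le> fst (point a)" "fst (point a) \<le> 1" "snd (point a) = 0" "fst (point a) \<noteq> 0" "fst (point a) \<noteq> 1"
  using assms point_in_square[of a] snd_point(1)[of a] fst_point[of a] disjoint by (auto simp: unit_square_def)

lemma charge_point_A: "a \<in> A \<Longrightarrow> s \<in> angles \<Longrightarrow> charge (point a) s = 0 \<longleftrightarrow> s \<in> A"
  using point_A[of a] pos disjoint by (auto simp: angles_def charge_simps)
    (metis UnI1 UnI2 less_irrefl)+

lemma sum_without_A:
  assumes "a \<in> A" "S \<subseteq> A"
  shows "(\<Sum>b\<in>angles - S. of_real (charge (point a) b) / g b) =
    (\<Sum>b\<in>angles - A. of_real (charge (point a) b) / (g b :: complex))"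
  using assms finite_angles by (intro sum.mono_neutral_right) (auto simp: charge_simps point_A)

lemma critical_without_A: "a \<in> A \<Longrightarrow> (\<Sum>b\<in>angles - A. of_real (charge (point a) b) / (a - b)) = 0"
  using sum_without_A[of a "{}"] critical_at_angle[of a] by simp

text \<open>The top coefficient is the first moment, nonzero by \<open>reduced_moment\<close>. The
  full degree is needed for the specialization at \<open>a\<close>.\<close>

lemma numerator_A_degree:
  assumes "a \<in> A"
  shows "Polynomial.degree (numerator (point a)) = card angles - 2" "numerator (point a) \<noteq> 0"
proof -
  have "Polynomial.coeff (numerator (point a)) (card angles - 2) \<noteq> 0"
    unfolding numerator_def
    using residue_poly_degree(2)[OF finite_angles card_angles, of "\<lambda>b. of_real (charge (point a) b)"]
      sum_charge_1 reduced_moment[OF point_A(1-3)[OF assms]] by (simp flip: of_real_sum)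
  then show "Polynomial.degree (numerator (point a)) = card angles - 2" "numerator (point a) \<noteq> 0"
    using degree_numerators(1)[of "point a"] le_degree by (auto intro: antisym)
qed

text \<open>Each \<open>s\<close> in \<open>A\<close> is uncharged, hence a root of the numerator.
  At \<open>s\<close> the cofactor is a nonzero multiple of the reduced form, so \<open>s\<close> is
  a multiple root exactly when the reduced form vanishes there.\<close>

lemma numerator_A_factor:
  assumes "a \<in> A" "s \<in> A"
  defines "R \<equiv> residue_poly (angles - {s}) (\<lambda>b. of_real (charge (point a) b))"
  shows "numerator (point a) = [:- s, 1:] * R"
    and "poly R s = (\<Prod>b\<in>angles - {s}. s - b) * (\<Sum>b\<in>angles - A. of_real (charge (point a) b) / (s - b))"
    and "poly R s = 0 \<Longrightarrow> poly (pderiv R) s =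
      - (\<Prod>b\<in>angles - {s}. s - b) * (\<Sum>b\<in>angles - A. of_real (charge (point a) b) / (s - b)\<^sup>2)"
    and "(\<Prod>b\<in>angles - {s}. s - b) \<noteq> 0"
proof -
  have s: "s \<in> angles" "{s} \<subseteq> A"
    using assms by (auto simp: angles_def)
  show "numerator (point a) = [:- s, 1:] * R"
    unfolding numerator_def R_def using finite_angles s assms(1,2)
    by (intro residue_poly_remove) (simp_all add: charge_point_A)
  show *: "(\<Prod>b\<in>angles - {s}. s - b) \<noteq> 0"
    using finite_angles by (auto simp: prod_zero_iff)
  show R: "poly R s = (\<Prod>b\<in>angles - {s}. s - b) * (\<Sum>b\<in>angles - A. of_real (charge (point a) b) / (s - b))"
    unfolding R_def using finite_angles sum_without_A[OF assms(1) s(2)] by (subst poly_residue_poly) auto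
  assume "poly R s = 0"
  then have "(\<Sum>b\<in>angles - {s}. of_real (charge (point a) b) / (s - b)) = 0"
    using R * sum_without_A[OF assms(1) s(2)] by simp
  then show "poly (pderiv R) s =
      - (\<Prod>b\<in>angles - {s}. s - b) * (\<Sum>b\<in>angles - A. of_real (charge (point a) b) / (s - b)\<^sup>2)"
    unfolding R_def using finite_angles sum_without_A[OF assms(1) s(2)] by (subst poly_pderiv_residue_poly) auto
qed

text \<open>Off the angles a multiple root is a double zero of the reduced form, at a charged angle
  the numerator does not vanish, and at another angle \<open>s\<close> of \<open>A\<close> the
  reduced form would vanish at both \<open>s\<close> and \<open>a\<close>.\<close>

lemma numerator_A_simple:
  assumes a: "a \<in> A" and s: "poly (numerator (point a)) s = 0" "poly (pderiv (numerator (point a))) s = 0"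
  shows "s = a"
proof (rule ccontr)
  assume "s \<noteq> a"
  consider "s \<notin> angles" | "s \<in> angles - A" | "s \<in> A"
    by blast
  then show False
  proof cases
    case 1
    then have "(\<Sum>b\<in>angles - {}. of_real (charge (point a) b) / (s - b)) = 0"
      "(\<Sum>b\<in>angles - {}. of_real (charge (point a) b) / (s - b)\<^sup>2) = 0"
      using s by (simp_all add: numerator_eq_0_iff pderiv_numerator_eq_0_iff)
    then show False
      unfolding sum_without_A[OF a empty_subsetI] using 1
      by (intro reduced_no_double_zero[OF point_A(1-3)[OF a], of s]) auto
  next
    case 2
    then have "poly (numerator (point a)) s \<noteq> 0"
      unfolding numerator_def using finite_angles charge_point_A[OF a, of s]
      by (subst poly_residue_poly_pole) (auto simp: prod_zero_iff)
    with s show False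
      by simp
  next
    case 3
    note R = numerator_A_factor[OF a 3]
    have "(\<Sum>b\<in>angles - A. of_real (charge (point a) b) / (s - b)) = 0"
      using s(2) R(2,4) unfolding R(1) pderiv_mult by (simp add: pderiv_pCons)
    then show False
      using reduced_one_zero[OF point_A(1-3)[OF a] a 3 _ critical_without_A[OF a]] \<open>s \<noteq> a\<close> by simp
  qed
qed

text \<open>The cofactor \<open>R\<close> of \<open>z - a\<close> has a simple root at
  \<open>a\<close>, since the reduced form has no double zero; the second derivative of the product
  is twice the derivative of \<open>R\<close>.\<close>

lemma numerator_A_double:
  assumes a: "a \<in> A"
  shows "poly (pderiv (pderiv (numerator (point a)))) a \<noteq> 0"
proof -
  define R where "R = residue_poly (angles - {a}) (\<lambda>b. of_real (charge (point a) b))"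
  note R = numerator_A_factor[OF a a, folded R_def]
  have "poly R a = 0"
    unfolding R(2) critical_without_A[OF a] by simp
  moreover have "(\<Sum>b\<in>angles - A. of_real (charge (point a) b) / (a - b)\<^sup>2) \<noteq> 0"
    using reduced_no_double_zero[OF point_A(1-3)[OF a] _ critical_without_A[OF a]] a by auto
  ultimately have "poly (pderiv R) a \<noteq> 0"
    using R(3,4) by simp
  moreover have "poly (pderiv (pderiv ([:- a, 1:] * R))) a = 2 * poly (pderiv R) a"
    unfolding pderiv_mult pderiv_add by (simp add: pderiv_pCons)
  ultimately show ?thesis
    unfolding R(1) by simp
qed

lemma parametrization:
  "\<exists>f g h. (\<forall>u\<in>unit_circle. poly h u \<noteq> 0 \<and> complex_of_real (fst (point u)) = poly f u / poly h u \<and>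
      complex_of_real (snd (point u)) = poly g u / poly h u) \<and>
    \<not> (\<exists>u. poly f u = 0 \<and> poly g u = 0 \<and> poly h u = 0)"
proof -
  interpret R: circular_weights C D B A m
    by (rule rotated)
  have "\<exists>f g h. \<forall>u\<in>unit_circle. poly h u \<noteq> 0 \<and>
      of_real (fst (point u)) = poly f u / poly h u \<and> of_real (snd (point u)) = poly g u / poly h u"
    unfolding point_def coord_def fst_conv snd_conv
    by (intro laurent_quotients laurent_add laurent_mult laurent_family_prod laurent_family_det circ
        less_imp_neq[THEN not_sym] coord_denom_pos R.coord_denom_pos)
  then obtain f g h where "\<And>u. u \<in> unit_circle \<Longrightarrow> poly h u \<noteq> 0 \<and>
      complex_of_real (fst (point u)) = poly f u / poly h u \<and> complex_of_real (snd (point u)) = poly g u / poly h u"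
    by blast
  then show ?thesis
    by (rule reduce_common_roots)
qed

end

locale parametrized_weights = circular_weights +
  fixes f g h :: "complex poly"
  assumes param: "\<And>u. u \<in> unit_circle \<Longrightarrow> poly h u \<noteq> 0"
      "\<And>u. u \<in> unit_circle \<Longrightarrow> complex_of_real (fst (point u)) = poly f u / poly h u"
      "\<And>u. u \<in> unit_circle \<Longrightarrow> complex_of_real (snd (point u)) = poly g u / poly h u"
    and no_common_root: "\<And>u. poly f u = 0 \<Longrightarrow> poly g u = 0 \<Longrightarrow> poly h u = 0 \<Longrightarrow> False"
begin

lemma combination_at:
  assumes "poly f u = of_real x * poly h u" "poly g u = of_real y * poly h u"
  shows "poly (f * numerator_x + g * numerator_y + h * numerator (0, 0)) u = poly h u * poly (numerator (x, y)) u"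
    and "poly (f * pderiv numerator_x + g * pderiv numerator_y + h * pderiv (numerator (0, 0))) u =
      poly h u * poly (pderiv (numerator (x, y))) u"
  unfolding numerator_affine[of "(x, y)"]
  using assms by (simp_all add: pderiv_add pderiv_smult algebra_simps)

lemma combination_on_circle:
  assumes u: "u \<in> unit_circle"
  shows "poly f u = of_real (fst (point u)) * poly h u" "poly g u = of_real (snd (point u)) * poly h u"
  using param[OF u] by simp_all

lemma combination_zero:
  "f * numerator_x + g * numerator_y + h * numerator (0, 0) = 0"
  "f * pderiv numerator_x + g * pderiv numerator_y + h * pderiv (numerator (0, 0)) = 0"
proof -
  show "f * numerator_x + g * numerator_y + h * numerator (0, 0) = 0"
    by (rule poly_zero_on_circle)
      (simp add: combination_at[OF combination_on_circle] numerator_point del: poly_add poly_mult)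
  define P where "P = f * pderiv numerator_x + g * pderiv numerator_y + h * pderiv (numerator (0, 0))"
  \<comment> \<open>The double root is so far known only off the angles; \<open>Q\<close> vanishes
    at the angles and can be cancelled from the polynomial identity.\<close>
  define Q where "Q = (\<Prod>a\<in>angles. [:- a, 1:])"
  have "Q * P = 0"
  proof (rule poly_zero_on_circle)
    fix u :: complex assume u: "u \<in> unit_circle"
    show "poly (Q * P) u = 0"
    proof (cases "u \<in> angles")
      case True
      then have "poly Q u = 0"
        using finite_angles by (auto simp: Q_def poly_prod prod_zero_iff)
      then show ?thesis
        by simp
    next
      case False
      then show ?thesis
        unfolding poly_mult P_def combination_at(2)[OF combination_on_circle[OF u]]
        by (simp add: pderiv_numerator_point[OF u])
    qed
  qed
  moreover have "Q \<noteq> 0"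
    using finite_angles by (simp add: Q_def prod_zero_iff)
  ultimately show "P = 0"
    by simp
qed

lemma real_value_on_circle:
  assumes u: "u \<notin> unit_circle" and fg: "poly f u = of_real x * poly h u" "poly g u = of_real y * poly h u"
  shows False
proof -
  have "poly h u \<noteq> 0"
    using no_common_root[of u] fg by auto
  then have "poly (numerator (x, y)) u = 0" "poly (pderiv (numerator (x, y))) u = 0"
    using combination_at[OF fg] unfolding combination_zero by simp_all
  moreover have "u \<notin> angles" "cmod u \<noteq> 1"
    using u angles_circle by auto
  ultimately show False
    using no_double_critical_off_circle[of u "(x, y)"] numerator_eq_0_iff[of u "(x, y)"]
      pderiv_numerator_eq_0_iff[of u "(x, y)"] by simp
qed

text \<open>The reflection of infinity is 0, so real ratios of the top coefficients give a real
  value at 0, a point off the circle. If \<open>h\<close> has no term of degree \<open>n\<close>,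
  all three top coefficients vanish, which forces \<open>n = 0\<close> and
  \<open>h = 0\<close>.\<close>

lemma no_real_value_at_infinity:
  assumes n: "n = Max {Polynomial.degree f, Polynomial.degree g, Polynomial.degree h}"
    and top: "Polynomial.coeff f n = of_real x * Polynomial.coeff h n"
      "Polynomial.coeff g n = of_real y * Polynomial.coeff h n"
  shows False
proof (cases "Polynomial.coeff h n = 0")
  case False
  have deg: "Polynomial.degree f \<le> n" "Polynomial.degree g \<le> n" "Polynomial.degree h \<le> n"
    by (simp_all add: n)
  have "poly f 0 * cnj (Polynomial.coeff h n) = cnj (Polynomial.coeff f n) * poly h 0"
    by (rule real_on_circle_reflection[OF _ deg(1,3)]) (use param in blast)
  moreover have "poly g 0 * cnj (Polynomial.coeff h n) = cnj (Polynomial.coeff g n) * poly h 0"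
    by (rule real_on_circle_reflection[OF _ deg(2,3)]) (use param in blast)
  ultimately have "poly f 0 = of_real x * poly h 0" "poly g 0 = of_real y * poly h 0"
    using False by (simp_all add: top)
  then show False
    by (intro real_value_on_circle[of 0]) auto
next
  case True
  then have 0: "Polynomial.coeff f n = 0" "Polynomial.coeff g n = 0"
    using top by simp_all
  have "h \<noteq> 0"
    using param(1)[of 1] by auto
  have "n \<in> {Polynomial.degree f, Polynomial.degree g, Polynomial.degree h}"
    unfolding n by (rule Max_in) auto
  then consider "n = Polynomial.degree f" | "n = Polynomial.degree g" | "n = Polynomial.degree h"
    by blast
  then have "n = 0"
    using 0 True by cases auto
  then have "Polynomial.degree h = 0"
    using n by simp
  then show False
    using True \<open>h \<noteq> 0\<close> \<open>n = 0\<close> by (metis leading_coeff_0_iff)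
qed

lemma parameter:
  assumes a: "a \<in> A"
  shows "emb [:0, 1:] \<in> function_field (emb f / emb h) (emb g / emb h)"
proof (rule parameter_in_function_field[OF _ combination_zero refl])
  have "a \<in> unit_circle"
    using a circ by blast
  note h = param(1)[OF this] and fg = combination_on_circle[OF this]
  show "poly h a \<noteq> 0"
    by (rule h)
  let ?N = "Polynomial.smult (poly f a) numerator_x + Polynomial.smult (poly g a) numerator_y +
    Polynomial.smult (poly h a) (numerator (0, 0))"
  have N: "?N = Polynomial.smult (poly h a) (numerator (point a))"
    unfolding numerator_affine[of "point a"] fg by (simp add: smult_add_right mult.commute)
  show "Polynomial.degree numerator_x \<le> Polynomial.degree ?N" "Polynomial.degree numerator_y \<le> Polynomial.degree ?N"
    "Polynomial.degree (numerator (0, 0)) \<le> Polynomial.degree ?N" "?N \<noteq> 0"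
    unfolding N using h degree_numerators numerator_A_degree[OF a] by simp_all
  show "poly (pderiv (pderiv ?N)) a \<noteq> 0"
    unfolding N pderiv_smult using h numerator_A_double[OF a] by simp
  fix s assume "poly ?N s = 0" "poly (pderiv ?N) s = 0"
  then show "s = a"
    unfolding N pderiv_smult using h by (intro numerator_A_simple[OF a]) auto
qed

end

section \<open>Tangency points and genus\<close>

text \<open>The coordinate is real along the circle, so its derivative there has no imaginary part;
  if \<open>r = 0\<close>, the complex derivative of the quotient vanishes, stated as a relation
  between \<open>pderiv v\<close> and \<open>pderiv h\<close>.\<close>

lemma derivative_along_circle:
  fixes v h :: "complex poly" and x :: "complex \<Rightarrow> real"
  assumes x: "\<And>u. u \<in> unit_circle \<Longrightarrow> poly h u \<noteq> 0 \<and> of_real (x u) = poly v u / poly h u"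
    and a: "a \<in> unit_circle"
  obtains r where "((\<lambda>t. x (a * cis t)) has_vector_derivative r) (at 0)"
    "r = 0 \<Longrightarrow> poly (pderiv v) a = of_real (x a) * poly (pderiv h) a"
proof -
  define d where "d = (poly (pderiv v) a * poly h a - poly v a * poly (pderiv h) a) / (poly h a * poly h a)"
  have circle: "a * cis t \<in> unit_circle" for t
    using a by (simp add: norm_mult)
  have "((\<lambda>z. poly v z / poly h z) has_field_derivative d) (at (a * cis 0))"
    unfolding d_def cis_zero mult_1_right using x[OF a] by (intro DERIV_divide poly_DERIV) simp
  moreover have "((\<lambda>t. a * cis t) has_vector_derivative a * \<i>) (at 0)"
    unfolding has_vector_derivative_def by (auto intro!: derivative_eq_intros simp: scaleR_conv_of_real)
  ultimately have "(((\<lambda>z. poly v z / poly h z) \<circ> (\<lambda>t. a * cis t)) has_vector_derivative a * \<i> * d) (at 0)"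
    by (intro field_vector_diff_chain_at) auto
  moreover have "(\<lambda>z. poly v z / poly h z) \<circ> (\<lambda>t. a * cis t) = (\<lambda>t. of_real (x (a * cis t)))"
    using x[OF circle] by auto
  ultimately have D: "((\<lambda>t. complex_of_real (x (a * cis t))) has_vector_derivative a * \<i> * d) (at 0)"
    by simp
  have re: "((\<lambda>t. x (a * cis t)) has_vector_derivative Re (a * \<i> * d)) (at 0)"
    using bounded_linear.has_vector_derivative[OF bounded_linear_Re D] by simp
  have "((\<lambda>t. 0 :: real) has_vector_derivative Im (a * \<i> * d)) (at 0)"
    using bounded_linear.has_vector_derivative[OF bounded_linear_Im D] by simp
  then have "Im (a * \<i> * d) = 0"
    by (rule vector_derivative_unique_at) (rule has_vector_derivative_const)
  then have "poly (pderiv v) a = of_real (x a) * poly (pderiv h) a" if "Re (a * \<i> * d) = 0"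
  proof -
    have "a * \<i> * d = 0"
      using that \<open>Im (a * \<i> * d) = 0\<close> by (simp add: complex_eq_iff)
    moreover have "a \<noteq> 0"
      using a by auto
    ultimately have "d = 0"
      by simp
    then show ?thesis
      using x[OF a] by (simp add: d_def field_simps)
  qed
  with re show thesis
    by (rule that)
qed

context parametrized_weights begin

text \<open>\<open>y\<close> has its minimum 0 at \<open>a\<close>, so its derivative vanishes. If
  that of \<open>x\<close> vanished too, differentiating the second identity of
  \<open>combination_zero\<close> at \<open>a\<close> would leave only \<open>h\<close> times the
  second derivative of \<open>numerator (point a)\<close>, which is nonzero.\<close>

lemma tangent_param:
  assumes a: "a \<in> A"
  shows "\<exists>r. r \<noteq> 0 \<and> ((\<lambda>t. point (a * cis t)) has_vector_derivative (r, 0)) (at 0)"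
proof -
  have c: "a \<in> unit_circle"
    using a circ by blast
  obtain r where r: "((\<lambda>t. fst (point (a * cis t))) has_vector_derivative r) (at 0)"
    "r = 0 \<Longrightarrow> poly (pderiv f) a = of_real (fst (point a)) * poly (pderiv h) a"
    by (rule derivative_along_circle[OF _ c, of h "\<lambda>u. fst (point u)" f]) (use param in auto)
  obtain s where s: "((\<lambda>t. snd (point (a * cis t))) has_vector_derivative s) (at 0)"
    "s = 0 \<Longrightarrow> poly (pderiv g) a = of_real (snd (point a)) * poly (pderiv h) a"
    by (rule derivative_along_circle[OF _ c, of h "\<lambda>u. snd (point u)" g]) (use param in auto)
  have "s = 0"
  proof (rule DERIV_local_min)
    show "((\<lambda>t. snd (point (a * cis t))) has_real_derivative s) (at 0)"
      using s(1) by (simp add: has_real_derivative_iff_has_vector_derivative)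
    show "\<forall>t. \<bar>0 - t\<bar> < 1 \<longrightarrow> snd (point (a * cis 0)) \<le> snd (point (a * cis t))"
      using snd_point(1)[of a] a point_in_square by (auto simp: unit_square_def mem_Times_iff)
  qed simp
  moreover have "r \<noteq> 0"
  proof
    assume "r = 0"
    have "poly (f * pderiv (pderiv numerator_x) + g * pderiv (pderiv numerator_y)
        + h * pderiv (pderiv (numerator (0, 0)))) a =
      poly (pderiv (f * pderiv numerator_x + g * pderiv numerator_y + h * pderiv (numerator (0, 0)))) a
      - (poly (pderiv f) a * poly (pderiv numerator_x) a + poly (pderiv g) a * poly (pderiv numerator_y) a
        + poly (pderiv h) a * poly (pderiv (numerator (0, 0))) a)"
      by (simp add: pderiv_add pderiv_mult algebra_simps)
    also have "\<dots> = - (poly (pderiv h) a * poly (pderiv (numerator (point a))) a)"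
      unfolding combination_zero r(2)[OF \<open>r = 0\<close>] s(2)[OF \<open>s = 0\<close>] numerator_affine[of "point a"]
      by (simp add: pderiv_add pderiv_smult algebra_simps)
    also have "poly (pderiv (numerator (point a))) a = 0"
      using combination_at(2)[OF combination_on_circle[OF c]] param(1)[OF c] unfolding combination_zero
      by simp
    finally have "poly h a * poly (pderiv (pderiv (numerator (point a)))) a = 0"
      unfolding numerator_affine[of "point a"]
      by (simp add: pderiv_add pderiv_smult combination_on_circle[OF c] algebra_simps)
    then show False
      using param(1)[OF c] numerator_A_double[OF a] by simp
  qed
  ultimately show ?thesis
    using has_vector_derivative_Pair[OF r(1) s(1)] by auto
qed

lemma genus_0_param: "real_algebraic_curve_of_genus (point ` unit_circle) 0"
proof (rule rational_curve_of_genus_0)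
  let ?n = "Max {Polynomial.degree f, Polynomial.degree g, Polynomial.degree h}"
  show "Polynomial.degree f \<le> ?n" "Polynomial.degree g \<le> ?n" "Polynomial.degree h \<le> ?n"
    by simp_all
  show "False" if "Polynomial.coeff f ?n = of_real x * Polynomial.coeff h ?n"
      "Polynomial.coeff g ?n = of_real y * Polynomial.coeff h ?n" for x y
    by (rule no_real_value_at_infinity[OF refl that])
  \<comment> \<open>A point outside the unit square.\<close>
  show "(- 1, 0) \<notin> point ` unit_circle"
    using point_in_square by (auto simp: unit_square_def) (metis atLeastAtMost_iff mem_Times_iff fst_conv neg_0_le_iff_le not_one_le_zero)
  obtain a b c where abc: "a \<in> A" "b \<in> C" "c \<in> D"
    using ne by blast
  show "emb [:0, 1:] \<in> function_field (emb f / emb h) (emb g / emb h)"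
    by (rule parameter[OF abc(1)])
  show "infinite (fst ` point ` unit_circle)"
  proof
    assume fin: "finite (fst ` point ` unit_circle)"
    have "connected (fst ` point ` unit_circle)"
      by (intro connected_continuous_image continuous_on_fst continuous_on_id continuous_on_point connected_sphere) simp
    moreover have "fst (point b) \<in> fst ` point ` unit_circle" "fst (point c) \<in> fst ` point ` unit_circle"
      using abc circ by blast+
    \<comment> \<open>\<open>x\<close> is 0 on \<open>C\<close> and 1 on \<open>D\<close>, so its
      connected image is uncountable.\<close>
    moreover have "fst (point b) \<noteq> fst (point c)"
      using fst_point(1)[of b] fst_point(2)[of c] abc by simp
    ultimately show False
      using connected_uncountable fin uncountable_infinite by blast
  qed
qed (use param real_value_on_circle in blast)+

end

context circular_weights begin

lemma obtain_parametrization: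
  obtains f g h where "parametrized_weights A B C D m f g h"
proof -
  obtain f g h where *: "\<And>u. u \<in> unit_circle \<Longrightarrow> poly h u \<noteq> 0 \<and> complex_of_real (fst (point u)) = poly f u / poly h u \<and>
      complex_of_real (snd (point u)) = poly g u / poly h u"
    "\<not> (\<exists>u. poly f u = 0 \<and> poly g u = 0 \<and> poly h u = 0)"
    using parametrization by blast
  have "parametrized_weights A B C D m f g h"
    by unfold_locales (use * in blast)+
  then show thesis
    by (rule that)
qed

lemma genus_0: "real_algebraic_curve_of_genus (point ` unit_circle) 0"
  by (rule obtain_parametrization) (rule parametrized_weights.genus_0_param)

lemma tangent_A: "a \<in> A \<Longrightarrow> \<exists>r. r \<noteq> 0 \<and> ((\<lambda>t. point (a * cis t)) has_vector_derivative (r, 0)) (at 0)"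
  by (rule obtain_parametrization) (rule parametrized_weights.tangent_param)

lemma rotated_derivative:
  assumes "((\<lambda>t. circular_weights.point C D B A m (\<gamma> t)) has_vector_derivative (r, s)) F"
  shows "((\<lambda>t. point (\<gamma> t)) has_vector_derivative (s, - r)) F"
proof -
  have "bounded_linear (\<lambda>q :: real \<times> real. (snd q, - fst q))"
    by (intro bounded_linear_Pair bounded_linear_snd bounded_linear_minus bounded_linear_fst)
  from bounded_linear.has_vector_derivative[OF this assms]
  have "((\<lambda>t. (0, 1) + (fst (point (\<gamma> t)), - (1 - snd (point (\<gamma> t))))) has_vector_derivative 0 + (s, - r)) F"
    by (intro has_vector_derivative_add has_vector_derivative_const) (simp add: point_rotated)
  then show ?thesis
    by simp
qed

lemma tangent_C: "a \<in> C \<Longrightarrow> \<exists>r. r \<noteq> 0 \<and> ((\<lambda>t. point (a * cis t)) has_vector_derivative (0, r)) (at 0)"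
proof -
  assume "a \<in> C"
  then obtain r where r: "r \<noteq> 0"
    "((\<lambda>t. circular_weights.point C D B A m (a * cis t)) has_vector_derivative (r, 0)) (at 0)"
    using circular_weights.tangent_A[OF rotated] by blast
  then show ?thesis
    using rotated_derivative[OF r(2)] by (intro exI[of _ "- r"]) simp
qed

lemma tangent_B: "a \<in> B \<Longrightarrow> \<exists>r. r \<noteq> 0 \<and> ((\<lambda>t. point (a * cis t)) has_vector_derivative (r, 0)) (at 0)"
proof -
  assume "a \<in> B"
  then obtain r where r: "r \<noteq> 0"
    "((\<lambda>t. circular_weights.point C D B A m (a * cis t)) has_vector_derivative (0, r)) (at 0)"
    using circular_weights.tangent_C[OF rotated] by blast
  then show ?thesis
    using rotated_derivative[OF r(2)] by (intro exI[of _ r]) simp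
qed

lemma tangent_D: "a \<in> D \<Longrightarrow> \<exists>r. r \<noteq> 0 \<and> ((\<lambda>t. point (a * cis t)) has_vector_derivative (0, r)) (at 0)"
proof -
  assume "a \<in> D"
  then obtain r where r: "r \<noteq> 0"
    "((\<lambda>t. circular_weights.point C D B A m (a * cis t)) has_vector_derivative (r, 0)) (at 0)"
    using circular_weights.tangent_B[OF rotated] by blast
  then show ?thesis
    using rotated_derivative[OF r(2)] by (intro exI[of _ "- r"]) simp
qed

text \<open>By the boundary values of the coordinates the curve meets a side only at the angles of
  one family, where the derivative is nonzero and parallel to that side.\<close>

lemma tangency:
  "{u \<in> unit_circle. tangent_to_side point u (0, 0) (1, 0)} = A"
  "{u \<in> unit_circle. tangent_to_side point u (0, 1) (1, 1)} = B"
  "{u \<in> unit_circle. tangent_to_side point u (0, 0) (0, 1)} = C"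
  "{u \<in> unit_circle. tangent_to_side point u (1, 0) (1, 1)} = D"
proof -
  have seg: "p \<in> closed_segment (0, c) (1, c) \<longleftrightarrow> 0 \<le> fst p \<and> fst p \<le> 1 \<and> snd p = c"
    "p \<in> closed_segment (c, 0) (c, 1) \<longleftrightarrow> fst p = c \<and> 0 \<le> snd p \<and> snd p \<le> 1"
    for p :: "real \<times> real" and c :: real
    by (cases p; auto simp: in_segment algebra_simps)+
  have sq: "0 \<le> fst (point u)" "fst (point u) \<le> 1" "0 \<le> snd (point u)" "snd (point u) \<le> 1" for u
    using point_in_square[of u] by (auto simp: unit_square_def mem_Times_iff)
  show "{u \<in> unit_circle. tangent_to_side point u (0, 0) (1, 0)} = A"
    "{u \<in> unit_circle. tangent_to_side point u (0, 1) (1, 1)} = B"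
    "{u \<in> unit_circle. tangent_to_side point u (0, 0) (0, 1)} = C"
    "{u \<in> unit_circle. tangent_to_side point u (1, 0) (1, 1)} = D"
    using tangent_A tangent_B tangent_C tangent_D circ
    by (auto simp: tangent_to_side_def seg sq snd_point fst_point)
qed

end

section \<open>Phases\<close>

text \<open>The image of the open disc is open by invariance of domain, and its closure is the
  compact image of the closed disc. The complement of a topological closed disc in the plane is
  connected and unbounded, so none of its points is inside the boundary curve.\<close>

lemma closed_disc_image:
  fixes f :: "complex \<Rightarrow> real \<times> real"
  assumes cont: "continuous_on (cball 0 1) f" and inj: "inj_on f (cball 0 1)"
  shows "\<exists>g. homeomorphism (ball 0 1) (f ` ball 0 1) f g"
    and "frontier (f ` ball 0 1) = f ` sphere 0 1"
    and "p \<notin> f ` cball 0 1 \<Longrightarrow> p \<notin> inside (f ` sphere 0 1)"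
proof -
  have cont': "continuous_on (ball 0 1) f" and inj': "inj_on f (ball 0 1)"
    using assms by (auto intro: continuous_on_subset inj_on_subset)
  show "\<exists>g. homeomorphism (ball 0 1) (f ` ball 0 1) f g"
    by (rule invariance_of_domain_homeomorphism[of "ball 0 1" f]) (use cont' inj' in auto)
  have op: "open (f ` ball 0 1)"
    by (rule invariance_of_domain_gen) (use cont' inj' in auto)
  have comp: "compact (f ` cball 0 1)"
    using cont by (intro compact_continuous_image) auto
  have "closure (f ` ball 0 1) = f ` cball 0 1"
  proof
    show "closure (f ` ball 0 1) \<subseteq> f ` cball 0 1"
      using comp by (intro closure_minimal) (auto simp: compact_imp_closed)
    have "f ` closure (ball 0 1) \<subseteq> closure (f ` ball 0 1)"
      using cont by (intro image_closure_subset) (auto intro: subsetD[OF closure_subset])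
    then show "f ` cball 0 1 \<subseteq> closure (f ` ball 0 1)"
      by simp
  qed
  then have "frontier (f ` ball 0 1) = f ` cball 0 1 - f ` ball 0 1"
    using op by (simp add: frontier_def interior_open)
  also have "\<dots> = f ` (cball 0 1 - ball 0 1)"
    using inj by (intro inj_on_image_set_diff[symmetric]) auto
  also have "cball 0 1 - ball 0 1 = (sphere 0 1 :: complex set)"
    by auto
  finally show "frontier (f ` ball 0 1) = f ` sphere 0 1" .
  assume p: "p \<notin> f ` cball 0 1"
  have "f ` cball 0 1 homeomorphic (cball 0 1 :: complex set)"
    using cont inj by (metis compact_cball homeomorphic_compact homeomorphic_sym)
  then have con: "connected (- (f ` cball 0 1))"
    by (intro connected_complement_homeomorphic_convex_compact[of _ "cball 0 1 :: complex set"]) auto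
  have sub: "- (f ` cball 0 1) \<subseteq> - (f ` sphere 0 1)"
    by auto
  have "- (f ` cball 0 1) \<subseteq> connected_component_set (- (f ` sphere 0 1)) p"
    using p con sub by (intro connected_component_maximal) auto
  moreover have "\<not> bounded (- (f ` cball 0 1))"
    using comp by (meson cobounded_imp_unbounded compact_imp_bounded bounded_subset double_complement)
  ultimately have "\<not> bounded (connected_component_set (- (f ` sphere 0 1)) p)"
    using bounded_subset by blast
  then show "p \<notin> inside (f ` sphere 0 1)"
    by (simp add: inside_def)
qed

section \<open>Zeros of the differential on the Riemann sphere\<close>

context circular_weights begin

definition critical_form :: "real \<times> real \<Rightarrow> complex \<Rightarrow> complex"
  where "critical_form p u = (\<Sum>a\<in>angles. of_real (charge p a) / (u - a))"

lemma critical_form_derivative: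
  assumes "u \<notin> angles"
  shows "(critical_form p has_field_derivative - (\<Sum>a\<in>angles. of_real (charge p a) / (u - a)\<^sup>2)) (at u)"
  unfolding critical_form_def[abs_def] sum_negf[symmetric]
proof (rule DERIV_sum)
  fix a assume "a \<in> angles"
  then have "u \<noteq> a"
    using assms by auto
  then show "((\<lambda>u. of_real (charge p a) / (u - a)) has_field_derivative - (of_real (charge p a) / (u - a)\<^sup>2)) (at u)"
    by (auto intro!: derivative_eq_intros simp: power2_eq_square)
qed

lemma tendsto_critical_form:
  assumes "cmod u \<noteq> 1"
  shows "(critical_form p \<longlongrightarrow> 0) (at u) \<longleftrightarrow> p = point u"
proof -
  have "u \<notin> angles"
    using angles_circle assms by auto
  then have "(critical_form p \<longlongrightarrow> critical_form p u) (at u)"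
    using critical_form_derivative DERIV_isCont isContD by blast
  then have "(critical_form p \<longlongrightarrow> 0) (at u) \<longleftrightarrow> critical_form p u = 0"
    using tendsto_unique[OF at_neq_bot] by metis
  then show ?thesis
    unfolding critical_form_def critical_off_circle[OF assms] .
qed

text \<open>In the coordinate \<open>w\<close> each term splits into \<open>r / w\<close> and
  \<open>r * a / (1 - a * w)\<close>. The poles cancel because the total charge is 0, and the limit
  at 0 is the first moment up to sign.\<close>

lemma tendsto_critical_form_infinity:
  assumes "((\<lambda>w. - critical_form p (1 / w) / w\<^sup>2) \<longlongrightarrow> 0) (at 0)"
  shows "p = point 0"
proof (rule balanced_0)
  define G where "G w = (\<Sum>a\<in>angles. of_real (charge p a) * (a / (1 - a * w)))" for w
  have form: "- critical_form p (1 / w) / w\<^sup>2 = - G w" if w: "w \<noteq> 0" "\<And>a. a \<in> angles \<Longrightarrow> 1 - a * w \<noteq> 0" for w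
  proof -
    have "of_real (charge p a) / (1 / w - a) / w\<^sup>2 = of_real (charge p a) / w + of_real (charge p a) * (a / (1 - a * w))"
      if "a \<in> angles" for a
    proof -
      have "1 / w - a = (1 - a * w) / w"
        using w(1) by (simp add: field_simps)
      then show ?thesis
        using w(1) w(2)[OF that] by (simp add: field_simps power2_eq_square)
    qed
    then have "critical_form p (1 / w) / w\<^sup>2 = (\<Sum>a\<in>angles. of_real (charge p a) / w) + G w"
      unfolding critical_form_def sum_divide_distrib G_def sum.distrib[symmetric] by (intro sum.cong refl)
    also have "(\<Sum>a\<in>angles. complex_of_real (charge p a) / w) = 0"
      using sum_charge_1[of p] by (simp flip: sum_divide_distrib of_real_sum)
    finally show ?thesis
      by simp
  qed
  have "\<forall>\<^sub>F w in at 0. w \<noteq> (0 :: complex) \<and> (\<forall>a\<in>angles. 1 - a * w \<noteq> 0)"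
  proof (intro eventually_conj eventually_ball_finite ballI finite_angles eventually_neq_at_within)
    fix a :: complex
    have "((\<lambda>w. 1 - a * w) \<longlongrightarrow> 1 - a * 0) (at 0)"
      by (intro tendsto_intros)
    then show "\<forall>\<^sub>F w in at (0 :: complex). 1 - a * w \<noteq> 0"
      by (rule tendsto_imp_eventually_ne) simp
  qed
  then have "\<forall>\<^sub>F w in at 0. - critical_form p (1 / w) / w\<^sup>2 = - G w"
    by eventually_elim (rule form; blast)
  then have "((\<lambda>w. - G w) \<longlongrightarrow> 0) (at 0)"
    using assms by (rule Lim_transform_eventually[rotated])
  moreover have "((\<lambda>w. - G w) \<longlongrightarrow> - G 0) (at 0)"
    unfolding G_def by (intro tendsto_intros) simp
  ultimately have "- G 0 = 0"
    using tendsto_unique[OF at_neq_bot] by blast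
  then show "(\<Sum>a\<in>angles. of_real (charge p a) * a) = 0"
    by (simp add: G_def)
qed

lemma double_critical_form:
  assumes "u \<in> unit_circle" "u \<notin> angles"
  shows "critical_form p u = 0 \<and> deriv (critical_form p) u = 0 \<longleftrightarrow> p = point u"
  unfolding DERIV_imp_deriv[OF critical_form_derivative[OF assms(2)]] neg_equal_0_iff_equal
  unfolding critical_form_def by (rule double_critical_on_circle[OF assms])

end

section \<open>From periodic sequences to weighted sets of angles\<close>

definition frequency :: "(nat \<Rightarrow> complex) \<Rightarrow> nat \<Rightarrow> complex \<Rightarrow> real"
  where "frequency s n a = real (card {j \<in> {1..n}. s j = a}) / real n"

lemma sum_frequency:
  fixes g :: "complex \<Rightarrow> 'b :: real_vector"
  assumes "finite S" "s ` {1..n} \<subseteq> S"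
  shows "(\<Sum>a\<in>S. frequency s n a *\<^sub>R g a) = (\<Sum>j = 1..n. g (s j)) /\<^sub>R real n"
proof -
  have "(\<Sum>j = 1..n. g (s j)) = (\<Sum>a\<in>S. \<Sum>j | j \<in> {1..n} \<and> s j = a. g (s j))"
    by (rule sum.group[symmetric]) (use assms in auto)
  also have "\<dots> = (\<Sum>a\<in>S. real (card {j \<in> {1..n}. s j = a}) *\<^sub>R g a)"
  proof (intro sum.cong refl)
    fix a
    have "(\<Sum>j | j \<in> {1..n} \<and> s j = a. g (s j)) = (\<Sum>j | j \<in> {1..n} \<and> s j = a. g a)"
      by (intro sum.cong refl) simp
    then show "(\<Sum>j | j \<in> {1..n} \<and> s j = a. g (s j)) = real (card {j \<in> {1..n}. s j = a}) *\<^sub>R g a"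
      by (simp add: scaleR_conv_of_real sum_constant_scaleR)
  qed
  finally show ?thesis
    by (simp add: scaleR_sum_right frequency_def divide_inverse mult.commute)
qed

text \<open>The sums of the action run over one period from 1 to \<open>n\<close>, the cyclic order
  condition over all indices.\<close>

lemma periodic_range:
  fixes s :: "nat \<Rightarrow> 'a"
  assumes n: "n \<ge> 1" and s: "\<forall>j. s (j + n) = s j"
  shows "range s = s ` {1..n}"
proof -
  have per: "s (j + k * n) = s j" for j k
  proof (induction k)
    case (Suc k)
    have "s (j + Suc k * n) = s (j + k * n + n)"
      by (simp add: algebra_simps)
    then show ?case
      using Suc s by simp
  qed simp
  have "s j \<in> s ` {1..n}" for j
  proof (cases "j mod n = 0")
    case True
    \<comment> \<open>Index 0 lies outside \<open>{1..n}\<close> and is represented by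
      \<open>n\<close>.\<close>
    have "s j = s 0"
      using per[of 0 "j div n"] True by (metis add.left_neutral add.right_neutral div_mult_mod_eq)
    also have "\<dots> = s n"
      using s[rule_format, of 0] by simp
    finally show ?thesis
      using n by auto
  next
    case False
    have "s j = s (j mod n)"
      using per[of "j mod n" "j div n"] by simp
    moreover have "j mod n \<in> {1..n}"
      using n False mod_less_divisor[of n j] by simp
    ultimately show ?thesis
      by blast
  qed
  then show ?thesis
    by auto
qed

lemma frequency_pos:
  assumes "n \<ge> 1" "a \<in> s ` {1..n}"
  shows "frequency s n a > 0"
proof -
  have "{j \<in> {1..n}. s j = a} \<noteq> {}"
    using assms by auto
  then have "card {j \<in> {1..n}. s j = a} > 0"
    by (simp add: card_gt_0_iff)
  then show ?thesis
    using assms by (simp add: frequency_def)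
qed

lemma frequency_0: "a \<notin> range s \<Longrightarrow> frequency s n a = 0"
  by (auto simp: frequency_def)

lemma ccw_order_distinct:
  assumes "ccw_order a b c d"
  shows "a \<noteq> b" "a \<noteq> c" "a \<noteq> d" "b \<noteq> c" "b \<noteq> d" "c \<noteq> d"
  using ccw_order_ori[OF assms] by (auto simp: ori_def algebra_simps)

text \<open>Under the cyclic order condition the ranges are disjoint, so at each angle only the
  frequency in its own family is nonzero.\<close>

definition angle_weight :: "fock_angles \<Rightarrow> complex \<Rightarrow> real"
  where "angle_weight W a = frequency (alpha W) (hper W) a + frequency (beta W) (hper W) a
    + frequency (gamma W) (vper W) a + frequency (delta W) (vper W) a"

lemma fock_circular_weights:
  assumes W: "periodic_fock_angles W"
  shows "circular_weights (range (alpha W)) (range (beta W)) (range (gamma W)) (range (delta W)) (angle_weight W)"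
    and "circular_weights.critical_form (range (alpha W)) (range (beta W)) (range (gamma W)) (range (delta W))
      (angle_weight W) = action' W"
proof -
  let ?A = "range (alpha W)" and ?B = "range (beta W)" and ?C = "range (gamma W)" and ?D = "range (delta W)"
  have per: "hper W \<ge> 1" "vper W \<ge> 1"
    and circ: "?A \<subseteq> unit_circle" "?B \<subseteq> unit_circle" "?C \<subseteq> unit_circle" "?D \<subseteq> unit_circle"
    and period: "\<forall>j. alpha W (j + hper W) = alpha W j" "\<forall>j. beta W (j + hper W) = beta W j"
      "\<forall>j. gamma W (j + vper W) = gamma W j" "\<forall>j. delta W (j + vper W) = delta W j"
    and ccw: "ccw_order (alpha W i) (gamma W j) (beta W k) (delta W l)" for i j k l
    using W by (auto simp: periodic_fock_angles_def)
  have r: "?A = alpha W ` {1..hper W}" "?B = beta W ` {1..hper W}"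
    "?C = gamma W ` {1..vper W}" "?D = delta W ` {1..vper W}"
    by (rule periodic_range, fact per, fact period)+
  have fin: "finite ?A" "finite ?B" "finite ?C" "finite ?D"
    unfolding r by simp_all
  note distinct = ccw_order_distinct[OF ccw]
  have m: "a \<in> ?A \<Longrightarrow> angle_weight W a = frequency (alpha W) (hper W) a"
    "a \<in> ?B \<Longrightarrow> angle_weight W a = frequency (beta W) (hper W) a"
    "a \<in> ?C \<Longrightarrow> angle_weight W a = frequency (gamma W) (vper W) a"
    "a \<in> ?D \<Longrightarrow> angle_weight W a = frequency (delta W) (vper W) a" for a
    unfolding angle_weight_def using distinct distinct[symmetric] by (auto simp: frequency_0 image_iff)
  have sum_m: "(\<Sum>a\<in>?A. angle_weight W a *\<^sub>R g a) = (\<Sum>j = 1..hper W. g (alpha W j)) /\<^sub>R real (hper W)"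
    "(\<Sum>a\<in>?B. angle_weight W a *\<^sub>R g a) = (\<Sum>j = 1..hper W. g (beta W j)) /\<^sub>R real (hper W)"
    "(\<Sum>a\<in>?C. angle_weight W a *\<^sub>R g a) = (\<Sum>j = 1..vper W. g (gamma W j)) /\<^sub>R real (vper W)"
    "(\<Sum>a\<in>?D. angle_weight W a *\<^sub>R g a) = (\<Sum>j = 1..vper W. g (delta W j)) /\<^sub>R real (vper W)"
    for g :: "complex \<Rightarrow> complex"
  proof -
    have *: "(\<Sum>a\<in>range s. angle_weight W a *\<^sub>R g a) = (\<Sum>j = 1..n. g (s j)) /\<^sub>R real n"
      if "finite (range s)" "\<And>a. a \<in> range s \<Longrightarrow> angle_weight W a = frequency s n a"
      for s :: "nat \<Rightarrow> complex" and n
    proof -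
      have "(\<Sum>a\<in>range s. angle_weight W a *\<^sub>R g a) = (\<Sum>a\<in>range s. frequency s n a *\<^sub>R g a)"
        by (intro sum.cong refl) (simp only: that(2))
      also have "\<dots> = (\<Sum>j = 1..n. g (s j)) /\<^sub>R real n"
        using that(1) by (intro sum_frequency) auto
      finally show ?thesis .
    qed
    show "(\<Sum>a\<in>?A. angle_weight W a *\<^sub>R g a) = (\<Sum>j = 1..hper W. g (alpha W j)) /\<^sub>R real (hper W)"
      "(\<Sum>a\<in>?B. angle_weight W a *\<^sub>R g a) = (\<Sum>j = 1..hper W. g (beta W j)) /\<^sub>R real (hper W)"
      "(\<Sum>a\<in>?C. angle_weight W a *\<^sub>R g a) = (\<Sum>j = 1..vper W. g (gamma W j)) /\<^sub>R real (vper W)"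
      "(\<Sum>a\<in>?D. angle_weight W a *\<^sub>R g a) = (\<Sum>j = 1..vper W. g (delta W j)) /\<^sub>R real (vper W)"
      by (rule * ; rule fin m; assumption)+
  qed
  show cw: "circular_weights ?A ?B ?C ?D (angle_weight W)"
  proof
    show "ccw_order a c b d" if "a \<in> ?A" "b \<in> ?B" "c \<in> ?C" "d \<in> ?D" for a b c d
      using that ccw by auto
    show "sum (angle_weight W) ?A = 1" "sum (angle_weight W) ?B = 1"
      "sum (angle_weight W) ?C = 1" "sum (angle_weight W) ?D = 1"
      using sum_m[of "\<lambda>_. 1"] per by (simp_all add: scaleR_conv_of_real flip: of_real_sum)
    show "angle_weight W a > 0" if a: "a \<in> ?A \<union> ?B \<union> ?C \<union> ?D" for a
    proof -
      consider "a \<in> ?A" | "a \<in> ?B" | "a \<in> ?C" | "a \<in> ?D"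
        using a by blast
      then show ?thesis
        by cases (simp only: m, rule frequency_pos; use per r in blast)+
    qed
  qed (fact fin circ | simp)+
  interpret circular_weights ?A ?B ?C ?D "angle_weight W"
    by (rule cw)
  show "critical_form = action' W"
  proof (intro ext)
    fix p u
    show "critical_form p u = action' W p u"
    proof -
      have *: "(\<Sum>j = 1..n. c / (u - s j)) = c * (\<Sum>j = 1..n. 1 / (u - s j))" for c n s
        by (simp add: sum_distrib_left)
      have "critical_form p u = (\<Sum>a\<in>angles. charge p a *\<^sub>R (1 / (u - a)))"
        by (simp add: critical_form_def scaleR_conv_of_real)
      also have "\<dots> = action' W p u"
        unfolding sum_charge sum_m
        unfolding action'_def case_prod_beta sum.distrib *[of "of_real _"] scaleR_conv_of_real
        by (simp add: divide_inverse algebra_simps)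
      finally show ?thesis .
    qed
  qed
qed

theorem proposition26:
  fixes W :: fock_angles
  assumes "periodic_fock_angles W"
  shows
    "(\<exists>\<Phi> \<Psi>. homeomorphism unit_disc (liquid_region W) \<Phi> \<Psi> \<and>
        (\<forall>u \<in> unit_disc. \<forall>p \<in> unit_square. critical_point W p (Some u) \<longleftrightarrow> p = \<Phi> u)) \<and>
     (\<exists>c :: complex \<Rightarrow> real \<times> real.
        continuous_on unit_circle c \<and>
        (\<forall>u \<in> unit_circle - angle_set W. \<forall>p.
           action' W p u = 0 \<and> deriv (action' W p) u = 0 \<longleftrightarrow> p = c u) \<and>
        (\<exists>f g h :: complex poly. \<forall>u \<in> unit_circle.
           poly h u \<noteq> 0 \<and>
           complex_of_real (fst (c u)) = poly f u / poly h u \<and>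
           complex_of_real (snd (c u)) = poly g u / poly h u) \<and>
        arctic_curve W = c ` unit_circle \<and>
        {u \<in> unit_circle. tangent_to_side c u (0, 0) (1, 0)} = range (alpha W) \<and>
        {u \<in> unit_circle. tangent_to_side c u (0, 1) (1, 1)} = range (beta W) \<and>
        {u \<in> unit_circle. tangent_to_side c u (0, 0) (0, 1)} = range (gamma W) \<and>
        {u \<in> unit_circle. tangent_to_side c u (1, 0) (1, 1)} = range (delta W) \<and>
        inj_on c (angle_set W)) \<and>
     components (arctic_curve W) = {arctic_curve W} \<and>
     real_algebraic_curve_of_genus (arctic_curve W) 0 \<and>
     gaseous_region W = {}"
proof -
  interpret circular_weights "range (alpha W)" "range (beta W)" "range (gamma W)" "range (delta W)" "angle_weight W"
    by (rule fock_circular_weights(1)[OF assms])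
  note form = fock_circular_weights(2)[OF assms]
  have angles: "angle_set W = angles"
    by (simp add: angle_set_def angles_def)
  have crit: "critical_point W p (Some u) \<longleftrightarrow> p = point u" if "cmod u \<noteq> 1" for p u
    using tendsto_critical_form[OF that, of p] by (simp add: form)
  have crit_inf: "p = point 0" if "critical_point W p None" for p
    using tendsto_critical_form_infinity[of p] that by (simp add: form)
  have liquid: "liquid_region W = point ` unit_disc"
  proof (intro equalityI subsetI)
    fix p assume "p \<in> liquid_region W"
    then obtain v where v: "critical_point W p v" "v \<notin> Some ` unit_circle"
      by (auto simp: liquid_region_def)
    show "p \<in> point ` unit_disc"
    proof (cases v)
      case None
      then show ?thesis
        using crit_inf[of p] v by (simp del: critical_point.simps)
    next
      case (Some u)
      then have u: "cmod u \<noteq> 1"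
        using v by auto
      then have p: "p = point u"
        using v crit[of u p] Some by blast
      show ?thesis
      proof (cases "cmod u < 1")
        case True
        then show ?thesis
          using p by simp
      next
        case False
        \<comment> \<open>A zero outside the disc is replaced by its reflection inside.\<close>
        then have "1 < cmod u"
          using u by simp
        then have "u \<noteq> 0" "1 / cnj u \<in> unit_disc"
          by (auto simp: norm_divide divide_less_eq)
        then have "p = point (1 / cnj u)" "1 / cnj u \<in> unit_disc"
          using p point_reflect[of u] u by simp_all
        then show ?thesis
          by blast
      qed
    qed
  next
    fix p assume "p \<in> point ` unit_disc"
    then obtain u where u: "cmod u < 1" "p = point u"
      by auto
    then have "critical_point W p (Some u)" "Some u \<notin> Some ` unit_circle"
      using crit[of u p] by (auto simp del: critical_point.simps)
    then show "p \<in> liquid_region W"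
      using u point_in_square unfolding liquid_region_def by blast
  qed
  note disc = closed_disc_image[OF continuous_on_point point_inj]
  have arctic: "arctic_curve W = point ` unit_circle"
    unfolding arctic_curve_def liquid by (rule disc(2))
  have "connected (point ` unit_circle)"
    by (intro connected_continuous_image continuous_on_point connected_sphere) simp
  moreover have "1 \<in> unit_circle"
    by simp
  ultimately have components: "components (arctic_curve W) = {arctic_curve W}"
    unfolding arctic components_eq_sing_iff by blast
  have cball_eq_union: "cball 0 1 = unit_circle \<union> unit_disc"
    by auto
  \<comment> \<open>A non-liquid point is frozen by definition, so it would be enclosed by the
    curve, the only component; but the disc bounded by the curve is the liquid region.\<close>
  have "gaseous_region W = {}"
  proof (rule ccontr)
    assume "gaseous_region W \<noteq> {}"
    then obtain p where p: "p \<in> unit_square" "p \<notin> liquid_region W"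
      "p \<notin> frozen_region W \<or> p \<in> inside (arctic_curve W)"
      unfolding gaseous_region_def components by auto
    then have "p \<in> inside (point ` unit_circle)"
      by (auto simp: liquid_region_def frozen_region_def arctic)
    moreover have "p \<notin> point ` unit_circle"
      using calculation inside_no_overlap by blast
    then have "p \<notin> point ` cball 0 1"
      using p(2) by (simp add: liquid cball_eq_union image_Un)
    ultimately show False
      using disc(3) by blast
  qed
  obtain \<Psi> where "homeomorphism unit_disc (liquid_region W) point \<Psi>"
    using disc(1) unfolding liquid by blast
  moreover have "\<forall>u \<in> unit_disc. \<forall>p \<in> unit_square. critical_point W p (Some u) \<longleftrightarrow> p = point u"
    using crit by auto
  moreover have "\<forall>u \<in> unit_circle - angle_set W. \<forall>p.
      action' W p u = 0 \<and> deriv (action' W p) u = 0 \<longleftrightarrow> p = point u"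
    using double_critical_form unfolding form angles by blast
  moreover have "\<exists>f g h. \<forall>u \<in> unit_circle. poly h u \<noteq> 0 \<and>
      complex_of_real (fst (point u)) = poly f u / poly h u \<and>
      complex_of_real (snd (point u)) = poly g u / poly h u"
    using parametrization by blast
  moreover have "inj_on point (angle_set W)"
    unfolding angles using point_inj by (rule inj_on_subset) (use angles_circle in auto)
  ultimately show ?thesis
    using continuous_on_point arctic tangency components genus_0 \<open>gaseous_region W = {}\<close>
    by (intro conjI exI[of _ point] exI[of _ \<Psi>]) simp_all
qed

end
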